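(* Let $(\Omega,\mathcal{A},\mu)$ be a complete probability space, let $T$ be a non-empty set, let $X \subseteq \mathbb{R}^T$ be a separable reproducing kernel Banach space, and let $\xi : T \times \Omega \to \mathbb{R}$ be a centered Gaussian process with covariance function $K$ and associated reproducing kernel Hilbert space $H(K) \subseteq \mathbb{R}^T$. (1) If $H(K) \subseteq X$ and the embedding $\iota : H(K) \to X$ is $\gamma$-radonifying, then there exists a centered Gaussian random element $\eta : \Omega \to X$ such that for every $t \in T$ one has $\xi_t = \eta_t$ $\mu$-almost surely. (2) If $H(K) \not\subseteq X$, or if the embedding $\iota : H(K) \to X$ is not $\gamma$-radonifying, then $$\mu(\{ \omega \in \Omega : \xi(\cdot,\omega) \in X \}) = 0.$$
   Context: All vector spaces are real. A Banach space $X$ that is a linear subspace of $\mathbb{R}^T$ (real functions on $T$) is a reproducing kernel Banach space if for every $t\in T$ the evaluation functional $\delta_t : X \to \mathbb{R}$, $x \mapsto x(t)$, is continuous. Random processes: a random process is a function $\xi : T\times\Omega\to\mathbb{R}$ such that $\xi_t := \xi(t,\cdot)$ is $\mathcal{A}$-measurable for each $t\in T$. It is a centered Gaussian process if $(\xi_t)_{t\in T_0}$ is a centered (possibly degenerate) Gaussian vector for each finite $T_0\subseteq T$; its covariance function is $K(s,t)=\int_\Omega \xi_s\xi_t\,d\mu$, which is a positive definite function, i.e. $\sum_{s,t\in T_0}c_sc_tK(s,t)\ge 0$ for all finite $T_0\subseteq T$ and real $(c_t)_{t\in T_0}$. $H(K)$: for positive definite $K:T\times T\to\mathbb{R}$,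 $H(K)\subseteq\mathbb{R}^T$ is the unique Hilbert space of functions on $T$ with $K(\cdot,t)\in H(K)$ for all $t \in T$ and $(x,K(\cdot,t))_{H(K)}=x(t)$ for all $x\in H(K)$, $t\in T$. When $H(K)\subseteq X$, $\iota:H(K)\to X$ is the inclusion (automatically continuous by the closed graph theorem). Gaussian random elements: a random element in $X$ is a map $\eta:\Omega\to X$ measurable with respect to $\mathcal{A}$ and the $\sigma$-algebra generated by $X^*$ (which equals the Borel $\sigma$-algebra since $X$ is separable). It is centered Gaussian if $f\circ\eta$ is a centered (possibly degenerate) Gaussian random variable for every $f\in X^*$. We write $\eta_t(\omega)=\eta(\omega)(t)$. $\gamma$-radonifying operators: let $H$ be a Hilbert space and $(\xi_k)$ a sequence of independent standard Gaussian random variables on some probability space, with expectation denoted $\mathbb{E}$. For a bounded linear $A:H\to X$ put $\|A\|_{\gamma_\infty(H,X)}=\sup\big(\mathbb{E}\|\sum_{k=1}^n\xi_kAh_k\|_X^2\big)^{1/2}$, the supremum being over all finite orthonormal systems $(h_k)_{k=1}^n$ in $H$; $\gamma_\infty(H,X)$ is the normed space of all $A$ for which this is finite. $A$ is $\gamma$-radonifying if it belongs to the closure in $\gamma_\infty(H,X)$ of the bounded finite-rank operators. *)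

theory Defs
  imports "HOL-Probability.Probability"
begin

text \<open>
  The index set \<open>T\<close> is the type \<open>'t\<close>.  A Banach space \<open>X\<close> of real functions on \<open>T\<close> is given by a
  type \<open>'x\<close> (its elements, carrying the norm of \<open>X\<close>) together with the map \<open>evl\<close> sending an element
  to the function that it is, so \<open>evl x t\<close> is \<open>x(t)\<close> and the linear subspace \<open>X\<close> of the space of all
  functions on \<open>T\<close> is \<open>range evl\<close>.  Linearity of \<open>evl\<close> is part of \<open>bounded_linear\<close>.
\<close>

definition rkbs :: "('x::banach \<Rightarrow> 't \<Rightarrow> real) \<Rightarrow> bool" where
  "rkbs evl \<longleftrightarrow> inj evl \<and> (\<forall>t. bounded_linear (\<lambda>x. evl x t))"

definition rkbs_space :: "('x::banach \<Rightarrow> 't \<Rightarrow> real) \<Rightarrow> ('t \<Rightarrow> real) set" where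
  "rkbs_space evl = range evl"

text \<open>The inclusion of a set of functions contained in \<open>X\<close>; only meaningful on \<open>rkbs_space evl\<close>.\<close>

definition rkbs_inclusion :: "('x::banach \<Rightarrow> 't \<Rightarrow> real) \<Rightarrow> ('t \<Rightarrow> real) \<Rightarrow> 'x" where
  "rkbs_inclusion evl h = (THE x. evl x = h)"


subsection \<open>Hilbert spaces of functions\<close>

text \<open>
  Since \<open>H(K)\<close> depends on the kernel, Hilbert spaces of functions are given by a carrier \<open>H\<close>
  and an inner product \<open>ip\<close>, whose values outside of \<open>H\<close> are irrelevant.
\<close>

definition function_subspace :: "('t \<Rightarrow> real) set \<Rightarrow> bool" where
  "function_subspace H \<longleftrightarrow>
     (\<lambda>s. 0) \<in> H \<and>
     (\<forall>x\<in>H. \<forall>y\<in>H. (\<lambda>s. x s + y s) \<in> H) \<and>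
     (\<forall>c. \<forall>x\<in>H. (\<lambda>s. c * x s) \<in> H)"

definition inner_product_on ::
  "('t \<Rightarrow> real) set \<Rightarrow> (('t \<Rightarrow> real) \<Rightarrow> ('t \<Rightarrow> real) \<Rightarrow> real) \<Rightarrow> bool" where
  "inner_product_on H ip \<longleftrightarrow>
     (\<forall>x\<in>H. \<forall>y\<in>H. ip x y = ip y x) \<and>
     (\<forall>x\<in>H. \<forall>y\<in>H. \<forall>z\<in>H. ip (\<lambda>s. x s + y s) z = ip x z + ip y z) \<and>
     (\<forall>c. \<forall>x\<in>H. \<forall>y\<in>H. ip (\<lambda>s. c * x s) y = c * ip x y) \<and>
     (\<forall>x\<in>H. 0 \<le> ip x x) \<and>
     (\<forall>x\<in>H. ip x x = 0 \<longrightarrow> x = (\<lambda>s. 0))"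

definition ip_norm :: "(('t \<Rightarrow> real) \<Rightarrow> ('t \<Rightarrow> real) \<Rightarrow> real) \<Rightarrow> ('t \<Rightarrow> real) \<Rightarrow> real" where
  "ip_norm ip x = sqrt (ip x x)"

definition ip_complete ::
  "('t \<Rightarrow> real) set \<Rightarrow> (('t \<Rightarrow> real) \<Rightarrow> ('t \<Rightarrow> real) \<Rightarrow> real) \<Rightarrow> bool" where
  "ip_complete H ip \<longleftrightarrow>
     (\<forall>u :: nat \<Rightarrow> 't \<Rightarrow> real.
        (\<forall>n. u n \<in> H) \<and>
        (\<forall>e>0. \<exists>N. \<forall>m\<ge>N. \<forall>n\<ge>N. ip_norm ip (\<lambda>s. u m s - u n s) < e) \<longrightarrow>
        (\<exists>x\<in>H. (\<lambda>n. ip_norm ip (\<lambda>s. u n s - x s)) \<longlonglongrightarrow> 0))"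

definition hilbert_function_space ::
  "('t \<Rightarrow> real) set \<Rightarrow> (('t \<Rightarrow> real) \<Rightarrow> ('t \<Rightarrow> real) \<Rightarrow> real) \<Rightarrow> bool" where
  "hilbert_function_space H ip \<longleftrightarrow>
     function_subspace H \<and> inner_product_on H ip \<and> ip_complete H ip"

text \<open>
  \<open>is_rkhs K H ip\<close> says that \<open>H\<close> with the inner product \<open>ip\<close> is the reproducing kernel Hilbert
  space \<open>H(K)\<close>; these properties determine \<open>H\<close>, and \<open>ip\<close> on \<open>H\<close>, uniquely.
\<close>

definition is_rkhs ::
  "('t \<Rightarrow> 't \<Rightarrow> real) \<Rightarrow> ('t \<Rightarrow> real) set \<Rightarrow>
     (('t \<Rightarrow> real) \<Rightarrow> ('t \<Rightarrow> real) \<Rightarrow> real) \<Rightarrow> bool" where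
  "is_rkhs K H ip \<longleftrightarrow>
     hilbert_function_space H ip \<and>
     (\<forall>t. (\<lambda>s. K s t) \<in> H) \<and>
     (\<forall>x\<in>H. \<forall>t. ip x (\<lambda>s. K s t) = x t)"


subsection \<open>Gaussian variables, processes and random elements\<close>

text \<open>The first disjunct is the degenerate Gaussian distribution.\<close>

definition centered_gaussian_rv :: "'w measure \<Rightarrow> ('w \<Rightarrow> real) \<Rightarrow> bool" where
  "centered_gaussian_rv M Y \<longleftrightarrow>
     Y \<in> borel_measurable M \<and>
     ((AE \<omega> in M. Y \<omega> = 0) \<or>
      (\<exists>\<sigma>>0. distributed M lborel Y (\<lambda>x. ennreal (normal_density 0 \<sigma> x))))"

text \<open>
  A finite family is a centered, possibly degenerate, Gaussian vector if all its linear
  combinations are centered, possibly degenerate, Gaussian random variables.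
\<close>

definition centered_gaussian_vector :: "'w measure \<Rightarrow> 't set \<Rightarrow> ('t \<Rightarrow> 'w \<Rightarrow> real) \<Rightarrow> bool" where
  "centered_gaussian_vector M T0 \<xi> \<longleftrightarrow>
     (\<forall>c :: 't \<Rightarrow> real. centered_gaussian_rv M (\<lambda>\<omega>. \<Sum>t\<in>T0. c t * \<xi> t \<omega>))"

definition centered_gaussian_process :: "'w measure \<Rightarrow> ('t \<Rightarrow> 'w \<Rightarrow> real) \<Rightarrow> bool" where
  "centered_gaussian_process M \<xi> \<longleftrightarrow>
     (\<forall>t. \<xi> t \<in> borel_measurable M) \<and>
     (\<forall>T0. finite T0 \<longrightarrow> centered_gaussian_vector M T0 \<xi>)"

definition covariance_function :: "'w measure \<Rightarrow> ('t \<Rightarrow> 'w \<Rightarrow> real) \<Rightarrow> 't \<Rightarrow> 't \<Rightarrow> real" where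
  "covariance_function M \<xi> s t = (\<integral>\<omega>. \<xi> s \<omega> * \<xi> t \<omega> \<partial>M)"

definition dual_sigma_algebra :: "'x::real_normed_vector measure" where
  "dual_sigma_algebra =
     sigma UNIV {f -` B | (f :: 'x \<Rightarrow> real) B. bounded_linear f \<and> B \<in> sets borel}"

definition centered_gaussian_element ::
  "'w measure \<Rightarrow> ('w \<Rightarrow> 'x::real_normed_vector) \<Rightarrow> bool" where
  "centered_gaussian_element M \<eta> \<longleftrightarrow>
     \<eta> \<in> measurable M dual_sigma_algebra \<and>
     (\<forall>f :: 'x \<Rightarrow> real. bounded_linear f \<longrightarrow> centered_gaussian_rv M (\<lambda>\<omega>. f (\<eta> \<omega>)))"


subsection \<open>Radonifying operators on Hilbert spaces of functions\<close>

definition bounded_operator_on ::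
  "('t \<Rightarrow> real) set \<Rightarrow> (('t \<Rightarrow> real) \<Rightarrow> ('t \<Rightarrow> real) \<Rightarrow> real) \<Rightarrow>
     (('t \<Rightarrow> real) \<Rightarrow> 'x::real_normed_vector) \<Rightarrow> bool" where
  "bounded_operator_on H ip A \<longleftrightarrow>
     (\<forall>x\<in>H. \<forall>y\<in>H. A (\<lambda>s. x s + y s) = A x + A y) \<and>
     (\<forall>c. \<forall>x\<in>H. A (\<lambda>s. c * x s) = c *\<^sub>R A x) \<and>
     (\<exists>C. \<forall>x\<in>H. norm (A x) \<le> C * ip_norm ip x)"

definition finite_rank_on :: "('t \<Rightarrow> real) set \<Rightarrow> (('t \<Rightarrow> real) \<Rightarrow> 'x::real_normed_vector) \<Rightarrow> bool" where
  "finite_rank_on H A \<longleftrightarrow> (\<exists>B. finite B \<and> A ` H \<subseteq> span B)"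

definition orthonormal_system ::
  "('t \<Rightarrow> real) set \<Rightarrow> (('t \<Rightarrow> real) \<Rightarrow> ('t \<Rightarrow> real) \<Rightarrow> real) \<Rightarrow>
     nat \<Rightarrow> (nat \<Rightarrow> 't \<Rightarrow> real) \<Rightarrow> bool" where
  "orthonormal_system H ip n h \<longleftrightarrow>
     (\<forall>k<n. h k \<in> H) \<and>
     (\<forall>j<n. \<forall>k<n. ip (h j) (h k) = (if j = k then 1 else 0))"

text \<open>
  The coordinates of this product space are the sequence of independent standard Gaussian random
  variables; the norm below depends only on their joint distribution.
\<close>

definition std_gaussian_sequence :: "(nat \<Rightarrow> real) measure" where
  "std_gaussian_sequence =
     PiM UNIV (\<lambda>_. density lborel (\<lambda>x. ennreal (std_normal_density x)))"

text \<open>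
  The integrand is always integrable, being dominated by the square of a finite sum of multiples
  of absolute values of Gaussian variables, so the real-valued integral is the expectation.
\<close>

definition gamma_values ::
  "('t \<Rightarrow> real) set \<Rightarrow> (('t \<Rightarrow> real) \<Rightarrow> ('t \<Rightarrow> real) \<Rightarrow> real) \<Rightarrow>
     (('t \<Rightarrow> real) \<Rightarrow> 'x::{banach,second_countable_topology}) \<Rightarrow> real set" where
  "gamma_values H ip A =
     {sqrt (\<integral>g. (norm (\<Sum>k<n. g k *\<^sub>R A (h k)))\<^sup>2 \<partial>std_gaussian_sequence) | n h.
        orthonormal_system H ip n h}"

definition gamma_norm ::
  "('t \<Rightarrow> real) set \<Rightarrow> (('t \<Rightarrow> real) \<Rightarrow> ('t \<Rightarrow> real) \<Rightarrow> real) \<Rightarrow>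
     (('t \<Rightarrow> real) \<Rightarrow> 'x::{banach,second_countable_topology}) \<Rightarrow> real" where
  "gamma_norm H ip A = Sup (gamma_values H ip A)"

definition gamma_infty ::
  "('t \<Rightarrow> real) set \<Rightarrow> (('t \<Rightarrow> real) \<Rightarrow> ('t \<Rightarrow> real) \<Rightarrow> real) \<Rightarrow>
     (('t \<Rightarrow> real) \<Rightarrow> 'x::{banach,second_countable_topology}) set" where
  "gamma_infty H ip = {A. bounded_operator_on H ip A \<and> bdd_above (gamma_values H ip A)}"

definition gamma_radonifying ::
  "('t \<Rightarrow> real) set \<Rightarrow> (('t \<Rightarrow> real) \<Rightarrow> ('t \<Rightarrow> real) \<Rightarrow> real) \<Rightarrow>
     (('t \<Rightarrow> real) \<Rightarrow> 'x::{banach,second_countable_topology}) \<Rightarrow> bool" where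
  "gamma_radonifying H ip A \<longleftrightarrow>
     A \<in> gamma_infty H ip \<and>
     (\<forall>e>0. \<exists>F\<in>gamma_infty H ip. finite_rank_on H F \<and> gamma_norm H ip (\<lambda>h. A h - F h) < e)"

end

theory Submission
  imports Defs
begin

text \<open>
  Countably many evaluations separate the points of \<open>X\<close> and embed it continuously and injectively
  into the sequences of reals.  By Lusin's separation theorem they generate the Borel sets of \<open>X\<close>,
  and their image is Borel; hence a Gaussian law on \<open>X\<close> is determined by the covariances
  of the coordinates.  All estimates come from this uniqueness: rotations of two independent copies
  give the zero-one law and the square integrability of the norm (Fernique), and for an orthogonal
  projection \<open>P\<close> of \<open>H(K)\<close> the isometry \<open>2 P - 1\<close> shows that the projection of a Gaussian element is
  bounded by the element itself in the \<open>L\<^sup>2\<close> norm.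

  If the paths lie in \<open>X\<close> with positive outer probability, then the zero-one law yields a random
  element \<open>\<eta>\<close> with \<open>\<eta>\<^sub>t = \<xi>\<^sub>t\<close>.  With \<open>Z h\<close> the Gaussian variable of \<open>h \<in> H(K)\<close>, the inclusion is
  \<open>\<iota> h = E (Z h \<eta>)\<close>; its \<open>\<gamma>\<close>-norm is at most the \<open>L\<^sup>2\<close> norm of \<open>\<eta>\<close>, and it is approximated by \<open>\<iota> P\<^sub>m\<close>
  with \<open>P\<^sub>m\<close> the projections onto finitely many kernel functions.  Conversely, if \<open>\<iota>\<close> is radonifying,
  then \<open>\<Sum>k. Z (e k) \<iota> (e k)\<close> converges in \<open>L\<^sup>2\<close> for an orthonormal basis \<open>e\<close>, and its sum is \<open>\<eta>\<close>.
\<close>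

text \<open>The event in (2) involves all coordinates of a path and need not be measurable. It is
  enclosed in the measurable event that the coordinates along a separating sequence come from an
  element of \<open>X\<close>. Such an event says nothing about the other coordinates, so the
  zero-one law is applied to every separating sequence: a fixed one determines \<eta>, and
  prepending an index to it compares \<eta> with \<xi> there. The exceptional null set depends on
  the index, as the claim allows.

  Projections of \<open>H(K)\<close> are not operators on \<open>X\<close>; they act on the index of
  \<open>Z\<close> only. Their effect on the norm of \<open>X\<close> is reached through equality of
  laws, which requires that the chosen coordinates generate all Borel sets of \<open>X\<close>.
  Convergence of the finite-dimensional projections of \<eta> would usually be a martingale
  statement; here the reflection takes the place of conditional expectations.\<close>

section \<open>Continuous injections of Polish spaces\<close>

text \<open>Two closed sets that cannot be separated contain inseparable closed parts of arbitrarily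
  small diameter; these shrink to two points, whose images have disjoint neighbourhoods.\<close>

lemma borel_separation_closed:
  fixes \<phi> :: "'a::{complete_space,second_countable_topology} \<Rightarrow> 'b::t2_space"
  assumes cont: "continuous_on UNIV \<phi>" and inj: "inj \<phi>"
    and P: "closed P" and Q: "closed Q" and PQ: "P \<inter> Q = {}"
  shows "\<exists>D\<in>sets borel. P \<subseteq> \<phi> -` D \<and> Q \<inter> \<phi> -` D = {}"
proof (rule ccontr)
  define sep where "sep P Q \<longleftrightarrow> (\<exists>D\<in>sets (borel :: 'b measure). P \<subseteq> \<phi> -` D \<and> Q \<inter> \<phi> -` D = {})" for P Q
  have sep_empty: "sep {} Q" "sep P {}" for P Q
    unfolding sep_def by (auto intro: bexI[of _ "{}"] bexI[of _ UNIV])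
  \<comment> \<open>If \<open>D i j\<close> separates \<open>P \<inter> C i\<close> from
    \<open>Q \<inter> C j\<close>, then \<open>\<Union>i. \<Inter>j. D i j\<close> separates
    \<open>P\<close> from \<open>Q\<close>. Read contrapositively: an inseparable pair contains an
    inseparable pair of pieces of any prescribed size.\<close>
  have sep_Un: "sep P Q" if C: "\<And>i j :: nat. sep (P \<inter> C i) (Q \<inter> C j)" "(\<Union>i. C i) = UNIV" for P Q C
  proof -
    from C(1) obtain D where D: "D i j \<in> sets borel" "P \<inter> C i \<subseteq> \<phi> -` D i j" "(Q \<inter> C j) \<inter> \<phi> -` D i j = {}" for i j
      unfolding sep_def by metis
    show ?thesis unfolding sep_def
    proof (intro bexI conjI)
      show "(\<Union>i. \<Inter>j. D i j) \<in> sets borel" using D(1) by auto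
      show "P \<subseteq> \<phi> -` (\<Union>i. \<Inter>j. D i j)" using D(2) C(2) by fastforce
      show "Q \<inter> \<phi> -` (\<Union>i. \<Inter>j. D i j) = {}" using D(3) C(2) by fastforce
    qed
  qed
  obtain S :: "'a set" where S: "countable S" "\<And>X. open X \<Longrightarrow> X \<noteq> {} \<Longrightarrow> \<exists>d\<in>S. d \<in> X"
    using countable_dense_exists by blast
  have "S \<noteq> {}" using S(2)[of UNIV] by auto
  define C where "C k i = cball (from_nat_into S i) ((1/2)^k)" for k i :: nat
  have UC: "(\<Union>i. C k i) = UNIV" for k
  proof (rule set_eqI, simp)
    fix x :: 'a
    obtain d where "d \<in> S" "d \<in> ball x ((1/2)^k)" using S(2)[of "ball x ((1/2)^k)"] by (auto simp: not_le)
    moreover then obtain i where "from_nat_into S i = d" using from_nat_into_surj[OF S(1)] by blast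
    ultimately show "\<exists>i. x \<in> C k i" unfolding C_def by (auto simp: dist_commute intro!: exI[of _ i])
  qed
  have step: "\<exists>P' Q'. P' \<subseteq> P \<and> Q' \<subseteq> Q \<and> closed P' \<and> closed Q' \<and> \<not> sep P' Q' \<and> 
      (\<exists>a. P' \<subseteq> cball a ((1/2)^k)) \<and> (\<exists>b. Q' \<subseteq> cball b ((1/2)^k))"
    if cl: "closed P" "closed Q" and ns': "\<not> sep P Q" for P Q k
  proof -
    obtain i j where "\<not> sep (P \<inter> C k i) (Q \<inter> C k j)" using sep_Un[where P=P and Q=Q and C="C k"] UC[of k] ns' by metis
    then show ?thesis using cl
      by (intro exI[of _ "P \<inter> C k i"] exI[of _ "Q \<inter> C k j"]) (auto simp: C_def)
  qed
  define I where "I k X \<longleftrightarrow> fst X \<subseteq> P \<and> snd X \<subseteq> Q \<and> closed (fst X) \<and> closed (snd X) \<and> \<not> sep (fst X) (snd X)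
    \<and> (\<exists>a. fst X \<subseteq> cball a ((1/2)^k)) \<and> (\<exists>b. snd X \<subseteq> cball b ((1/2)^k))" for k :: nat and X
  assume "\<not> (\<exists>D\<in>sets borel. P \<subseteq> \<phi> -` D \<and> Q \<inter> \<phi> -` D = {})"
  then have ns: "\<not> sep P Q" unfolding sep_def by simp
  have "\<exists>f. \<forall>k. I k (f k) \<and> (fst (f (Suc k)) \<subseteq> fst (f k) \<and> snd (f (Suc k)) \<subseteq> snd (f k))"
  proof (rule dependent_nat_choice)
    show "\<exists>X. I 0 X" using step[OF P Q ns, of 0] unfolding I_def by auto
    fix X k assume X: "I k X"
    obtain P' Q' where "P' \<subseteq> fst X" "Q' \<subseteq> snd X" "closed P'" "closed Q'" "\<not> sep P' Q'"
      "\<exists>a. P' \<subseteq> cball a ((1/2)^Suc k)" "\<exists>b. Q' \<subseteq> cball b ((1/2)^Suc k)"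
      using step[of "fst X" "snd X" "Suc k"] X unfolding I_def by blast
    then show "\<exists>Y. I (Suc k) Y \<and> fst Y \<subseteq> fst X \<and> snd Y \<subseteq> snd X"
      using X by (intro exI[of _ "(P', Q')"]) (auto simp: I_def)
  qed
  then obtain f where f: "\<And>k. I k (f k)" "\<And>k. fst (f (Suc k)) \<subseteq> fst (f k)" "\<And>k. snd (f (Suc k)) \<subseteq> snd (f k)"
    by blast
  have nest: "\<exists>p. \<forall>n. p \<in> F n" if F: "\<And>n. closed (F n)" "\<And>n. F n \<noteq> {}" "\<And>n. F (Suc n) \<subseteq> F n"
      "\<And>n. \<exists>a. F n \<subseteq> cball a ((1/2)^n)" for F :: "nat \<Rightarrow> 'a set"
  proof -
    have "\<exists>n. \<forall>x\<in>F n. \<forall>y\<in>F n. dist x y < e" if e: "e > 0" for e :: real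
    proof -
      obtain n where n: "(1/2::real)^n < e/2" using real_arch_pow_inv[of "e/2" "1/2"] e by auto
      obtain a where a: "F n \<subseteq> cball a ((1/2)^n)" using F(4) by blast
      have "dist x y < e" if xy: "x \<in> F n" "y \<in> F n" for x y
      proof -
        have "dist a x \<le> (1/2)^n" "dist a y \<le> (1/2)^n" using a xy by (auto simp: subset_iff)
        then show ?thesis using n dist_triangle3[of x y a] by linarith
      qed
      then show ?thesis by blast
    qed
    moreover have "F n \<subseteq> F m" if "m \<le> n" for m n using lift_Suc_antimono_le[of F m n] F(3) that by blast
    ultimately show ?thesis using decreasing_closed_nest[of F] F(1,2) by metis
  qed
  have small: "\<exists>n. F n \<subseteq> U" if F: "\<And>n. p \<in> F n" "\<And>n. \<exists>a. F n \<subseteq> cball a ((1/2)^n)" and U: "open U" "p \<in> U"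
    for F :: "nat \<Rightarrow> 'a set" and U p
  proof -
    obtain e where e: "e > 0" "ball p e \<subseteq> U" using U openE by blast
    obtain n where n: "(1/2::real)^n < e/2" using real_arch_pow_inv[of "e/2" "1/2"] e(1) by auto
    obtain a where a: "F n \<subseteq> cball a ((1/2)^n)" using F(2) by blast
    have "x \<in> U" if x: "x \<in> F n" for x
    proof -
      have "dist a x \<le> (1/2)^n" "dist a p \<le> (1/2)^n" using a x F(1)[of n] by (auto simp: subset_iff)
      then have "dist p x < e" using n dist_triangle3[of p x a] by linarith
      then show ?thesis using e(2) by auto
    qed
    then show ?thesis by blast
  qed
  have "fst (f n) \<noteq> {}" "snd (f n) \<noteq> {}" for n using f(1)[of n] sep_empty unfolding I_def by metis+
  moreover have "\<exists>a. fst (f n) \<subseteq> cball a ((1/2)^n)" "\<exists>a. snd (f n) \<subseteq> cball a ((1/2)^n)"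
    "closed (fst (f n))" "closed (snd (f n))" for n
    using f(1)[of n] unfolding I_def by blast+
  note fI = this
  ultimately have "\<exists>p. \<forall>n. p \<in> fst (f n)" "\<exists>q. \<forall>n. q \<in> snd (f n)"
    by (intro nest f(2,3) fI; simp)+
  then obtain p q where p: "\<And>n. p \<in> fst (f n)" and q: "\<And>n. q \<in> snd (f n)" by blast
  have "p \<in> P" "q \<in> Q" using p q f(1)[of 0] unfolding I_def by auto
  then have "p \<noteq> q" using PQ by auto
  then have "\<phi> p \<noteq> \<phi> q" using inj by (simp add: inj_eq)
  then obtain U V where UV: "open U" "open V" "\<phi> p \<in> U" "\<phi> q \<in> V" "U \<inter> V = {}"
    by (auto dest!: hausdorff)
  have "open (\<phi> -` U)" "open (\<phi> -` V)" using cont UV by (auto simp: continuous_on_open_vimage)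
  then have "\<exists>n. fst (f n) \<subseteq> \<phi> -` U" "\<exists>m. snd (f m) \<subseteq> \<phi> -` V"
    using UV p q fI by (intro small[where p=p] small[where p=q]; simp)+
  then obtain n m where "fst (f n) \<subseteq> \<phi> -` U" "snd (f m) \<subseteq> \<phi> -` V" by blast
  moreover have "fst (f (max n m)) \<subseteq> fst (f n)" "snd (f (max n m)) \<subseteq> snd (f m)"
    using lift_Suc_antimono_le[of "\<lambda>n. fst (f n)" n "max n m"] lift_Suc_antimono_le[of "\<lambda>n. snd (f n)" m "max n m"] f(2,3) by auto
  ultimately have "sep (fst (f (max n m))) (snd (f (max n m)))"
    unfolding sep_def using UV by (intro bexI[of _ U]) auto
  then show False using f(1)[of "max n m"] unfolding I_def by blast
qed

text \<open>An open set is the union of the closed sets of points at distance at least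
  \<open>1 / Suc n\<close> from its complement. Separating the complement from each of them by a
  Borel set and taking the union of the complements of these Borel sets gives a set whose preimage
  is exactly the open set; open sets generate the rest.\<close>

lemma borel_eq_vimage_continuous_inj:
  fixes \<phi> :: "'a::{complete_space,second_countable_topology} \<Rightarrow> 'b::t2_space"
  assumes cont: "continuous_on UNIV \<phi>" and inj: "inj \<phi>" and B: "B \<in> sets borel"
  shows "\<exists>D\<in>sets borel. B = \<phi> -` D"
proof -
  have closed: "\<exists>D\<in>sets borel. U = \<phi> -` D" if U: "open U" for U :: "'a set"
  proof (cases "U = UNIV")
    case True then show ?thesis by (intro bexI[of _ UNIV]) auto
  next
    case False
    define C where "C = - U"
    have C: "closed C" "C \<noteq> {}" using U False by (auto simp: C_def)
    define Q where "Q n = {x. infdist x C \<ge> 1 / Suc n}" for n :: nat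
    have "closed (Q n)" for n unfolding Q_def by (intro closed_Collect_le continuous_intros)
    moreover have "C \<inter> Q n = {}" for n unfolding Q_def by (auto simp: infdist_zero not_le)
    ultimately have "\<exists>D\<in>sets borel. C \<subseteq> \<phi> -` D \<and> Q n \<inter> \<phi> -` D = {}" for n
      by (intro borel_separation_closed[OF cont inj C(1)])
    then obtain D where D: "D n \<in> sets borel" "C \<subseteq> \<phi> -` D n" "Q n \<inter> \<phi> -` D n = {}" for n by metis
    have UQ: "U = (\<Union>n. Q n)"
    proof (intro set_eqI iffI)
      fix x assume "x \<in> U"
      then have "x \<notin> C" by (simp add: C_def)
      then have "infdist x C \<noteq> 0" using C in_closed_iff_infdist_zero[of C x] by simp
      then have "infdist x C > 0" using infdist_nonneg[of x C] by linarith
      then obtain n where "inverse (real (Suc n)) < infdist x C" using reals_Archimedean by blast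
      then show "x \<in> (\<Union>n. Q n)" by (auto simp: Q_def inverse_eq_divide intro!: exI[of _ n])
    next
      fix x assume "x \<in> (\<Union>n. Q n)"
      then obtain n where "1 / Suc n \<le> infdist x C" by (auto simp: Q_def)
      then have "infdist x C \<noteq> 0" by (metis divide_pos_pos not_le of_nat_0_less_iff zero_less_Suc zero_less_one)
      then show "x \<in> U" using infdist_zero[of x C] unfolding C_def by blast
    qed
    show ?thesis
    proof (intro bexI)
      show "(\<Union>n. - D n) \<in> sets borel" using D(1) by (auto simp: Compl_eq_Diff_UNIV)
      show "U = \<phi> -` (\<Union>n. - D n)" using D(2,3) UQ unfolding C_def by fastforce
    qed
  qed
  have "(\<lambda>x. x) \<in> borel_measurable (vimage_algebra UNIV \<phi> borel)"
  proof (rule borel_measurableI)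
    fix S :: "'a set" assume "open S"
    then show "(\<lambda>x. x) -` S \<inter> space (vimage_algebra UNIV \<phi> borel) \<in> sets (vimage_algebra UNIV \<phi> borel)"
      using closed[of S] by (auto simp: sets_vimage_algebra2)
  qed
  then have "B \<in> sets (vimage_algebra UNIV \<phi> borel)" using measurable_sets[OF _ B, of "\<lambda>x. x" "vimage_algebra UNIV \<phi> borel"] by simp
  then show ?thesis by (auto simp: sets_vimage_algebra2)
qed

text \<open>The Lusin-Souslin theorem. A point \<open>y\<close> of \<open>W\<close> selects for
  every \<open>n\<close> a ball of radius \<open>(1/2)^n\<close> such that \<open>y\<close> is in
  the closure of its image, and the set removed in \<open>W\<close> forces the selected balls to
  meet pairwise. Points of these balls with images near \<open>y\<close> form a Cauchy sequence, and
  continuity sends its limit to \<open>y\<close>. Injectivity enters through the sets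
  \<open>D n i\<close>, whose preimages are exactly the balls.\<close>

lemma borel_range_continuous_inj:
  fixes \<phi> :: "'a::{complete_space,second_countable_topology} \<Rightarrow> 'b::metric_space"
  assumes cont: "continuous_on UNIV \<phi>" and inj: "inj \<phi>"
  shows "range \<phi> \<in> sets borel"
proof -
  obtain S :: "'a set" where S: "countable S" "\<And>X. open X \<Longrightarrow> X \<noteq> {} \<Longrightarrow> \<exists>d\<in>S. d \<in> X"
    using countable_dense_exists by blast
  have "S \<noteq> {}" using S(2)[of UNIV] by auto
  define E where "E n i = ball (from_nat_into S i) ((1/2)^n)" for n i :: nat
  have UE: "\<exists>i. x \<in> E n i" for n x
  proof -
    obtain d where "d \<in> S" "d \<in> ball x ((1/2)^n)" using S(2)[of "ball x ((1/2)^n)"] by (auto simp: not_le)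
    moreover then obtain i where "from_nat_into S i = d" using from_nat_into_surj[OF S(1)] by blast
    ultimately show ?thesis unfolding E_def by (auto simp: dist_commute intro!: exI[of _ i])
  qed
  have "\<exists>D\<in>sets borel. E n i = \<phi> -` D" for n i
    by (rule borel_eq_vimage_continuous_inj[OF cont inj]) (simp add: E_def)
  then obtain D where D: "D n i \<in> sets borel" "E n i = \<phi> -` D n i" for n i by metis
  define D' where "D' n i = D n i \<inter> closure (\<phi> ` E n i)" for n i
  define W where "W = (\<Inter>n. \<Union>i. D' n i) - (\<Union>n i m j. if E n i \<inter> E m j = {} then D n i \<inter> D m j else {})"
  have D'm: "D' n i \<in> sets borel" for n i using D(1) by (auto simp: D'_def)
  have "W \<in> sets borel" unfolding W_def using D'm D(1) by (intro sets.Diff sets.countable_INT' sets.countable_UN) auto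
  moreover have "W = range \<phi>"
  proof (intro set_eqI iffI)
    fix y assume "y \<in> range \<phi>"
    then obtain x where y: "y = \<phi> x" by blast
    have "\<exists>i. y \<in> D' n i" for n using UE[of x n] D(2) closure_subset unfolding y D'_def by fastforce
    moreover have "y \<notin> D n i \<inter> D m j" if "E n i \<inter> E m j = {}" for n i m j using that D(2) y by blast
    ultimately show "y \<in> W" unfolding W_def by (auto split: if_splits)
  next
    fix y assume y: "y \<in> W"
    then have "\<forall>n. \<exists>i. y \<in> D' n i" by (auto simp: W_def)
    then obtain i where i: "y \<in> D' n (i n)" for n by metis
    have ne: "E n (i n) \<inter> E m (i m) \<noteq> {}" for n m
    proof
      assume "E n (i n) \<inter> E m (i m) = {}"
      moreover have "y \<in> D n (i n) \<inter> D m (i m)" using i by (auto simp: D'_def)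
      ultimately have "y \<in> (\<Union>n i m j. if E n i \<inter> E m j = {} then D n i \<inter> D m j else {})"
        by (intro UN_I[of n] UN_I[of "i n"] UN_I[of m] UN_I[of "i m"]) auto
      then show False using y by (auto simp: W_def)
    qed
    have "\<exists>x. x \<in> E n (i n) \<and> dist (\<phi> x) y < (1/2)^n" for n
    proof -
      have "\<forall>\<epsilon>>0. \<exists>ya\<in>E n (i n). dist (\<phi> ya) y < \<epsilon>"
        using i[of n] closure_approachable[of y "\<phi> ` E n (i n)"] by (auto simp: D'_def)
      from this[rule_format, of "(1/2)^n"] show ?thesis by auto
    qed
    then obtain x where x: "x n \<in> E n (i n)" "dist (\<phi> (x n)) y < (1/2)^n" for n by metis
    have dx: "dist (x n) (x m) < 2 * (1/2)^n + 2 * (1/2)^m" for n m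
    proof -
      obtain z where z: "z \<in> E n (i n)" "z \<in> E m (i m)" using ne by blast
      have "dist (x n) z < 2 * (1/2)^n" using x(1)[of n] z(1) dist_triangle3[of "x n" z "from_nat_into S (i n)"] by (auto simp: E_def)
      moreover have "dist (x m) z < 2 * (1/2)^m" using x(1)[of m] z(2) dist_triangle3[of "x m" z "from_nat_into S (i m)"] by (auto simp: E_def)
      ultimately show ?thesis using dist_triangle2[of "x n" "x m" z] by linarith
    qed
    have "Cauchy x"
    proof (rule metric_CauchyI)
      fix e :: real assume e: "e > 0"
      obtain N where N: "(1/2::real)^N < e/4" using real_arch_pow_inv[of "e/4" "1/2"] e by auto
      have "dist (x m) (x n) < e" if "m \<ge> N" "n \<ge> N" for m n
      proof -
        have "(1/2::real)^m \<le> (1/2)^N" "(1/2::real)^n \<le> (1/2)^N" using that by (auto intro!: power_decreasing)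
        then show ?thesis using dx[of m n] N by linarith
      qed
      then show "\<exists>N. \<forall>m\<ge>N. \<forall>n\<ge>N. dist (x m) (x n) < e" by blast
    qed
    then obtain l where l: "x \<longlonglongrightarrow> l" using Cauchy_convergent_iff convergent_def by blast
    have "(\<lambda>n. \<phi> (x n)) \<longlonglongrightarrow> \<phi> l" using continuous_on_tendsto_compose[OF cont l] by simp
    moreover have "(\<lambda>n. \<phi> (x n)) \<longlonglongrightarrow> y"
      unfolding tendsto_dist_iff[of _ y]
      by (rule tendsto_sandwich[of "\<lambda>_. 0" _ _ "\<lambda>n. (1/2)^n"]) (auto intro!: always_eventually less_imp_le x(2) LIMSEQ_power_zero)
    ultimately show "y \<in> range \<phi>" using LIMSEQ_unique by blast
  qed
  ultimately show ?thesis by simp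
qed

section \<open>Gaussian laws and characteristic functions\<close>

text \<open>This prepares uniqueness under a change of measure. \<open>W / m\<close> is a
  probability density, and the phase \<open>- pi/2\<close> turns the cosine into a sine, so cosine
  integrals with arbitrary phase carry both parts of the characteristic function.\<close>

lemma (in prob_space) real_distribution_weighted:
  fixes W Y :: "'a \<Rightarrow> real"
  assumes [measurable]: "W \<in> borel_measurable M" "Y \<in> borel_measurable M"
    and nn: "\<And>\<omega>. 0 \<le> W \<omega>" and bd: "\<And>\<omega>. W \<omega> \<le> b" and m: "expectation W = m" "m > 0"
  defines "P \<equiv> distr (density M (\<lambda>\<omega>. ennreal (W \<omega> / m))) borel Y"
  shows "real_distribution P"
    and "B \<in> sets borel \<Longrightarrow> measure P B = (\<integral>\<omega>. W \<omega> * indicator B (Y \<omega>) \<partial>M) / m"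
    and "char P s = Complex (\<integral>\<omega>. W \<omega> * cos (s * Y \<omega> + 0) \<partial>M) (\<integral>\<omega>. W \<omega> * cos (s * Y \<omega> + (- pi/2)) \<partial>M) / of_real m"
proof -
  have iW: "integrable M (\<lambda>\<omega>. W \<omega> * g \<omega>)" if [measurable]: "g \<in> borel_measurable M" and "\<And>\<omega>. \<bar>g \<omega>\<bar> \<le> 1" for g :: "'a \<Rightarrow> real"
  proof (rule integrable_const_bound[where B=b])
    show "AE x in M. norm (W x * g x) \<le> b"
    proof (rule AE_I2)
      fix x
      have "\<bar>W x\<bar> * \<bar>g x\<bar> \<le> b * 1" using nn[of x] bd[of x] that(2)[of x] by (intro mult_mono) auto
      then show "norm (W x * g x) \<le> b" by (simp add: abs_mult)
    qed
  qed simp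
  have mp: "m \<noteq> 0" using m by simp
  interpret D: prob_space "density M (\<lambda>\<omega>. ennreal (W \<omega> / m))"
  proof
    have "emeasure (density M (\<lambda>\<omega>. ennreal (W \<omega> / m))) (space M) = (\<integral>\<^sup>+\<omega>. ennreal (W \<omega> / m) \<partial>M)"
      by (subst emeasure_density) (auto intro!: nn_integral_cong)
    also have "\<dots> = ennreal (\<integral>\<omega>. W \<omega> / m \<partial>M)"
      using iW[of "\<lambda>_. 1/m"] iW[of "\<lambda>_. 1"] nn m by (intro nn_integral_eq_integral) auto
    also have "\<dots> = 1" using m by simp
    finally show "emeasure (density M (\<lambda>\<omega>. ennreal (W \<omega> / m))) (space (density M (\<lambda>\<omega>. ennreal (W \<omega> / m)))) = 1" by simp
  qed
  show "real_distribution P" unfolding P_def by (rule D.real_distribution_distr) simp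
  show "measure P B = (\<integral>\<omega>. W \<omega> * indicator B (Y \<omega>) \<partial>M) / m" if [measurable]: "B \<in> sets borel"
  proof -
    have "measure P B = (\<integral>x. indicator B x \<partial>P)" using that by (simp add: P_def)
    also have "\<dots> = (\<integral>\<omega>. indicator B (Y \<omega>) \<partial>density M (\<lambda>\<omega>. ennreal (W \<omega> / m)))"
      unfolding P_def by (subst integral_distr) auto
    also have "\<dots> = (\<integral>\<omega>. W \<omega> / m * indicator B (Y \<omega>) \<partial>M)"
      by (subst integral_density) (auto simp: nn m less_imp_le)
    also have "\<dots> = (\<integral>\<omega>. W \<omega> * indicator B (Y \<omega>) \<partial>M) / m" by simp
    finally show ?thesis .
  qed
  have "char P s = (CLINT \<omega>|density M (\<lambda>\<omega>. ennreal (W \<omega> / m)). iexp (s * Y \<omega>))"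
    unfolding P_def char_def by (subst integral_distr) auto
  also have "\<dots> = (CLINT \<omega>|M. (W \<omega> / m) *\<^sub>R iexp (s * Y \<omega>))"
    by (subst integral_density) (auto simp: nn m less_imp_le)
  also have "\<dots> = (CLINT \<omega>|M. iexp (s * Y \<omega>) * W \<omega> / m)"
    by (intro Bochner_Integration.integral_cong) (auto simp: scaleR_conv_of_real)
  also have "\<dots> = (CLINT \<omega>|M. iexp (s * Y \<omega>) * W \<omega>) / m" by simp
  also have "(CLINT \<omega>|M. iexp (s * Y \<omega>) * W \<omega>) = Complex (\<integral>\<omega>. W \<omega> * cos (s * Y \<omega> + 0) \<partial>M) (\<integral>\<omega>. W \<omega> * cos (s * Y \<omega> + (- pi/2)) \<partial>M)"
  proof -
    have i: "complex_integrable M (\<lambda>\<omega>. iexp (s * Y \<omega>) * W \<omega>)"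
    proof (rule integrable_const_bound[where B=b])
      show "AE x in M. cmod (iexp (s * Y x) * W x) \<le> b"
        using nn bd by (intro AE_I2) (simp add: norm_mult)
    qed simp
    have "Re (CLINT \<omega>|M. iexp (s * Y \<omega>) * W \<omega>) = (\<integral>\<omega>. W \<omega> * cos (s * Y \<omega> + 0) \<partial>M)"
      by (subst integral_Re[OF i, symmetric]) (auto simp: Re_exp mult.commute)
    moreover have "Im (CLINT \<omega>|M. iexp (s * Y \<omega>) * W \<omega>) = (\<integral>\<omega>. W \<omega> * cos (s * Y \<omega> + (- pi/2)) \<partial>M)"
      by (subst integral_Im[OF i, symmetric]) (auto simp: Im_exp mult.commute cos_diff)
    ultimately show ?thesis by (simp add: complex_eq_iff)
  qed
  finally show "char P s = Complex (\<integral>\<omega>. W \<omega> * cos (s * Y \<omega> + 0) \<partial>M) (\<integral>\<omega>. W \<omega> * cos (s * Y \<omega> + (- pi/2)) \<partial>M) / of_real m" .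
qed

text \<open>The hypothesis at \<open>s = 0\<close>, \<open>a = 0\<close> says that both weights have
  the same total mass. If it is positive, normalization reduces the claim to one-dimensional
  uniqueness; if it is zero, both weights vanish almost everywhere and there is nothing to
  normalize.\<close>

lemma weighted_Levy_uniqueness:
  fixes W Y :: "'a \<Rightarrow> real" and W' Y' :: "'b \<Rightarrow> real"
  assumes M: "prob_space M" and M': "prob_space M'"
    and meas[measurable]: "W \<in> borel_measurable M" "Y \<in> borel_measurable M"
      "W' \<in> borel_measurable M'" "Y' \<in> borel_measurable M'"
    and nn: "\<And>\<omega>. 0 \<le> W \<omega>" "\<And>\<omega>. W \<omega> \<le> b" "\<And>\<omega>. 0 \<le> W' \<omega>" "\<And>\<omega>. W' \<omega> \<le> b"
    and eq: "\<And>s a. (\<integral>\<omega>. W \<omega> * cos (s * Y \<omega> + a) \<partial>M) = (\<integral>\<omega>. W' \<omega> * cos (s * Y' \<omega> + a) \<partial>M')"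
    and B[measurable]: "B \<in> sets borel"
  shows "(\<integral>\<omega>. W \<omega> * indicator B (Y \<omega>) \<partial>M) = (\<integral>\<omega>. W' \<omega> * indicator B (Y' \<omega>) \<partial>M')"
proof -
  interpret M: prob_space M by fact
  interpret M': prob_space M' by fact
  define m where "m = (\<integral>\<omega>. W \<omega> \<partial>M)"
  have m: "(\<integral>\<omega>. W \<omega> \<partial>M) = m" "(\<integral>\<omega>. W' \<omega> \<partial>M') = m" using eq[of 0 0] by (auto simp: m_def)
  have "m \<ge> 0" unfolding m_def using nn by simp
  consider "m = 0" | "m > 0" using \<open>m \<ge> 0\<close> by linarith
  then show ?thesis
  proof cases
    case 1
    have i: "integrable M W" "integrable M' W'"
      using nn by (auto intro!: M.integrable_const_bound[where B=b] M'.integrable_const_bound[where B=b])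
    have "AE \<omega> in M. W \<omega> = 0" "AE \<omega> in M'. W' \<omega> = 0"
      using integral_nonneg_eq_0_iff_AE[OF i(1)] integral_nonneg_eq_0_iff_AE[OF i(2)] nn m 1 by auto
    then have "(\<integral>\<omega>. W \<omega> * indicator B (Y \<omega>) \<partial>M) = (\<integral>\<omega>. 0 \<partial>M)" "(\<integral>\<omega>. W' \<omega> * indicator B (Y' \<omega>) \<partial>M') = (\<integral>\<omega>. 0 \<partial>M')"
      by (intro integral_cong_AE; auto)+
    then show ?thesis by simp
  next
    case 2
    note r = M.real_distribution_weighted[OF meas(1,2) nn(1,2) m(1) 2]
    note r' = M'.real_distribution_weighted[OF meas(3,4) nn(3,4) m(2) 2]
    have "distr (density M (\<lambda>\<omega>. ennreal (W \<omega> / m))) borel Y = distr (density M' (\<lambda>\<omega>. ennreal (W' \<omega> / m))) borel Y'"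
    proof (rule Levy_uniqueness)
      show "real_distribution (distr (density M (\<lambda>\<omega>. ennreal (W \<omega> / m))) borel Y)" by (rule r(1))
      show "real_distribution (distr (density M' (\<lambda>\<omega>. ennreal (W' \<omega> / m))) borel Y')" by (rule r'(1))
      show "char (distr (density M (\<lambda>\<omega>. ennreal (W \<omega> / m))) borel Y) = char (distr (density M' (\<lambda>\<omega>. ennreal (W' \<omega> / m))) borel Y')"
        by (rule ext, simp only: r(3) r'(3) eq)
    qed
    then show ?thesis using r(2)[of B] r'(2)[of B] 2 by simp
  qed
qed

text \<open>One coordinate at a time: the weights \<open>1 + cos\<close> are nonnegative, so the one-dimensional
  uniqueness theorem applies to the coordinate under the weighted measure.\<close>

lemma char_determines_weighted_integrals:
  fixes Z :: "'i \<Rightarrow> 'a \<Rightarrow> real" and Z' :: "'i \<Rightarrow> 'b \<Rightarrow> real"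
  assumes M: "prob_space M" and M': "prob_space M'"
    and meas[measurable]: "\<And>i. Z i \<in> borel_measurable M" "\<And>i. Z' i \<in> borel_measurable M'"
    and eq: "\<And>F c a. finite F \<Longrightarrow> (\<integral>\<omega>. cos ((\<Sum>i\<in>F. c i * Z i \<omega>) + a) \<partial>M) = (\<integral>\<omega>. cos ((\<Sum>i\<in>F. c i * Z' i \<omega>) + a) \<partial>M')"
    and J: "finite J" and B: "\<And>j. B j \<in> sets borel" and F: "finite F"
  shows "(\<integral>\<omega>. (\<Prod>j\<in>J. indicator (B j) (Z j \<omega>)) * cos ((\<Sum>i\<in>F. c i * Z i \<omega>) + a) \<partial>M)
       = (\<integral>\<omega>. (\<Prod>j\<in>J. indicator (B j) (Z' j \<omega>)) * cos ((\<Sum>i\<in>F. c i * Z' i \<omega>) + a) \<partial>M')"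
  using J F
proof (induction J arbitrary: F c a rule: finite_induct)
  case empty
  then show ?case using eq by simp
next
  case (insert j J)
  note [measurable] = B
  interpret M: prob_space M by fact
  interpret M': prob_space M' by fact
  define p where "p \<omega> = (\<Prod>j\<in>J. indicator (B j) (Z j \<omega>) :: real)" for \<omega>
  define p' where "p' \<omega> = (\<Prod>j\<in>J. indicator (B j) (Z' j \<omega>) :: real)" for \<omega>
  have [measurable]: "p \<in> borel_measurable M" "p' \<in> borel_measurable M'" unfolding p_def p'_def by auto
  have p01: "0 \<le> p \<omega>" "p \<omega> \<le> 1" "0 \<le> p' \<omega>'" "p' \<omega>' \<le> 1" for \<omega> \<omega>'
    unfolding p_def p'_def by (auto intro!: prod_nonneg prod_le_1)
  have int: "integrable M (\<lambda>\<omega>. p \<omega> * g \<omega>)" if [measurable]: "g \<in> borel_measurable M" and "\<And>\<omega>. \<bar>g \<omega>\<bar> \<le> 1" for g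
  proof (rule M.integrable_const_bound[where B=1])
    have "\<bar>p x\<bar> * \<bar>g x\<bar> \<le> 1 * 1" for x using p01(1,2)[of x] that(2)[of x] by (intro mult_mono) auto
    then show "AE x in M. norm (p x * g x) \<le> 1" by (auto simp: abs_mult)
  qed simp
  have int': "integrable M' (\<lambda>\<omega>. p' \<omega> * g \<omega>)" if [measurable]: "g \<in> borel_measurable M'" and "\<And>\<omega>. \<bar>g \<omega>\<bar> \<le> 1" for g
  proof (rule M'.integrable_const_bound[where B=1])
    have "\<bar>p' x\<bar> * \<bar>g x\<bar> \<le> 1 * 1" for x using p01(3,4)[of x] that(2)[of x] by (intro mult_mono) auto
    then show "AE x in M'. norm (p' x * g x) \<le> 1" by (auto simp: abs_mult)
  qed simp
  define S where "S \<omega> = (\<Sum>i\<in>F. c i * Z i \<omega>) + a" for \<omega>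
  define S' where "S' \<omega> = (\<Sum>i\<in>F. c i * Z' i \<omega>) + a" for \<omega>
  have [measurable]: "S \<in> borel_measurable M" "S' \<in> borel_measurable M'" unfolding S_def S'_def by auto
  have single: "(\<integral>\<omega>. p \<omega> * cos (s * Z j \<omega> + b) \<partial>M) = (\<integral>\<omega>. p' \<omega> * cos (s * Z' j \<omega> + b) \<partial>M')" for s b
    using insert.IH[of "{j}" "\<lambda>_. s" b] by (simp add: p_def p'_def)
  have comb: "(\<integral>\<omega>. p \<omega> * cos (S \<omega> + (s * Z j \<omega> + b)) \<partial>M) = (\<integral>\<omega>. p' \<omega> * cos (S' \<omega> + (s * Z' j \<omega> + b)) \<partial>M')" for s b
  proof -
    \<comment> \<open>The index \<open>j\<close> may already occur in \<open>F\<close>; its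
      coefficient is then increased by \<open>s\<close>.\<close>
    define c' where "c' i = (if i \<in> F then c i else 0) + (if i = j then s else 0)" for i
    have e: "(\<Sum>i\<in>insert j F. c' i * z i) + (a + b) = (\<Sum>i\<in>F. c i * z i) + a + (s * z j + b)" for z :: "'i \<Rightarrow> real"
    proof -
      have "(\<Sum>i\<in>insert j F. c' i * z i) = (\<Sum>i\<in>insert j F. (if i \<in> F then c i * z i else 0)) + (\<Sum>i\<in>insert j F. (if i = j then s * z i else 0))"
        unfolding sum.distrib[symmetric] by (intro sum.cong) (auto simp: c'_def algebra_simps)
      also have "(\<Sum>i\<in>insert j F. (if i \<in> F then c i * z i else 0)) = (\<Sum>i\<in>F. c i * z i)"
        using insert.prems by (intro sum.mono_neutral_cong_right) auto
      also have "(\<Sum>i\<in>insert j F. (if i = j then s * z i else 0)) = s * z j"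
        using insert.prems by (subst sum.delta) auto
      finally show ?thesis by simp
    qed
    show ?thesis using insert.IH[of "insert j F" c' "a+b"] insert.prems
      unfolding p_def[symmetric] p'_def[symmetric] e by (simp add: S_def S'_def)
  qed
  \<comment> \<open>The product-to-sum formula turns the weighted cosine into cosines of linear
    combinations, to which the induction hypothesis applies. This is why that hypothesis carries an
    arbitrary phase.\<close>
  have prod: "p \<omega> * (1 + cos (S \<omega>)) * cos (s * Z j \<omega> + b) = p \<omega> * cos (s * Z j \<omega> + b)
     + (p \<omega> * cos (S \<omega> + (s * Z j \<omega> + b)) / 2 + p \<omega> * cos (S \<omega> + (- s * Z j \<omega> + - b)) / 2)" for \<omega> s b
  proof -
    have "cos (S \<omega>) * cos (s * Z j \<omega> + b) = (cos (S \<omega> + (s * Z j \<omega> + b)) + cos (S \<omega> - (s * Z j \<omega> + b))) / 2"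
      using cos_times_cos[of "S \<omega>" "s * Z j \<omega> + b"] by simp
    also have "S \<omega> - (s * Z j \<omega> + b) = S \<omega> + (- s * Z j \<omega> + - b)" by simp
    finally have c: "cos (S \<omega>) * cos (s * Z j \<omega> + b) = (cos (S \<omega> + (s * Z j \<omega> + b)) + cos (S \<omega> + (- s * Z j \<omega> + - b))) / 2" .
    have "p \<omega> * (1 + cos (S \<omega>)) * cos (s * Z j \<omega> + b) = p \<omega> * cos (s * Z j \<omega> + b) + p \<omega> * (cos (S \<omega>) * cos (s * Z j \<omega> + b))"
      by (simp only: distrib_left distrib_right mult_1_right mult.assoc)
    then show ?thesis unfolding c by (simp only: distrib_left times_divide_eq_right add_divide_distrib)
  qed
  have prod': "p' \<omega> * (1 + cos (S' \<omega>)) * cos (s * Z' j \<omega> + b) = p' \<omega> * cos (s * Z' j \<omega> + b)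
     + (p' \<omega> * cos (S' \<omega> + (s * Z' j \<omega> + b)) / 2 + p' \<omega> * cos (S' \<omega> + (- s * Z' j \<omega> + - b)) / 2)" for \<omega> s b
  proof -
    have "cos (S' \<omega>) * cos (s * Z' j \<omega> + b) = (cos (S' \<omega> + (s * Z' j \<omega> + b)) + cos (S' \<omega> - (s * Z' j \<omega> + b))) / 2"
      using cos_times_cos[of "S' \<omega>" "s * Z' j \<omega> + b"] by simp
    also have "S' \<omega> - (s * Z' j \<omega> + b) = S' \<omega> + (- s * Z' j \<omega> + - b)" by simp
    finally have c: "cos (S' \<omega>) * cos (s * Z' j \<omega> + b) = (cos (S' \<omega> + (s * Z' j \<omega> + b)) + cos (S' \<omega> + (- s * Z' j \<omega> + - b))) / 2" .
    have "p' \<omega> * (1 + cos (S' \<omega>)) * cos (s * Z' j \<omega> + b) = p' \<omega> * cos (s * Z' j \<omega> + b) + p' \<omega> * (cos (S' \<omega>) * cos (s * Z' j \<omega> + b))"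
      by (simp only: distrib_left distrib_right mult_1_right mult.assoc)
    then show ?thesis unfolding c by (simp only: distrib_left times_divide_eq_right add_divide_distrib)
  qed
  have cb: "0 \<le> 1 + cos x" "1 + cos x \<le> 2" for x :: real using cos_ge_minus_one[of x] cos_le_one[of x] by linarith+
  have pc: "0 \<le> p \<omega> * (1 + cos (S \<omega>))" "p \<omega> * (1 + cos (S \<omega>)) \<le> 2"
    "0 \<le> p' \<omega>' * (1 + cos (S' \<omega>'))" "p' \<omega>' * (1 + cos (S' \<omega>')) \<le> 2" for \<omega> \<omega>'
    using mult_mono[OF p01(2)[of \<omega>] cb(2)[of "S \<omega>"]] mult_mono[OF p01(4)[of \<omega>'] cb(2)[of "S' \<omega>'"]] p01 cb by auto
  have 1: "(\<integral>\<omega>. p \<omega> * (1 + cos (S \<omega>)) * indicator (B j) (Z j \<omega>) \<partial>M) = (\<integral>\<omega>. p' \<omega> * (1 + cos (S' \<omega>)) * indicator (B j) (Z' j \<omega>) \<partial>M')"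
  proof (rule weighted_Levy_uniqueness[OF M M', where b=2])
    fix s b
    show "(\<integral>\<omega>. p \<omega> * (1 + cos (S \<omega>)) * cos (s * Z j \<omega> + b) \<partial>M) = (\<integral>\<omega>. p' \<omega> * (1 + cos (S' \<omega>)) * cos (s * Z' j \<omega> + b) \<partial>M')"
      unfolding prod prod'
      apply (subst Bochner_Integration.integral_add, ((intro Bochner_Integration.integrable_add Bochner_Integration.integrable_divide int int'; simp)+)[2])
      apply (subst Bochner_Integration.integral_add, ((intro Bochner_Integration.integrable_add Bochner_Integration.integrable_divide int int'; simp)+)[2])
      apply (subst Bochner_Integration.integral_add, ((intro Bochner_Integration.integrable_add Bochner_Integration.integrable_divide int int'; simp)+)[2])
      apply (subst Bochner_Integration.integral_add, ((intro Bochner_Integration.integrable_add Bochner_Integration.integrable_divide int int'; simp)+)[2])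
      apply (simp only: integral_divide_zero single comb)
      done
  qed (use pc in auto)
  have 2: "(\<integral>\<omega>. p \<omega> * indicator (B j) (Z j \<omega>) \<partial>M) = (\<integral>\<omega>. p' \<omega> * indicator (B j) (Z' j \<omega>) \<partial>M')"
    by (rule weighted_Levy_uniqueness[OF M M', where b=1]) (use p01 single in auto)
  have ind: "\<bar>indicator A x :: real\<bar> \<le> 1" for A and x :: real by (auto simp: indicator_def)
  \<comment> \<open>The weight \<open>cos (S \<omega>)\<close> has no sign. It is the difference of
    the two nonnegative weights treated in \<open>1\<close> and \<open>2\<close>.\<close>
  have "(\<integral>\<omega>. p \<omega> * (indicator (B j) (Z j \<omega>) * cos (S \<omega>)) \<partial>M) = (\<integral>\<omega>. p \<omega> * (1 + cos (S \<omega>)) * indicator (B j) (Z j \<omega>) \<partial>M) - (\<integral>\<omega>. p \<omega> * indicator (B j) (Z j \<omega>) \<partial>M)"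
  proof (subst Bochner_Integration.integral_diff[symmetric])
    have "integrable M (\<lambda>\<omega>. p \<omega> * (indicator (B j) (Z j \<omega>)) + p \<omega> * (indicator (B j) (Z j \<omega>) * cos (S \<omega>)))"
      by (intro Bochner_Integration.integrable_add int) (auto simp: indicator_def)
    then show "integrable M (\<lambda>\<omega>. p \<omega> * (1 + cos (S \<omega>)) * indicator (B j) (Z j \<omega>))" by (simp add: algebra_simps)
    show "integrable M (\<lambda>\<omega>. p \<omega> * indicator (B j) (Z j \<omega>))" by (intro int) (auto simp: indicator_def)
  qed (simp add: algebra_simps)
  also have "\<dots> = (\<integral>\<omega>. p' \<omega> * (1 + cos (S' \<omega>)) * indicator (B j) (Z' j \<omega>) \<partial>M') - (\<integral>\<omega>. p' \<omega> * indicator (B j) (Z' j \<omega>) \<partial>M')"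
    by (simp only: 1 2)
  also have "\<dots> = (\<integral>\<omega>. p' \<omega> * (indicator (B j) (Z' j \<omega>) * cos (S' \<omega>)) \<partial>M')"
  proof (subst Bochner_Integration.integral_diff[symmetric])
    have "integrable M' (\<lambda>\<omega>. p' \<omega> * (indicator (B j) (Z' j \<omega>)) + p' \<omega> * (indicator (B j) (Z' j \<omega>) * cos (S' \<omega>)))"
      by (intro Bochner_Integration.integrable_add int') (auto simp: indicator_def)
    then show "integrable M' (\<lambda>\<omega>. p' \<omega> * (1 + cos (S' \<omega>)) * indicator (B j) (Z' j \<omega>))" by (simp add: algebra_simps)
    show "integrable M' (\<lambda>\<omega>. p' \<omega> * indicator (B j) (Z' j \<omega>))" by (intro int') (auto simp: indicator_def)
  qed (simp add: algebra_simps)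
  finally show ?case using insert.hyps by (simp add: p_def p'_def S_def S'_def mult_ac)
qed

text \<open>Finite-dimensional boxes determine a finite measure on the product. Their probabilities
  are the weighted integrals of the preceding lemma with the cosine reduced to the constant
  1.\<close>

lemma distr_PiM_eqI_char:
  fixes Z :: "'i \<Rightarrow> 'a \<Rightarrow> real" and Z' :: "'i \<Rightarrow> 'b \<Rightarrow> real"
  assumes M: "prob_space M" and M': "prob_space M'"
    and meas[measurable]: "\<And>i. Z i \<in> borel_measurable M" "\<And>i. Z' i \<in> borel_measurable M'"
    and eq: "\<And>F c. finite F \<Longrightarrow> (CLINT \<omega>|M. iexp (\<Sum>i\<in>F. c i * Z i \<omega>)) = (CLINT \<omega>|M'. iexp (\<Sum>i\<in>F. c i * Z' i \<omega>))"
  shows "distr M (PiM UNIV (\<lambda>_. borel)) (\<lambda>\<omega> i. Z i \<omega>) = distr M' (PiM UNIV (\<lambda>_. borel)) (\<lambda>\<omega> i. Z' i \<omega>)"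
proof (rule measure_eqI_PiM_infinite)
  interpret M: prob_space M by fact
  interpret M': prob_space M' by fact
  have [measurable]: "(\<lambda>\<omega> i. Z i \<omega>) \<in> measurable M (PiM UNIV (\<lambda>_. borel))" "(\<lambda>\<omega> i. Z' i \<omega>) \<in> measurable M' (PiM UNIV (\<lambda>_. borel))"
    by (auto intro!: measurable_PiM_single' simp: PiE_def)
  show "finite_measure (distr M (PiM UNIV (\<lambda>_. borel)) (\<lambda>\<omega> i. Z i \<omega>))"
    by (intro M.finite_measure_distr) simp
  \<comment> \<open>Passage from characteristic functions to cosines with a phase: multiply by
    \<open>iexp a\<close> and take the real part.\<close>
  have cos: "(\<integral>\<omega>. cos (Y \<omega> + a) \<partial>N) = Re (iexp a * (CLINT \<omega>|N. iexp (Y \<omega>)))"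
    if "prob_space N" and [measurable]: "Y \<in> borel_measurable N" for N :: "'z measure" and Y a
  proof -
    interpret N: prob_space N by fact
    have "complex_integrable N (\<lambda>\<omega>. iexp (Y \<omega>))" by (rule N.integrable_iexp) auto
    then have "complex_integrable N (\<lambda>\<omega>. iexp a * iexp (Y \<omega>))" by simp
    from integral_Re[OF this] have "Re (CLINT \<omega>|N. iexp a * iexp (Y \<omega>)) = (\<integral>\<omega>. cos (Y \<omega> + a) \<partial>N)"
      by (simp add: exp_add[symmetric] Re_exp add.commute distrib_left[symmetric] flip: of_real_add)
    then show ?thesis by simp
  qed
  fix A :: "'i \<Rightarrow> real set" and J :: "'i set"
  assume J: "finite J" and A': "\<And>i. i \<in> J \<Longrightarrow> A i \<in> sets borel"
  \<comment> \<open>The given sets are Borel on \<open>J\<close> only; outside of \<open>J\<close>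
    they are replaced by the whole line, so that all of them are Borel.\<close>
  define A0 where "A0 i = (if i \<in> J then A i else UNIV)" for i
  have A0[measurable]: "A0 i \<in> sets borel" for i using A' by (auto simp: A0_def)
  have emb: "prod_emb UNIV (\<lambda>_. borel) J (Pi\<^sub>E J A) = {x. \<forall>j\<in>J. x j \<in> A0 j}"
    by (auto simp: prod_emb_def A0_def PiE_iff)
  have A[measurable]: "{x. \<forall>j\<in>J. x j \<in> A0 j} \<in> sets (PiM UNIV (\<lambda>_. borel))"
    unfolding emb[symmetric] using J A' by (intro sets_PiM_I) auto
  have me: "emeasure (distr N (PiM UNIV (\<lambda>_. borel)) (\<lambda>\<omega> i. X i \<omega>)) {x. \<forall>j\<in>J. x j \<in> A0 j} = ennreal (\<integral>\<omega>. (\<Prod>j\<in>J. indicator (A0 j) (X j \<omega>)) \<partial>N)"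
    if "prob_space N" and Xm[measurable]: "\<And>i. X i \<in> borel_measurable N" for N :: "'z measure" and X
  proof -
    interpret N: prob_space N by fact
    have [measurable]: "(\<lambda>\<omega> i. X i \<omega>) \<in> measurable N (PiM UNIV (\<lambda>_. borel))"
      by (auto intro!: measurable_PiM_single' simp: PiE_def)
    have m: "{\<omega> \<in> space N. \<forall>j\<in>J. X j \<omega> \<in> A0 j} \<in> sets N" 
      using measurable_sets[OF \<open>(\<lambda>\<omega> i. X i \<omega>) \<in> _\<close> A] by (simp add: vimage_def Int_def conj_commute)
    have "emeasure (distr N (PiM UNIV (\<lambda>_. borel)) (\<lambda>\<omega> i. X i \<omega>)) {x. \<forall>j\<in>J. x j \<in> A0 j}
       = emeasure N {\<omega> \<in> space N. \<forall>j\<in>J. X j \<omega> \<in> A0 j}"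
      by (subst emeasure_distr) (auto intro!: arg_cong[where f="emeasure N"])
    also have "\<dots> = ennreal (\<integral>\<omega>. indicator {\<omega> \<in> space N. \<forall>j\<in>J. X j \<omega> \<in> A0 j} \<omega> \<partial>N)"
      using m by (simp add: N.emeasure_eq_measure)
    also have "(\<integral>\<omega>. indicator {\<omega> \<in> space N. \<forall>j\<in>J. X j \<omega> \<in> A0 j} \<omega> \<partial>N) = (\<integral>\<omega>. (\<Prod>j\<in>J. indicator (A0 j) (X j \<omega>) :: real) \<partial>N)"
    proof (rule Bochner_Integration.integral_cong)
      fix \<omega> assume "\<omega> \<in> space N"
      then show "indicator {\<omega> \<in> space N. \<forall>j\<in>J. X j \<omega> \<in> A0 j} \<omega> = (\<Prod>j\<in>J. indicator (A0 j) (X j \<omega>) :: real)"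
        using J by (auto simp: indicator_def)
    qed simp
    finally show ?thesis .
  qed
  have "(\<integral>\<omega>. (\<Prod>j\<in>J. indicator (A0 j) (Z j \<omega>)) * cos ((\<Sum>i\<in>{}. 0 * Z i \<omega>) + 0) \<partial>M)
       = (\<integral>\<omega>. (\<Prod>j\<in>J. indicator (A0 j) (Z' j \<omega>)) * cos ((\<Sum>i\<in>{}. 0 * Z' i \<omega>) + 0) \<partial>M')"
  proof (rule char_determines_weighted_integrals[OF M M'])
    fix F :: "'i set" and c a assume F: "finite F"
    show "(\<integral>\<omega>. cos ((\<Sum>i\<in>F. c i * Z i \<omega>) + a) \<partial>M) = (\<integral>\<omega>. cos ((\<Sum>i\<in>F. c i * Z' i \<omega>) + a) \<partial>M')"
      by (subst cos[OF M], simp, subst cos[OF M'], simp, simp only: eq[OF F])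
  qed (simp_all add: J)
  then show "emeasure (distr M (PiM UNIV (\<lambda>_. borel)) (\<lambda>\<omega> i. Z i \<omega>)) (prod_emb UNIV (\<lambda>_. borel) J (Pi\<^sub>E J A)) =
    emeasure (distr M' (PiM UNIV (\<lambda>_. borel)) (\<lambda>\<omega> i. Z' i \<omega>)) (prod_emb UNIV (\<lambda>_. borel) J (Pi\<^sub>E J A))"
    unfolding emb by (simp add: me M M')
qed simp_all

text \<open>Countability of the index type makes the Borel sets of the product topology coincide
  with the product \<sigma>-algebra.\<close>

lemma measurable_into_borel_coordinate:
  fixes f :: "'a \<Rightarrow> 'i::countable \<Rightarrow> real"
  shows "f \<in> measurable M borel \<longleftrightarrow> (\<forall>i. (\<lambda>\<omega>. f \<omega> i) \<in> borel_measurable M)"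
proof -
  have "f \<in> measurable M borel \<longleftrightarrow> f \<in> measurable M (PiM UNIV (\<lambda>_. borel))"
    by (intro arg_cong2[where f="(\<in>)"] refl measurable_cong_sets) (auto simp: sets_PiM_equal_borel)
  also have "\<dots> \<longleftrightarrow> (\<forall>i. (\<lambda>\<omega>. f \<omega> i) \<in> borel_measurable M)"
    by (auto intro!: measurable_PiM_single' simp: PiE_def)
  finally show ?thesis .
qed

text \<open>Every Borel set of the space is the preimage under \<open>\<phi>\<close> of a Borel set
  of sequences, so the law of the coordinate sequence, fixed by its characteristic function, already
  determines the law on the space.\<close>

lemma distr_borel_eqI_char:
  fixes \<phi> :: "'x::{complete_space,second_countable_topology} \<Rightarrow> 'i::countable \<Rightarrow> real"
  assumes M: "prob_space M" and M': "prob_space M'"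
    and cont: "continuous_on UNIV \<phi>" and inj: "inj \<phi>"
    and \<eta>[measurable]: "\<eta> \<in> borel_measurable M" "\<eta>' \<in> borel_measurable M'"
    and eq: "\<And>F c. finite F \<Longrightarrow> (CLINT \<omega>|M. iexp (\<Sum>i\<in>F. c i * \<phi> (\<eta> \<omega>) i)) = (CLINT \<omega>|M'. iexp (\<Sum>i\<in>F. c i * \<phi> (\<eta>' \<omega>) i))"
  shows "distr M borel \<eta> = distr M' borel \<eta>'"
proof (rule measure_eqI)
  have \<phi>m[measurable]: "(\<lambda>x. \<phi> x i) \<in> borel_measurable borel" for i
    using borel_measurable_continuous_onI[OF cont] by (simp add: measurable_into_borel_coordinate)
  have m: "(\<lambda>\<omega> i. \<phi> (\<eta> \<omega>) i) \<in> measurable M (PiM UNIV (\<lambda>_. borel))" "(\<lambda>\<omega> i. \<phi> (\<eta>' \<omega>) i) \<in> measurable M' (PiM UNIV (\<lambda>_. borel))"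
    by (auto intro!: measurable_PiM_single' simp: PiE_def)
  have d: "distr M (PiM UNIV (\<lambda>_. borel)) (\<lambda>\<omega> i. \<phi> (\<eta> \<omega>) i) = distr M' (PiM UNIV (\<lambda>_. borel)) (\<lambda>\<omega> i. \<phi> (\<eta>' \<omega>) i)"
    by (rule distr_PiM_eqI_char[OF M M' _ _ eq]) auto
  fix A assume "A \<in> sets (distr M borel \<eta>)"
  then have A: "A \<in> sets borel" by simp
  then obtain D where D: "D \<in> sets borel" "A = \<phi> -` D" using borel_eq_vimage_continuous_inj[OF cont inj] by blast
  have D': "D \<in> sets (PiM UNIV (\<lambda>_. borel))" using D(1) by (simp add: sets_PiM_equal_borel)
  have "emeasure (distr M borel \<eta>) A = emeasure (distr M (PiM UNIV (\<lambda>_. borel)) (\<lambda>\<omega> i. \<phi> (\<eta> \<omega>) i)) D"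
    using A D(2) D' m by (simp add: emeasure_distr vimage_def)
  moreover have "emeasure (distr M' borel \<eta>') A = emeasure (distr M' (PiM UNIV (\<lambda>_. borel)) (\<lambda>\<omega> i. \<phi> (\<eta>' \<omega>) i)) D"
    using A D(2) D' m by (simp add: emeasure_distr vimage_def)
  ultimately show "emeasure (distr M borel \<eta>) A = emeasure (distr M' borel \<eta>') A" using d by simp
qed simp

text \<open>Jointly Gaussian with covariance \<open>C\<close>, expressed by the characteristic
  function. Degenerate families need no separate case, and \<open>C\<close> enters through its
  quadratic form only.\<close>

definition gauss_family :: "'w measure \<Rightarrow> ('i \<Rightarrow> 'w \<Rightarrow> real) \<Rightarrow> ('i \<Rightarrow> 'i \<Rightarrow> real) \<Rightarrow> bool" where
  "gauss_family M Y C \<longleftrightarrow> (\<forall>i. Y i \<in> borel_measurable M) \<and>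
     (\<forall>F c. finite F \<longrightarrow> (CLINT \<omega>|M. iexp (\<Sum>i\<in>F. c i * Y i \<omega>)) =
        of_real (exp (- (\<Sum>i\<in>F. \<Sum>j\<in>F. c i * c j * C i j) / 2)))"

lemma distr_borel_eqI_gauss_family:
  fixes \<phi> :: "'x::{complete_space,second_countable_topology} \<Rightarrow> 'i::countable \<Rightarrow> real"
  assumes "prob_space M" "prob_space M'" "continuous_on UNIV \<phi>" "inj \<phi>"
    and "\<eta> \<in> borel_measurable M" "\<eta>' \<in> borel_measurable M'"
    and "gauss_family M (\<lambda>i \<omega>. \<phi> (\<eta> \<omega>) i) C" "gauss_family M' (\<lambda>i \<omega>. \<phi> (\<eta>' \<omega>) i) C"
  shows "distr M borel \<eta> = distr M' borel \<eta>'"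
  using assms by (intro distr_borel_eqI_char[where \<phi>=\<phi>]) (auto simp: gauss_family_def)

section \<open>Centered Gaussian variables and their characteristic functions\<close>

lemma (in prob_space) centered_gaussian_rv_char:
  assumes "centered_gaussian_rv M Y"
  shows "integrable M (\<lambda>\<omega>. (Y \<omega>)\<^sup>2)"
    and "(CLINT \<omega>|M. iexp (Y \<omega>)) = of_real (exp (- (\<integral>\<omega>. (Y \<omega>)\<^sup>2 \<partial>M) / 2))"
proof -
  have Y[measurable]: "Y \<in> borel_measurable M" using assms by (simp add: centered_gaussian_rv_def)
  have "integrable M (\<lambda>\<omega>. (Y \<omega>)\<^sup>2) \<and> (CLINT \<omega>|M. iexp (Y \<omega>)) = of_real (exp (- (\<integral>\<omega>. (Y \<omega>)\<^sup>2 \<partial>M) / 2))"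
  proof (cases "AE \<omega> in M. Y \<omega> = 0")
    case True
    have 1: "(CLINT \<omega>|M. iexp (Y \<omega>)) = (CLINT \<omega>|M. 1)"
      using True by (intro integral_cong_AE) (auto elim!: eventually_mono)
    have 2: "(\<integral>\<omega>. (Y \<omega>)\<^sup>2 \<partial>M) = (\<integral>\<omega>. 0 \<partial>M)"
      using True by (intro integral_cong_AE) (auto elim!: eventually_mono)
    have 3: "integrable M (\<lambda>\<omega>. (Y \<omega>)\<^sup>2) \<longleftrightarrow> integrable M (\<lambda>\<omega>. 0 :: real)"
      using True by (intro integrable_cong_AE) (auto elim!: eventually_mono)
    show ?thesis unfolding 1 2 3 by (simp add: prob_space)
  next
    case False
    then obtain \<sigma> where \<sigma>: "\<sigma> > 0" and D: "distributed M lborel Y (\<lambda>x. ennreal (normal_density 0 \<sigma> x))"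
      using assms by (auto simp: centered_gaussian_rv_def)
    have "integrable M (\<lambda>\<omega>. (Y \<omega>)\<^sup>2)"
      using distributed_integrable[OF D, of "\<lambda>x. x\<^sup>2"] integrable_normal_moment[OF \<sigma>, of 0 2] by simp
    moreover have "(\<integral>\<omega>. (Y \<omega>)\<^sup>2 \<partial>M) = \<sigma>\<^sup>2"
      using normal_distributed_variance[OF \<sigma> D] normal_distributed_expectation[OF \<sigma> D] by simp
    moreover have "(CLINT \<omega>|M. iexp (Y \<omega>)) = of_real (exp (- \<sigma>\<^sup>2 / 2))"
    proof -
      have "distributed M lborel (\<lambda>x. (Y x - 0) / \<sigma>) std_normal_density"
        using D normal_standard_normal_convert[OF \<sigma>, of Y 0] by simp
      then have d: "distr M lborel (\<lambda>x. Y x / \<sigma>) = std_normal_distribution"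
        by (simp add: distributed_distr_eq_density)
      have "char std_normal_distribution \<sigma> = (CLINT \<omega>|M. iexp (\<sigma> * (Y \<omega> / \<sigma>)))"
        unfolding char_def d[symmetric] by (subst integral_distr) auto
      then show ?thesis using \<sigma> by (simp add: char_std_normal_distribution)
    qed
    ultimately show ?thesis by simp
  qed
  then show "integrable M (\<lambda>\<omega>. (Y \<omega>)\<^sup>2)"
    and "(CLINT \<omega>|M. iexp (Y \<omega>)) = of_real (exp (- (\<integral>\<omega>. (Y \<omega>)\<^sup>2 \<partial>M) / 2))" by auto
qed

text \<open>The case \<open>v = 0\<close> has to be separated, because the law is then the point
  mass at 0 and has no density. Otherwise division by \<open>sqrt v\<close> reduces to the standard
  normal law.\<close>

lemma (in prob_space) centered_gaussian_rv_of_char: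
  assumes Y[measurable]: "Y \<in> borel_measurable M" and v: "v \<ge> 0"
    and ch: "\<And>s. (CLINT \<omega>|M. iexp (s * Y \<omega>)) = of_real (exp (- (s\<^sup>2 * v) / 2))"
  shows "centered_gaussian_rv M Y"
proof (cases "v = 0")
  case True
  have c: "char (distr M borel Y) = char (return borel 0)"
    using ch True by (auto simp: char_def integral_distr integral_return)
  have "distr M borel Y = return borel 0"
    by (rule Levy_uniqueness[OF real_distribution_distr[OF Y] _ c])
      (auto simp: real_distribution_def real_distribution_axioms_def prob_space_return)
  moreover have "AE x in return borel 0. x = (0::real)" by (simp add: AE_return)
  ultimately have "AE x in distr M borel Y. x = 0" by metis
  then have "AE \<omega> in M. Y \<omega> = 0" by (simp add: AE_distr_iff)
  then show ?thesis by (simp add: centered_gaussian_rv_def)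
next
  case False
  define \<sigma> where "\<sigma> = sqrt v"
  have \<sigma>: "\<sigma> > 0" "\<sigma>\<^sup>2 = v" using v False by (auto simp: \<sigma>_def)
  have c: "char (distr M borel (\<lambda>\<omega>. Y \<omega> / \<sigma>)) s = char std_normal_distribution s" for s
  proof -
    have "char (distr M borel (\<lambda>\<omega>. Y \<omega> / \<sigma>)) s = (CLINT \<omega>|M. iexp ((s/\<sigma>) * Y \<omega>))"
      unfolding char_def by (subst integral_distr) auto
    also have "\<dots> = of_real (exp (- ((s/\<sigma>)\<^sup>2 * v) / 2))" by (rule ch)
    also have "(s/\<sigma>)\<^sup>2 * v = s\<^sup>2" using \<sigma> False by (simp add: power_divide)
    finally show ?thesis by (simp add: char_std_normal_distribution)
  qed
  have eq: "distr M borel (\<lambda>\<omega>. Y \<omega> / \<sigma>) = std_normal_distribution"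
    by (intro Levy_uniqueness real_distribution_distr real_dist_normal_dist ext c) simp
  have "distr M lborel (\<lambda>\<omega>. Y \<omega> / \<sigma>) = distr M borel (\<lambda>\<omega>. Y \<omega> / \<sigma>)" by (intro distr_cong) auto
  then have "distributed M lborel (\<lambda>x. (Y x - 0) / \<sigma>) std_normal_density"
    using eq by (auto simp: distributed_def)
  then have "distributed M lborel Y (normal_density 0 \<sigma>)"
    using normal_standard_normal_convert[OF \<sigma>(1), of Y 0] by simp
  then show ?thesis using \<sigma>(1) by (auto simp: centered_gaussian_rv_def)
qed

lemma product_integrable_of_squares:
  fixes f g :: "'a \<Rightarrow> real"
  assumes [measurable]: "f \<in> borel_measurable M" "g \<in> borel_measurable M"
    and "integrable M (\<lambda>\<omega>. (f \<omega>)\<^sup>2)" "integrable M (\<lambda>\<omega>. (g \<omega>)\<^sup>2)"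
  shows "integrable M (\<lambda>\<omega>. f \<omega> * g \<omega>)"
proof (rule Bochner_Integration.integrable_bound)
  show "integrable M (\<lambda>\<omega>. (f \<omega>)\<^sup>2 + (g \<omega>)\<^sup>2)" using assms by simp
  have "\<bar>x * y\<bar> \<le> x\<^sup>2 + y\<^sup>2" for x y :: real
    using sum_squares_bound[of "\<bar>x\<bar>" "\<bar>y\<bar>"] mult_nonneg_nonneg[of "\<bar>x\<bar>" "\<bar>y\<bar>"]
    unfolding abs_mult power2_abs by linarith
  then show "AE \<omega> in M. norm (f \<omega> * g \<omega>) \<le> norm ((f \<omega>)\<^sup>2 + (g \<omega>)\<^sup>2)" by simp
qed simp

lemma (in prob_space) gaussian_process_gauss_family:
  fixes \<xi> :: "'b \<Rightarrow> 'a \<Rightarrow> real"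
  assumes "centered_gaussian_process M \<xi>"
  shows "integrable M (\<lambda>\<omega>. (\<xi> t \<omega>)\<^sup>2)"
    and "gauss_family M \<xi> (covariance_function M \<xi>)"
proof -
  have [measurable]: "\<And>t. \<xi> t \<in> borel_measurable M" using assms by (auto simp: centered_gaussian_process_def)
  have G: "centered_gaussian_rv M (\<lambda>\<omega>. \<Sum>t\<in>F. c t * \<xi> t \<omega>)" if "finite F" for F c
    using assms that by (auto simp: centered_gaussian_process_def centered_gaussian_vector_def)
  have sq: "integrable M (\<lambda>\<omega>. (\<xi> t \<omega>)\<^sup>2)" for t
    using centered_gaussian_rv_char(1)[OF G[of "{t}" "\<lambda>_. 1"]] by simp
  then show "integrable M (\<lambda>\<omega>. (\<xi> t \<omega>)\<^sup>2)" .
  have i: "integrable M (\<lambda>\<omega>. \<xi> s \<omega> * \<xi> t \<omega>)" for s t by (intro product_integrable_of_squares sq) auto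
  show "gauss_family M \<xi> (covariance_function M \<xi>)"
    unfolding gauss_family_def
  proof (intro conjI allI impI)
    fix F :: "'b set" and c assume F: "finite F"
    have "(\<integral>\<omega>. (\<Sum>t\<in>F. c t * \<xi> t \<omega>)\<^sup>2 \<partial>M) = (\<integral>\<omega>. (\<Sum>s\<in>F. \<Sum>t\<in>F. c s * c t * (\<xi> s \<omega> * \<xi> t \<omega>)) \<partial>M)"
      by (intro Bochner_Integration.integral_cong) (auto simp: power2_eq_square sum_product mult_ac)
    also have "\<dots> = (\<Sum>s\<in>F. \<Sum>t\<in>F. c s * c t * covariance_function M \<xi> s t)"
      using i by (simp add: covariance_function_def)
    finally show "(CLINT \<omega>|M. iexp (\<Sum>i\<in>F. c i * \<xi> i \<omega>)) =
        of_real (exp (- (\<Sum>i\<in>F. \<Sum>j\<in>F. c i * c j * covariance_function M \<xi> i j) / 2))"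
      using centered_gaussian_rv_char(2)[OF G[OF F, of c]] by simp
  qed simp
qed

section \<open>Mean square convergence and the zero-one law\<close>

text \<open>The second part is nonnegativity of the variance of the absolute value.\<close>

lemma (in prob_space) expectation_abs_le_sqrt:
  fixes f :: "'a \<Rightarrow> real"
  assumes [measurable]: "f \<in> borel_measurable M" and "integrable M (\<lambda>\<omega>. (f \<omega>)\<^sup>2)"
  shows "integrable M f" and "(\<integral>\<omega>. \<bar>f \<omega>\<bar> \<partial>M) \<le> sqrt (\<integral>\<omega>. (f \<omega>)\<^sup>2 \<partial>M)"
proof -
  show i: "integrable M f" by (rule square_integrable_imp_integrable[OF assms])
  have "0 \<le> variance (\<lambda>\<omega>. \<bar>f \<omega>\<bar>)" by (rule variance_positive)
  also have "\<dots> = (\<integral>\<omega>. (f \<omega>)\<^sup>2 \<partial>M) - (\<integral>\<omega>. \<bar>f \<omega>\<bar> \<partial>M)\<^sup>2"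
    using i assms(2) by (subst variance_eq) auto
  finally show "(\<integral>\<omega>. \<bar>f \<omega>\<bar> \<partial>M) \<le> sqrt (\<integral>\<omega>. (f \<omega>)\<^sup>2 \<partial>M)" by (intro real_le_rsqrt) simp
qed

lemma norm_add_sq_le: "(norm (x + y))\<^sup>2 \<le> 2 * (norm x)\<^sup>2 + 2 * (norm y)\<^sup>2"
proof -
  have "(norm (x + y))\<^sup>2 \<le> (norm x + norm y)\<^sup>2" by (intro power_mono norm_triangle_ineq) simp
  also have "\<dots> \<le> 2 * (norm x)\<^sup>2 + 2 * (norm y)\<^sup>2"
    using sum_squares_bound[of "norm x" "norm y"] by (simp add: power2_sum)
  finally show ?thesis .
qed

lemma integrable_norm_sq_add:
  fixes f g :: "'a \<Rightarrow> 'x::{banach,second_countable_topology}"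
  assumes [measurable]: "f \<in> borel_measurable M" "g \<in> borel_measurable M"
    and "integrable M (\<lambda>\<omega>. (norm (f \<omega>))\<^sup>2)" "integrable M (\<lambda>\<omega>. (norm (g \<omega>))\<^sup>2)"
  shows "integrable M (\<lambda>\<omega>. (norm (f \<omega> + g \<omega>))\<^sup>2)"
    and "(\<integral>\<omega>. (norm (f \<omega> + g \<omega>))\<^sup>2 \<partial>M) \<le> 2 * (\<integral>\<omega>. (norm (f \<omega>))\<^sup>2 \<partial>M) + 2 * (\<integral>\<omega>. (norm (g \<omega>))\<^sup>2 \<partial>M)"
proof -
  have i: "integrable M (\<lambda>\<omega>. 2 * (norm (f \<omega>))\<^sup>2 + 2 * (norm (g \<omega>))\<^sup>2)" using assms by simp
  show j: "integrable M (\<lambda>\<omega>. (norm (f \<omega> + g \<omega>))\<^sup>2)"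
    by (rule Bochner_Integration.integrable_bound[OF i]) (auto simp: norm_add_sq_le)
  have "(\<integral>\<omega>. (norm (f \<omega> + g \<omega>))\<^sup>2 \<partial>M) \<le> (\<integral>\<omega>. 2 * (norm (f \<omega>))\<^sup>2 + 2 * (norm (g \<omega>))\<^sup>2 \<partial>M)"
    by (rule integral_mono[OF j i]) (rule norm_add_sq_le)
  then show "(\<integral>\<omega>. (norm (f \<omega> + g \<omega>))\<^sup>2 \<partial>M) \<le> 2 * (\<integral>\<omega>. (norm (f \<omega>))\<^sup>2 \<partial>M) + 2 * (\<integral>\<omega>. (norm (g \<omega>))\<^sup>2 \<partial>M)"
    using assms by simp
qed

lemma integrable_norm_sq_diff:
  fixes f g :: "'a \<Rightarrow> 'x::{banach,second_countable_topology}"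
  assumes [measurable]: "f \<in> borel_measurable M" "g \<in> borel_measurable M"
    and "integrable M (\<lambda>\<omega>. (norm (f \<omega>))\<^sup>2)" "integrable M (\<lambda>\<omega>. (norm (g \<omega>))\<^sup>2)"
  shows "integrable M (\<lambda>\<omega>. (norm (f \<omega> - g \<omega>))\<^sup>2)"
    and "(\<integral>\<omega>. (norm (f \<omega> - g \<omega>))\<^sup>2 \<partial>M) \<le> 2 * (\<integral>\<omega>. (norm (f \<omega>))\<^sup>2 \<partial>M) + 2 * (\<integral>\<omega>. (norm (g \<omega>))\<^sup>2 \<partial>M)"
  using integrable_norm_sq_add[of f M "\<lambda>\<omega>. - g \<omega>"] assms by auto

text \<open>The Riesz-Fischer theorem for values in a separable Banach space. A fast subsequence has
  increments with summable \<open>L\<^sup>1\<close> norms and so converges almost surely; Fatou's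
  lemma then controls the distance of the full sequence to the limit. Square integrability is
  assumed for differences only.\<close>

lemma (in prob_space) L2_complete:
  fixes f :: "nat \<Rightarrow> 'a \<Rightarrow> 'x::{banach,second_countable_topology}"
  assumes f[measurable]: "\<And>n. f n \<in> borel_measurable M"
    and int: "\<And>m n. integrable M (\<lambda>\<omega>. (norm (f m \<omega> - f n \<omega>))\<^sup>2)"
    and cau: "\<And>e. e > 0 \<Longrightarrow> \<exists>N. \<forall>m\<ge>N. \<forall>n\<ge>N. (\<integral>\<omega>. (norm (f m \<omega> - f n \<omega>))\<^sup>2 \<partial>M) < e"
  obtains g where "g \<in> borel_measurable M"
    "\<And>n. integrable M (\<lambda>\<omega>. (norm (f n \<omega> - g \<omega>))\<^sup>2)"
    "(\<lambda>n. \<integral>\<omega>. (norm (f n \<omega> - g \<omega>))\<^sup>2 \<partial>M) \<longlonglongrightarrow> 0"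
proof -
  \<comment> \<open>The rate \<open>(1/4)^k\<close> for squares becomes \<open>(1/2)^k\<close> after
    taking the root, which is summable.\<close>
  have "\<exists>r. strict_mono r \<and> (\<forall>k. \<forall>m\<ge>r k. \<forall>n\<ge>r k. (\<integral>\<omega>. (norm (f m \<omega> - f n \<omega>))\<^sup>2 \<partial>M) < (1/4)^k)"
  proof -
    have "\<exists>r. \<forall>k. (\<forall>m\<ge>r k. \<forall>n\<ge>r k. (\<integral>\<omega>. (norm (f m \<omega> - f n \<omega>))\<^sup>2 \<partial>M) < (1/4)^k) \<and> r k < r (Suc k)"
    proof (rule dependent_nat_choice)
      show "\<exists>x. \<forall>m\<ge>x. \<forall>n\<ge>x. (\<integral>\<omega>. (norm (f m \<omega> - f n \<omega>))\<^sup>2 \<partial>M) < (1/4)^0" using cau[of 1] by simp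
      fix x :: nat and k :: nat
      obtain N where N: "\<forall>m\<ge>N. \<forall>n\<ge>N. (\<integral>\<omega>. (norm (f m \<omega> - f n \<omega>))\<^sup>2 \<partial>M) < (1/4)^Suc k" using cau[of "(1/4)^Suc k"] by auto
      then show "\<exists>y. (\<forall>m\<ge>y. \<forall>n\<ge>y. (\<integral>\<omega>. (norm (f m \<omega> - f n \<omega>))\<^sup>2 \<partial>M) < (1/4)^Suc k) \<and> x < y"
        by (intro exI[of _ "max N (Suc x)"]) auto
    qed
    then show ?thesis by (auto simp: strict_mono_Suc_iff)
  qed
  then obtain r where r: "strict_mono r" and rk: "\<And>k m n. m \<ge> r k \<Longrightarrow> n \<ge> r k \<Longrightarrow> (\<integral>\<omega>. (norm (f m \<omega> - f n \<omega>))\<^sup>2 \<partial>M) < (1/4)^k" by blast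
  define d where "d k \<omega> = f (r (Suc k)) \<omega> - f (r k) \<omega>" for k \<omega>
  have [measurable]: "d k \<in> borel_measurable M" for k unfolding d_def by measurable
  have dk: "(\<integral>\<^sup>+\<omega>. ennreal (norm (d k \<omega>)) \<partial>M) \<le> ennreal ((1/2)^k)" for k
  proof -
    have i: "integrable M (\<lambda>\<omega>. (norm (d k \<omega>))\<^sup>2)" unfolding d_def by (rule int)
    have "(\<integral>\<omega>. (norm (d k \<omega>))\<^sup>2 \<partial>M) < (1/4)^k"
      unfolding d_def by (rule rk) (use r in \<open>auto simp: strict_mono_def less_imp_le\<close>)
    then have "sqrt (\<integral>\<omega>. (norm (d k \<omega>))\<^sup>2 \<partial>M) \<le> sqrt ((1/4)^k)" by simp
    also have "sqrt ((1/4)^k) = (1/2::real)^k" by (simp add: real_sqrt_power real_sqrt_divide)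
    finally have "(\<integral>\<omega>. \<bar>norm (d k \<omega>)\<bar> \<partial>M) \<le> (1/2)^k"
      using expectation_abs_le_sqrt(2)[of "\<lambda>\<omega>. norm (d k \<omega>)"] i by simp
    moreover have "integrable M (\<lambda>\<omega>. norm (d k \<omega>))" using expectation_abs_le_sqrt(1)[of "\<lambda>\<omega>. norm (d k \<omega>)"] i by simp
    ultimately show ?thesis by (simp add: nn_integral_eq_integral)
  qed
  have "(\<integral>\<^sup>+\<omega>. (\<Sum>k. ennreal (norm (d k \<omega>))) \<partial>M) = (\<Sum>k. \<integral>\<^sup>+\<omega>. ennreal (norm (d k \<omega>)) \<partial>M)"
    by (rule nn_integral_suminf) simp
  also have "\<dots> \<le> (\<Sum>k. ennreal ((1/2)^k))" using dk by (intro suminf_le) auto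
  also have "\<dots> = ennreal (\<Sum>k. (1/2)^k)" by (intro suminf_ennreal2) auto
  also have "\<dots> < \<infinity>" by simp
  finally have "AE \<omega> in M. (\<Sum>k. ennreal (norm (d k \<omega>))) \<noteq> \<infinity>"
    by (intro nn_integral_PInf_AE) auto
  then have conv: "AE \<omega> in M. convergent (\<lambda>k. f (r k) \<omega>)"
  proof eventually_elim
    case (elim \<omega>)
    have "summable (\<lambda>k. norm (d k \<omega>))"
      using elim by (intro summable_suminf_not_top) auto
    then have "summable (\<lambda>k. d k \<omega>)" by (rule summable_norm_cancel)
    then have "convergent (\<lambda>n. \<Sum>k<n. d k \<omega>)" by (simp add: summable_iff_convergent)
    moreover have "(\<Sum>k<n. d k \<omega>) = f (r n) \<omega> - f (r 0) \<omega>" for n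
      unfolding d_def by (rule sum_lessThan_telescope)
    ultimately have "convergent (\<lambda>n. f (r n) \<omega> - f (r 0) \<omega>)" by simp
    from convergent_add[OF this convergent_const[of "f (r 0) \<omega>"]] show ?case by simp
  qed
  \<comment> \<open>\<open>lim\<close> yields a measurable function whether or not the sequence
    converges, so the exceptional null set needs no treatment of its own.\<close>
  define g where "g \<omega> = lim (\<lambda>k. f (r k) \<omega>)" for \<omega>
  have gm[measurable]: "g \<in> borel_measurable M" unfolding g_def by (rule borel_measurable_lim_metric) simp
  have lim: "AE \<omega> in M. (\<lambda>n. f (r n) \<omega>) \<longlonglongrightarrow> g \<omega>"
    using conv by eventually_elim (simp add: g_def convergent_LIMSEQ_iff)
  \<comment> \<open>Fatou's lemma with \<open>n\<close> fixed and the subsequence index tending to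
    infinity.\<close>
  have nn: "(\<integral>\<^sup>+\<omega>. ennreal ((norm (f n \<omega> - g \<omega>))\<^sup>2) \<partial>M) \<le> ennreal ((1/4)^k)" if n: "n \<ge> r k" for n k
  proof -
    have "(\<integral>\<^sup>+\<omega>. ennreal ((norm (f n \<omega> - g \<omega>))\<^sup>2) \<partial>M) \<le> (\<integral>\<^sup>+\<omega>. liminf (\<lambda>j. ennreal ((norm (f n \<omega> - f (r j) \<omega>))\<^sup>2)) \<partial>M)"
    proof (rule nn_integral_mono_AE, use lim in eventually_elim)
      case (elim \<omega>)
      have "(\<lambda>j. ennreal ((norm (f n \<omega> - f (r j) \<omega>))\<^sup>2)) \<longlonglongrightarrow> ennreal ((norm (f n \<omega> - g \<omega>))\<^sup>2)"
        using elim by (intro tendsto_ennrealI tendsto_intros)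
      then show ?case by (simp only: lim_imp_Liminf[OF trivial_limit_sequentially] order_refl)
    qed
    also have "\<dots> \<le> liminf (\<lambda>j. \<integral>\<^sup>+\<omega>. ennreal ((norm (f n \<omega> - f (r j) \<omega>))\<^sup>2) \<partial>M)"
      by (rule nn_integral_liminf) simp
    also have "\<dots> \<le> liminf (\<lambda>j. ennreal ((1/4)^k))"
    proof (rule Liminf_mono, rule eventually_sequentiallyI)
      fix j assume "j \<ge> k"
      then have "r j \<ge> r k" using r by (simp add: strict_mono_less_eq)
      then have "(\<integral>\<omega>. (norm (f n \<omega> - f (r j) \<omega>))\<^sup>2 \<partial>M) < (1/4)^k" using n by (intro rk)
      then show "(\<integral>\<^sup>+\<omega>. ennreal ((norm (f n \<omega> - f (r j) \<omega>))\<^sup>2) \<partial>M) \<le> ennreal ((1/4)^k)"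
        using int by (simp add: nn_integral_eq_integral)
    qed
    also have "\<dots> = ennreal ((1/4)^k)" by (simp add: Liminf_const)
    finally show ?thesis .
  qed
  have I: "integrable M (\<lambda>\<omega>. (norm (f n \<omega> - g \<omega>))\<^sup>2)" if n: "n \<ge> r k" for n k
  proof (rule integrableI_bounded)
    show "(\<integral>\<^sup>+\<omega>. ennreal (norm ((norm (f n \<omega> - g \<omega>))\<^sup>2)) \<partial>M) < \<infinity>"
      using le_less_trans[OF nn[OF n]] by (simp add: ennreal_less_top)
  qed simp
  have I': "integrable M (\<lambda>\<omega>. (norm (f n \<omega> - g \<omega>))\<^sup>2)" for n
    using integrable_norm_sq_add(1)[of "\<lambda>\<omega>. f n \<omega> - f (r 0) \<omega>" M "\<lambda>\<omega>. f (r 0) \<omega> - g \<omega>"] int I[of 0 "r 0"] by simp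
  have "(\<lambda>n. \<integral>\<omega>. (norm (f n \<omega> - g \<omega>))\<^sup>2 \<partial>M) \<longlonglongrightarrow> 0"
  proof (rule LIMSEQ_I)
    fix e :: real assume "e > 0"
    then obtain k where k: "(1/4::real)^k < e" using real_arch_pow_inv[of e "1/4"] by auto
    have "norm ((\<integral>\<omega>. (norm (f n \<omega> - g \<omega>))\<^sup>2 \<partial>M) - 0) < e" if "n \<ge> r k" for n
    proof -
      have "(\<integral>\<omega>. (norm (f n \<omega> - g \<omega>))\<^sup>2 \<partial>M) \<le> (1/4)^k"
        using nn[OF that] I' by (simp add: nn_integral_eq_integral)
      then show ?thesis using k by simp
    qed
    then show "\<exists>no. \<forall>n\<ge>no. norm ((\<integral>\<omega>. (norm (f n \<omega> - g \<omega>))\<^sup>2 \<partial>M) - 0) < e" by blast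
  qed
  then show thesis using that gm I' by blast
qed

text \<open>The map \<open>iexp\<close> is 1-Lipschitz on the reals, so characteristic functions
  differ by at most the \<open>L\<^sup>1\<close> distance, hence by at most the
  \<open>L\<^sup>2\<close> distance.\<close>

lemma (in prob_space) char_tendsto_L2:
  fixes Y :: "nat \<Rightarrow> 'a \<Rightarrow> real"
  assumes [measurable]: "\<And>n. Y n \<in> borel_measurable M" "Z \<in> borel_measurable M"
    and int: "\<And>n. integrable M (\<lambda>\<omega>. (Y n \<omega> - Z \<omega>)\<^sup>2)"
    and lim: "(\<lambda>n. \<integral>\<omega>. (Y n \<omega> - Z \<omega>)\<^sup>2 \<partial>M) \<longlonglongrightarrow> 0"
  shows "(\<lambda>n. CLINT \<omega>|M. iexp (Y n \<omega>)) \<longlonglongrightarrow> (CLINT \<omega>|M. iexp (Z \<omega>))"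
proof (rule LIM_zero_cancel, rule Lim_null_comparison)
  show "(\<lambda>n. sqrt (\<integral>\<omega>. (Y n \<omega> - Z \<omega>)\<^sup>2 \<partial>M)) \<longlonglongrightarrow> 0" using tendsto_real_sqrt[OF lim] by simp
  have b: "cmod (iexp a - iexp b) \<le> \<bar>a - b\<bar>" for a b :: real
  proof -
    have "iexp a - iexp b = iexp b * (iexp (a - b) - 1)" by (simp add: algebra_simps exp_add[symmetric] exp_diff[symmetric])
    then show ?thesis using iexp_approx1[of "a - b" 0] by (simp add: norm_mult)
  qed
  have "norm ((CLINT \<omega>|M. iexp (Y n \<omega>)) - (CLINT \<omega>|M. iexp (Z \<omega>))) \<le> sqrt (\<integral>\<omega>. (Y n \<omega> - Z \<omega>)\<^sup>2 \<partial>M)" for n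
  proof -
    have i: "complex_integrable M (\<lambda>\<omega>. iexp (Y n \<omega>))" "complex_integrable M (\<lambda>\<omega>. iexp (Z \<omega>))" by (auto intro!: integrable_iexp)
    have "(CLINT \<omega>|M. iexp (Y n \<omega>)) - (CLINT \<omega>|M. iexp (Z \<omega>)) = (CLINT \<omega>|M. iexp (Y n \<omega>) - iexp (Z \<omega>))"
      using i by (rule Bochner_Integration.integral_diff[symmetric])
    also have "norm \<dots> \<le> (\<integral>\<omega>. \<bar>Y n \<omega> - Z \<omega>\<bar> \<partial>M)"
    proof (rule order_trans[OF integral_norm_bound integral_mono])
      show "integrable M (\<lambda>\<omega>. \<bar>Y n \<omega> - Z \<omega>\<bar>)"
        by (rule integrable_abs, rule expectation_abs_le_sqrt(1)) (auto simp: int)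
    qed (use i b in auto)
    also have "\<dots> \<le> sqrt (\<integral>\<omega>. (Y n \<omega> - Z \<omega>)\<^sup>2 \<partial>M)"
      by (rule expectation_abs_le_sqrt(2)) (auto simp: int)
    finally show ?thesis .
  qed
  then show "\<forall>\<^sub>F n in sequentially. norm ((CLINT \<omega>|M. iexp (Y n \<omega>)) - (CLINT \<omega>|M. iexp (Z \<omega>))) \<le> sqrt (\<integral>\<omega>. (Y n \<omega> - Z \<omega>)\<^sup>2 \<partial>M)" by simp
qed

text \<open>The two factors of the product measure are independent copies. By Fubini the
  characteristic function factorizes, and the quadratic forms of \<open>a\<close> and
  \<open>b\<close> add in the exponent.\<close>

lemma char_gauss_pair:
  assumes "prob_space M" and g: "gauss_family M Y C" and F: "finite F"
  shows "(CLINT p|M \<Otimes>\<^sub>M M. iexp ((\<Sum>i\<in>F. a i * Y i (fst p)) + (\<Sum>i\<in>F. b i * Y i (snd p)))) =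
     of_real (exp (- (\<Sum>i\<in>F. \<Sum>j\<in>F. (a i * a j + b i * b j) * C i j) / 2))"
proof -
  interpret M: prob_space M by fact
  interpret pair_prob_space M M ..
  have [measurable]: "Y i \<in> borel_measurable M" for i using g by (simp add: gauss_family_def)
  define A where "A \<omega> = (\<Sum>i\<in>F. a i * Y i \<omega>)" for \<omega>
  define B where "B \<omega> = (\<Sum>i\<in>F. b i * Y i \<omega>)" for \<omega>
  have [measurable]: "A \<in> borel_measurable M" "B \<in> borel_measurable M" unfolding A_def B_def by auto
  have "(CLINT p|M \<Otimes>\<^sub>M M. iexp (A (fst p) + B (snd p))) = (CLINT x|M. CLINT y|M. iexp (A x + B y))"
  proof -
    have "complex_integrable (M \<Otimes>\<^sub>M M) (\<lambda>p. iexp (A (fst p) + B (snd p)))"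
      by (rule P.integrable_iexp) auto
    from integral_fst'[OF this] show ?thesis by simp
  qed
  also have "\<dots> = (CLINT x|M. iexp (A x) * (CLINT y|M. iexp (B y)))"
    by (simp add: exp_add distrib_left)
  also have "\<dots> = (CLINT x|M. iexp (A x)) * (CLINT y|M. iexp (B y))" by (rule integral_mult_left_zero)
  also have "\<dots> = of_real (exp (- (\<Sum>i\<in>F. \<Sum>j\<in>F. a i * a j * C i j) / 2) * exp (- (\<Sum>i\<in>F. \<Sum>j\<in>F. b i * b j * C i j) / 2))"
    using g F unfolding A_def B_def gauss_family_def by simp
  also have "\<dots> = of_real (exp (- (\<Sum>i\<in>F. \<Sum>j\<in>F. (a i * a j + b i * b j) * C i j) / 2))"
    by (simp add: exp_add[symmetric] distrib_right sum.distrib add_divide_distrib)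
  finally show ?thesis by (simp add: A_def B_def)
qed

text \<open>The coefficients \<open>a\<close> turn into \<open>c * a\<close> on one copy and
  \<open>s * a\<close> on the other; their quadratic forms add up to that of
  \<open>a\<close>.\<close>

lemma gauss_family_rotate:
  fixes Y :: "'i \<Rightarrow> 'a \<Rightarrow> real"
  assumes "prob_space M" and g: "gauss_family M Y C" and c: "c\<^sup>2 + s\<^sup>2 = (1::real)"
  shows "gauss_family (M \<Otimes>\<^sub>M M) (\<lambda>i p. c * Y i (fst p) + s * Y i (snd p)) C"
  unfolding gauss_family_def
proof (intro conjI allI impI)
  have [measurable]: "Y i \<in> borel_measurable M" for i using g by (simp add: gauss_family_def)
  show "(\<lambda>p. c * Y i (fst p) + s * Y i (snd p)) \<in> borel_measurable (M \<Otimes>\<^sub>M M)" for i by measurable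
  fix F :: "'i set" and a assume F: "finite F"
  have "(\<Sum>i\<in>F. a i * (c * Y i x + s * Y i y)) = (\<Sum>i\<in>F. (c * a i) * Y i x) + (\<Sum>i\<in>F. (s * a i) * Y i y)" for x y
    by (simp add: sum.distrib[symmetric] algebra_simps)
  moreover have "(c * a i) * (c * a j) + (s * a i) * (s * a j) = a i * a j" for i j
  proof -
    have "(c * a i) * (c * a j) + (s * a i) * (s * a j) = (c\<^sup>2 + s\<^sup>2) * (a i * a j)" by (simp add: algebra_simps power2_eq_square)
    then show ?thesis using c by simp
  qed
  ultimately show "(CLINT p|M \<Otimes>\<^sub>M M. iexp (\<Sum>i\<in>F. a i * (c * Y i (fst p) + s * Y i (snd p)))) =
        of_real (exp (- (\<Sum>i\<in>F. \<Sum>j\<in>F. a i * a j * C i j) / 2))"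
    using char_gauss_pair[OF assms(1) g F, of "\<lambda>i. c * a i" "\<lambda>i. s * a i"] by (simp only:)
qed

text \<open>The events that a rotated copy of \<open>\<psi>\<close> is in \<open>V\<close> all have probability \<open>p\<close>, and any two of them
  intersect in the event, of probability \<open>p\<^sup>2\<close>, that both copies are in \<open>V\<close>.\<close>

lemma gaussian_zero_one:
  fixes \<psi> :: "'a \<Rightarrow> 'i::countable \<Rightarrow> real"
  assumes "prob_space M" and \<psi>[measurable]: "\<psi> \<in> borel_measurable M"
    and g: "gauss_family M (\<lambda>i \<omega>. \<psi> \<omega> i) C"
    and V[measurable]: "V \<in> sets borel" and lin: "\<And>a b x y. x \<in> V \<Longrightarrow> y \<in> V \<Longrightarrow> (\<lambda>i. a * x i + b * y i) \<in> V"
  shows "measure M {\<omega> \<in> space M. \<psi> \<omega> \<in> V} \<in> {0, 1}"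
proof -
  interpret M: prob_space M by fact
  interpret pair_prob_space M M ..
  define p where "p = measure M {\<omega> \<in> space M. \<psi> \<omega> \<in> V}"
  have [measurable]: "(\<lambda>\<omega>. \<psi> \<omega> i) \<in> borel_measurable M" for i using \<psi> by (simp add: measurable_into_borel_coordinate)
  \<comment> \<open>Infinitely many distinct angles between 0 and 1: the sine of a difference of two
    of them never vanishes, so any two rotations are linearly independent.\<close>
  define \<theta> where "\<theta> k = 1 / real (Suc k)" for k
  define R where "R k q = (\<lambda>i. cos (\<theta> k) * \<psi> (fst q) i + sin (\<theta> k) * \<psi> (snd q) i)" for k q
  have [measurable]: "R k \<in> borel_measurable (M \<Otimes>\<^sub>M M)" for k
    unfolding R_def measurable_into_borel_coordinate by measurable
  have "distr (M \<Otimes>\<^sub>M M) borel (R k) = distr M borel \<psi>" for k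
  proof (rule distr_borel_eqI_gauss_family[where \<phi>="\<lambda>x. x" and C=C])
    show "gauss_family (M \<Otimes>\<^sub>M M) (\<lambda>i \<omega>. R k \<omega> i) C"
      unfolding R_def by (rule gauss_family_rotate[OF \<open>prob_space M\<close> g]) simp
  qed (auto simp: g P.prob_space_axioms M.prob_space_axioms)
  then have dm: "measure (distr (M \<Otimes>\<^sub>M M) borel (R k)) V = measure (distr M borel \<psi>) V" for k by simp
  define F where "F k = {q \<in> space (M \<Otimes>\<^sub>M M). R k q \<in> V}" for k
  have Fm[measurable]: "F k \<in> sets (M \<Otimes>\<^sub>M M)" for k unfolding F_def by measurable
  have F: "measure (M \<Otimes>\<^sub>M M) (F k) = p" for k
    using dm[of k] by (simp add: measure_distr p_def F_def vimage_def Int_def conj_commute)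
  define W where "W = {\<omega> \<in> space M. \<psi> \<omega> \<in> V} \<times> {\<omega> \<in> space M. \<psi> \<omega> \<in> V}"
  have Wm[measurable]: "W \<in> sets (M \<Otimes>\<^sub>M M)" unfolding W_def by measurable
  have W: "measure (M \<Otimes>\<^sub>M M) W = p * p"
    unfolding W_def p_def by (simp add: measure_def M.emeasure_pair_measure_Times enn2real_mult)
  have WF: "W \<subseteq> F k" for k unfolding W_def F_def R_def by (auto simp: space_pair_measure intro!: lin)
  have FF: "F k \<inter> F j \<subseteq> W" if "k \<noteq> j" for k j
  proof
    fix q assume q: "q \<in> F k \<inter> F j"
    define D where "D = sin (\<theta> j - \<theta> k)"
    have "\<theta> j \<noteq> \<theta> k" "0 < \<theta> j" "\<theta> j \<le> 1" "0 < \<theta> k" "\<theta> k \<le> 1" using that by (auto simp: \<theta>_def)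
    then have D: "D \<noteq> 0" unfolding D_def
      using sin_zero_pi_iff[of "\<theta> j - \<theta> k"] pi_gt3 by auto
    \<comment> \<open>Cramer's rule for the two rotations, with determinant \<open>D\<close>,
      recovers the first copy; the second is recovered in the same way below.\<close>
    have "\<psi> (fst q) = (\<lambda>i. (sin (\<theta> j) / D) * R k q i + (- sin (\<theta> k) / D) * R j q i)"
    proof
      fix i
      have "(sin (\<theta> j)) * R k q i - sin (\<theta> k) * R j q i = D * \<psi> (fst q) i"
        unfolding R_def D_def sin_diff by (simp add: algebra_simps)
      then show "\<psi> (fst q) i = (sin (\<theta> j) / D) * R k q i + (- sin (\<theta> k) / D) * R j q i"
        using D by (simp add: field_simps)
    qed
    moreover have "(\<lambda>i. (sin (\<theta> j) / D) * R k q i + (- sin (\<theta> k) / D) * R j q i) \<in> V" using q by (intro lin) (auto simp: F_def)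
    ultimately have 1: "\<psi> (fst q) \<in> V" by simp
    have "\<psi> (snd q) = (\<lambda>i. (- cos (\<theta> j) / D) * R k q i + (cos (\<theta> k) / D) * R j q i)"
    proof
      fix i
      have "cos (\<theta> k) * R j q i - cos (\<theta> j) * R k q i = D * \<psi> (snd q) i"
        unfolding R_def D_def sin_diff by (simp add: algebra_simps)
      then show "\<psi> (snd q) i = (- cos (\<theta> j) / D) * R k q i + (cos (\<theta> k) / D) * R j q i"
        using D by (simp add: field_simps)
    qed
    moreover have "(\<lambda>i. (- cos (\<theta> j) / D) * R k q i + (cos (\<theta> k) / D) * R j q i) \<in> V" using q by (intro lin) (auto simp: F_def)
    ultimately have 2: "\<psi> (snd q) \<in> V" by simp
    show "q \<in> W" using 1 2 q by (auto simp: W_def F_def space_pair_measure mem_Times_iff)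
  qed
  have G: "measure (M \<Otimes>\<^sub>M M) (F k - W) = p - p * p" for k
    using P.finite_measure_Diff[OF Fm Wm WF] F W by simp
  \<comment> \<open>The sets \<open>F k - W\<close> are disjoint and all have measure
    \<open>p - p * p\<close>. Infinitely many of them fit into a probability space only if this
    number is not positive.\<close>
  have N: "real n * (p - p * p) \<le> 1" for n
  proof -
    have "(\<Sum>k<n. measure (M \<Otimes>\<^sub>M M) (F k - W)) = measure (M \<Otimes>\<^sub>M M) (\<Union>k<n. F k - W)"
      using FF by (intro P.finite_measure_finite_Union[symmetric]) (auto simp: disjoint_family_on_def)
    also have "\<dots> \<le> 1" by (rule P.prob_le_1)
    finally show ?thesis by (simp add: G)
  qed
  have p01: "0 \<le> p" "p \<le> 1" unfolding p_def by auto
  have "p - p * p \<le> 0"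
  proof (rule ccontr)
    assume "\<not> p - p * p \<le> 0"
    then obtain n :: nat where "1 < real n * (p - p * p)" using reals_Archimedean3 by (metis not_le)
    then show False using N[of n] by simp
  qed
  then have "p * (1 - p) \<le> 0" by (simp add: algebra_simps)
  moreover have "p * (1 - p) \<ge> 0" using p01 by simp
  ultimately have "p * (1 - p) = 0" by linarith
  then have "p = 0 \<or> p = 1" by simp
  then show ?thesis by (simp add: p_def)
qed

section \<open>Square integrability of Gaussian elements\<close>

text \<open>Fernique's inequality. For independent copies \<open>x\<close> and \<open>y\<close>, the
  pair of \<open>(x - y) / sqrt 2\<close> and \<open>(x + y) / sqrt 2\<close> has the same law as
  the pair of \<open>x\<close> and \<open>y\<close>. If the first has norm at most \<open>s\<close>
  and the second has norm above \<open>t\<close>, then both \<open>x\<close> and \<open>y\<close>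
  have norm above \<open>(t - s) / sqrt 2\<close>, and independence squares the probability.\<close>

lemma gauss_tail_inequality:
  fixes \<phi> :: "'x::{banach,second_countable_topology} \<Rightarrow> nat \<Rightarrow> real"
  assumes "prob_space M" and cont: "continuous_on UNIV \<phi>" and inj: "inj \<phi>"
    and lin: "\<And>a b x y i. \<phi> (a *\<^sub>R x + b *\<^sub>R y) i = a * \<phi> x i + b * \<phi> y i"
    and \<eta>[measurable]: "\<eta> \<in> borel_measurable M"
    and g: "gauss_family M (\<lambda>i \<omega>. \<phi> (\<eta> \<omega>) i) C"
  shows "measure M {\<omega> \<in> space M. norm (\<eta> \<omega>) \<le> s} * measure M {\<omega> \<in> space M. norm (\<eta> \<omega>) > t}
     \<le> (measure M {\<omega> \<in> space M. norm (\<eta> \<omega>) > (t - s) / sqrt 2})\<^sup>2"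
proof -
  interpret M: prob_space M by fact
  interpret pair_prob_space M M ..
  \<comment> \<open>Coordinates for pairs, indexed by the factor and the position: uniqueness of
    laws is applied to the product space, since the joint law of the rotated pair is what
    matters.\<close>
  define \<Phi> where "\<Phi> z p = \<phi> (if fst p then fst z else snd z) (snd p)" for z :: "'x \<times> 'x" and p :: "bool \<times> nat"
  have cont\<Phi>: "continuous_on UNIV \<Phi>"
  proof (rule continuous_on_coordinatewise_then_product)
    fix p :: "bool \<times> nat"
    have c: "continuous_on UNIV (\<lambda>x. \<phi> x (snd p))" by (rule continuous_on_product_then_coordinatewise[OF cont])
    show "continuous_on UNIV (\<lambda>z. \<Phi> z p)"
    proof (cases "fst p")
      case True
      then show ?thesis unfolding \<Phi>_def using continuous_on_compose2[OF c continuous_on_fst[OF continuous_on_id]] by simp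
    next
      case False
      then show ?thesis unfolding \<Phi>_def using continuous_on_compose2[OF c continuous_on_snd[OF continuous_on_id]] by simp
    qed
  qed
  have inj\<Phi>: "inj \<Phi>"
  proof (rule injI)
    fix y z assume e: "\<Phi> y = \<Phi> z"
    have "\<phi> (fst y) = \<phi> (fst z)" using fun_cong[OF e, of "(True, _)"] by (auto simp: \<Phi>_def)
    moreover have "\<phi> (snd y) = \<phi> (snd z)" using fun_cong[OF e, of "(False, _)"] by (auto simp: \<Phi>_def)
    ultimately show "y = z" using inj by (simp add: inj_eq prod_eq_iff)
  qed
  define \<zeta> where "\<zeta> p = (\<eta> (fst p), \<eta> (snd p))" for p
  define r where "r = 1 / sqrt 2"
  have r: "r > 0" "r * r = 1/2" by (auto simp: r_def)
  define \<zeta>' where "\<zeta>' p = (r *\<^sub>R \<eta> (fst p) + (- r) *\<^sub>R \<eta> (snd p), r *\<^sub>R \<eta> (fst p) + r *\<^sub>R \<eta> (snd p))" for p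
  have [measurable]: "\<zeta> \<in> borel_measurable (M \<Otimes>\<^sub>M M)" "\<zeta>' \<in> borel_measurable (M \<Otimes>\<^sub>M M)"
    unfolding \<zeta>_def \<zeta>'_def borel_prod[symmetric] by measurable
  have d: "distr (M \<Otimes>\<^sub>M M) borel \<zeta> = distr (M \<Otimes>\<^sub>M M) borel \<zeta>'"
  proof (rule distr_borel_eqI_char[OF P.prob_space_axioms P.prob_space_axioms cont\<Phi> inj\<Phi>])
    fix F :: "(bool \<times> nat) set" and c :: "bool \<times> nat \<Rightarrow> real" assume F: "finite F"
    define A where "A = snd ` F"
    define c' where "c' b n = (if (b, n) \<in> F then c (b, n) else 0)" for b n
    have A: "finite A" unfolding A_def using F by simp
    have split: "(\<Sum>i\<in>F. c i * \<Phi> z i) = (\<Sum>n\<in>A. c' True n * \<phi> (fst z) n) + (\<Sum>n\<in>A. c' False n * \<phi> (snd z) n)" for z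
    proof -
      have "(\<Sum>i\<in>F. c i * \<Phi> z i) = (\<Sum>i\<in>UNIV \<times> A. c' (fst i) (snd i) * \<Phi> z i)"
        using F A by (intro sum.mono_neutral_cong_left) (force simp: A_def c'_def)+
      also have "\<dots> = (\<Sum>b\<in>UNIV. \<Sum>n\<in>A. c' b n * \<Phi> z (b, n))" by (simp add: sum.cartesian_product case_prod_beta)
      also have "\<dots> = (\<Sum>n\<in>A. c' True n * \<phi> (fst z) n) + (\<Sum>n\<in>A. c' False n * \<phi> (snd z) n)"
        by (simp add: UNIV_bool \<Phi>_def add.commute)
      finally show ?thesis .
    qed
    define a b where "a = c' True" and "b = c' False"
    have 1: "(\<Sum>i\<in>F. c i * \<Phi> (\<zeta> p) i) = (\<Sum>n\<in>A. a n * \<phi> (\<eta> (fst p)) n) + (\<Sum>n\<in>A. b n * \<phi> (\<eta> (snd p)) n)" for p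
      unfolding split by (simp add: \<zeta>_def a_def b_def)
    have 2: "(\<Sum>i\<in>F. c i * \<Phi> (\<zeta>' p) i) = (\<Sum>n\<in>A. (r * (b n + a n)) * \<phi> (\<eta> (fst p)) n) + (\<Sum>n\<in>A. (r * (b n - a n)) * \<phi> (\<eta> (snd p)) n)" for p
      unfolding split unfolding \<zeta>'_def a_def[symmetric] b_def[symmetric] fst_conv snd_conv lin
      by (simp add: sum.distrib[symmetric] algebra_simps)
    \<comment> \<open>Orthogonality of the rotation by \<open>pi/4\<close>: the quadratic form of
      the pair is unchanged, so \<open>\<zeta>\<close> and \<open>\<zeta>'\<close> have equal
      characteristic functions.\<close>
    have 3: "(r * (b i + a i)) * (r * (b j + a j)) + (r * (b i - a i)) * (r * (b j - a j)) = a i * a j + b i * b j" for i j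
    proof -
      have "(r * (b i + a i)) * (r * (b j + a j)) + (r * (b i - a i)) * (r * (b j - a j)) = (r * r) * (2 * (a i * a j + b i * b j))"
        by (simp add: algebra_simps)
      then show ?thesis by (simp add: r(2))
    qed
    show "(CLINT p|M \<Otimes>\<^sub>M M. iexp (\<Sum>i\<in>F. c i * \<Phi> (\<zeta> p) i)) = (CLINT p|M \<Otimes>\<^sub>M M. iexp (\<Sum>i\<in>F. c i * \<Phi> (\<zeta>' p) i))"
      unfolding 1 2 char_gauss_pair[OF \<open>prob_space M\<close> g A] 3 ..
  qed auto
  define S where "S = {x :: 'x. norm x \<le> s} \<times> {x :: 'x. norm x > t}"
  have Sm: "S \<in> sets borel" unfolding S_def borel_prod[symmetric] by measurable
  define q where "q = measure M {\<omega> \<in> space M. norm (\<eta> \<omega>) > (t - s) / sqrt 2}"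
  have "measure M {\<omega> \<in> space M. norm (\<eta> \<omega>) \<le> s} * measure M {\<omega> \<in> space M. norm (\<eta> \<omega>) > t}
     = measure (M \<Otimes>\<^sub>M M) ({\<omega> \<in> space M. norm (\<eta> \<omega>) \<le> s} \<times> {\<omega> \<in> space M. norm (\<eta> \<omega>) > t})"
    by (simp add: measure_def M.emeasure_pair_measure_Times enn2real_mult)
  also have "\<dots> = measure (distr (M \<Otimes>\<^sub>M M) borel \<zeta>) S"
    using Sm by (subst measure_distr) (auto simp: \<zeta>_def S_def space_pair_measure intro!: arg_cong[where f="measure _"])
  also have "\<dots> = measure (distr (M \<Otimes>\<^sub>M M) borel \<zeta>') S" by (simp add: d)
  also have "\<dots> = measure (M \<Otimes>\<^sub>M M) (\<zeta>' -` S \<inter> space (M \<Otimes>\<^sub>M M))" using Sm by (subst measure_distr) auto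
  also have "\<dots> \<le> measure (M \<Otimes>\<^sub>M M) ({\<omega> \<in> space M. norm (\<eta> \<omega>) > (t - s) / sqrt 2} \<times> {\<omega> \<in> space M. norm (\<eta> \<omega>) > (t - s) / sqrt 2})"
  proof (rule P.finite_measure_mono)
    show "\<zeta>' -` S \<inter> space (M \<Otimes>\<^sub>M M) \<subseteq> {\<omega> \<in> space M. norm (\<eta> \<omega>) > (t - s) / sqrt 2} \<times> {\<omega> \<in> space M. norm (\<eta> \<omega>) > (t - s) / sqrt 2}"
    proof
      fix p assume p: "p \<in> \<zeta>' -` S \<inter> space (M \<Otimes>\<^sub>M M)"
      define x y where "x = \<eta> (fst p)" and "y = \<eta> (snd p)"
      have e: "r *\<^sub>R x + (- r) *\<^sub>R y = r *\<^sub>R (x - y)" "r *\<^sub>R x + r *\<^sub>R y = r *\<^sub>R (x + y)" by (simp_all add: algebra_simps)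
      have 1: "r * norm (x - y) \<le> s" "t < r * norm (x + y)"
        using p r(1) e by (auto simp: \<zeta>'_def S_def x_def[symmetric] y_def[symmetric])
      \<comment> \<open>From \<open>x + y = 2 x + (y - x)\<close> and
        \<open>x + y = 2 y + (x - y)\<close>.\<close>
      have "norm (x + y) \<le> 2 * norm x + norm (x - y)" "norm (x + y) \<le> 2 * norm y + norm (x - y)"
        using norm_triangle_ineq[of "x + x" "y - x"] norm_triangle_ineq[of "y + y" "x - y"]
          norm_triangle_ineq[of x x] norm_triangle_ineq[of y y]
        by (simp_all add: norm_minus_commute add.commute)
      then have "r * norm (x + y) \<le> r * (2 * norm x + norm (x - y))" "r * norm (x + y) \<le> r * (2 * norm y + norm (x - y))"
        using r(1) by (simp_all add: mult_left_mono)
      then have 2: "t - s < 2 * r * norm x" "t - s < 2 * r * norm y" using 1 by (simp_all add: algebra_simps)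
      have "2 * r = sqrt 2" unfolding r_def by (simp add: real_div_sqrt)
      then have "(t - s) / sqrt 2 < norm x" "(t - s) / sqrt 2 < norm y"
        using 2 by (simp_all add: pos_divide_less_eq mult.commute)
      then show "p \<in> {\<omega> \<in> space M. norm (\<eta> \<omega>) > (t - s) / sqrt 2} \<times> {\<omega> \<in> space M. norm (\<eta> \<omega>) > (t - s) / sqrt 2}"
        using p by (auto simp: x_def y_def space_pair_measure mem_Times_iff)
    qed
  qed simp
  also have "\<dots> = q\<^sup>2"
    unfolding q_def by (simp add: measure_def M.emeasure_pair_measure_Times enn2real_mult power2_eq_square)
  finally show ?thesis unfolding q_def .
qed

text \<open>While the threshold grows by the factor \<open>3/2\<close>, its square grows by
  \<open>9/4\<close> and the tail shrinks by \<open>1/4\<close>. The layers therefore contribute a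
  geometric series with ratio \<open>9/16\<close>.\<close>

lemma (in prob_space) integrable_norm_sq_of_geometric_tail:
  fixes \<eta> :: "'a \<Rightarrow> 'x::{banach,second_countable_topology}"
  assumes [measurable]: "\<eta> \<in> borel_measurable M" and u: "u > 0"
    and tail: "\<And>t. t \<ge> u \<Longrightarrow> measure M {\<omega> \<in> space M. norm (\<eta> \<omega>) > 3/2 * t} \<le> measure M {\<omega> \<in> space M. norm (\<eta> \<omega>) > t} / 4"
  shows "integrable M (\<lambda>\<omega>. (norm (\<eta> \<omega>))\<^sup>2)"
proof -
  define v where "v n = (3/2)^n * u" for n :: nat
  have vu: "v n \<ge> u" for n unfolding v_def using u by simp
  have tn: "measure M {\<omega> \<in> space M. norm (\<eta> \<omega>) > v n} \<le> (1/4)^n" for n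
  proof (induction n)
    case 0 then show ?case by simp
  next
    case (Suc n)
    then show ?case using tail[OF vu[of n]] by (simp add: v_def mult.assoc)
  qed
  \<comment> \<open>On the layer where the norm is above \<open>v n\<close> and at most
    \<open>v (Suc n)\<close>, the function \<open>h n\<close> dominates the squared norm.\<close>
  define h where "h n \<omega> = ennreal ((v (Suc n))\<^sup>2) * indicator {\<omega> \<in> space M. norm (\<eta> \<omega>) > v n} \<omega>" for n \<omega>
  have [measurable]: "h n \<in> borel_measurable M" for n unfolding h_def by measurable
  have bound: "ennreal ((norm (\<eta> \<omega>))\<^sup>2) \<le> ennreal (u\<^sup>2) + (\<Sum>n. h n \<omega>)" if \<omega>: "\<omega> \<in> space M" for \<omega>
  proof (cases "norm (\<eta> \<omega>) \<le> u")
    case True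
    then have "(norm (\<eta> \<omega>))\<^sup>2 \<le> u\<^sup>2" by (intro power_mono) auto
    then have "ennreal ((norm (\<eta> \<omega>))\<^sup>2) \<le> ennreal (u\<^sup>2)" by (simp add: ennreal_leI)
    then show ?thesis by (metis add_increasing2 zero_le)
  next
    case False
    obtain n where "norm (\<eta> \<omega>) / u < (3/2)^n" using real_arch_pow[of "3/2" "norm (\<eta> \<omega>) / u"] by auto
    then have ex: "\<exists>n. norm (\<eta> \<omega>) \<le> v n" using u by (intro exI[of _ n]) (simp add: v_def pos_divide_less_eq less_imp_le)
    define m where "m = (LEAST n. norm (\<eta> \<omega>) \<le> v n)"
    have m: "norm (\<eta> \<omega>) \<le> v m" unfolding m_def by (rule LeastI_ex[OF ex])
    have "m \<noteq> 0"
    proof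
      assume "m = 0"
      then show False using m False by (simp add: v_def)
    qed
    then obtain k where k: "m = Suc k" by (cases m) auto
    have vk: "v k < norm (\<eta> \<omega>)" using not_less_Least[of k "\<lambda>n. norm (\<eta> \<omega>) \<le> v n"] k unfolding m_def by simp
    have "(norm (\<eta> \<omega>))\<^sup>2 \<le> (v (Suc k))\<^sup>2" using m k by (intro power_mono) auto
    then have "ennreal ((norm (\<eta> \<omega>))\<^sup>2) \<le> h k \<omega>" using vk \<omega> by (simp add: h_def ennreal_leI)
    also have "\<dots> \<le> (\<Sum>n. h n \<omega>)" using sum_le_suminf[of "\<lambda>n. h n \<omega>" "{k}"] by simp
    finally show ?thesis by (metis add_increasing zero_le)
  qed
  have hn: "(\<integral>\<^sup>+\<omega>. h n \<omega> \<partial>M) \<le> ennreal (9/4 * u\<^sup>2 * (9/16)^n)" for n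
  proof -
    have "(\<integral>\<^sup>+\<omega>. h n \<omega> \<partial>M) = ennreal ((v (Suc n))\<^sup>2) * emeasure M {\<omega> \<in> space M. norm (\<eta> \<omega>) > v n}"
      unfolding h_def by (subst nn_integral_cmult_indicator) auto
    also have "\<dots> = ennreal ((v (Suc n))\<^sup>2 * measure M {\<omega> \<in> space M. norm (\<eta> \<omega>) > v n})"
      by (simp add: emeasure_eq_measure ennreal_mult)
    also have "\<dots> \<le> ennreal ((v (Suc n))\<^sup>2 * (1/4)^n)" by (intro ennreal_leI mult_left_mono tn) simp
    also have "(v (Suc n))\<^sup>2 * (1/4)^n = 9/4 * u\<^sup>2 * (9/16)^n"
    proof -
      have "((3/2)^n)\<^sup>2 * (1/4)^n = (9/16::real)^n"
        by (simp add: power_mult[symmetric] mult.commute[of n 2]) (simp add: power_mult power_mult_distrib[symmetric] power2_eq_square)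
      then show ?thesis by (simp add: v_def power_mult_distrib power2_eq_square mult_ac)
    qed
    finally show ?thesis .
  qed
  have "(\<integral>\<^sup>+\<omega>. ennreal ((norm (\<eta> \<omega>))\<^sup>2) \<partial>M) \<le> (\<integral>\<^sup>+\<omega>. ennreal (u\<^sup>2) + (\<Sum>n. h n \<omega>) \<partial>M)"
    by (intro nn_integral_mono bound)
  also have "\<dots> = ennreal (u\<^sup>2) + (\<Sum>n. \<integral>\<^sup>+\<omega>. h n \<omega> \<partial>M)"
    by (simp add: nn_integral_add nn_integral_suminf emeasure_space_1)
  also have "(\<Sum>n. \<integral>\<^sup>+\<omega>. h n \<omega> \<partial>M) \<le> (\<Sum>n. ennreal (9/4 * u\<^sup>2 * (9/16)^n))"
    by (intro suminf_le hn) auto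
  also have "(\<Sum>n. ennreal (9/4 * u\<^sup>2 * (9/16)^n)) = ennreal (\<Sum>n. 9/4 * u\<^sup>2 * (9/16)^n)"
    by (intro suminf_ennreal2) (auto intro!: summable_mult summable_geometric)
  finally have "(\<integral>\<^sup>+\<omega>. ennreal ((norm (\<eta> \<omega>))\<^sup>2) \<partial>M) < \<infinity>"
    by (rule le_less_trans) (auto simp: add_left_mono)
  then show ?thesis by (intro integrableI_bounded) auto
qed

text \<open>The part of Fernique's theorem used here. At the level \<open>sqrt 2 * t + s\<close> the
  tail inequality reads \<open>(1 - q s) * q (sqrt 2 * t + s) \<le> (q t)\<^sup>2\<close>; the
  square on the right makes the tail decay geometrically as soon as \<open>q s\<close> is
  small.\<close>

lemma gauss_square_integrable:
  fixes \<phi> :: "'x::{banach,second_countable_topology} \<Rightarrow> nat \<Rightarrow> real"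
  assumes "prob_space M" and cont: "continuous_on UNIV \<phi>" and inj: "inj \<phi>"
    and lin: "\<And>a b x y i. \<phi> (a *\<^sub>R x + b *\<^sub>R y) i = a * \<phi> x i + b * \<phi> y i"
    and \<eta>[measurable]: "\<eta> \<in> borel_measurable M"
    and g: "gauss_family M (\<lambda>i \<omega>. \<phi> (\<eta> \<omega>) i) C"
  shows "integrable M (\<lambda>\<omega>. (norm (\<eta> \<omega>))\<^sup>2)"
proof -
  interpret M: prob_space M by fact
  define q where "q t = measure M {\<omega> \<in> space M. norm (\<eta> \<omega>) > t}" for t
  have qmono: "q t \<le> q s" if "s \<le> t" for s t unfolding q_def using that by (intro M.finite_measure_mono) auto
  have q0: "q t \<ge> 0" for t by (simp add: q_def)
  have "(\<lambda>n. q (real n)) \<longlonglongrightarrow> measure M (\<Inter>n. {\<omega> \<in> space M. norm (\<eta> \<omega>) > real n})"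
    unfolding q_def by (intro M.finite_Lim_measure_decseq) (auto simp: decseq_def)
  moreover have "(\<Inter>n. {\<omega> \<in> space M. norm (\<eta> \<omega>) > real n}) = {}"
  proof -
    have "\<exists>n. \<not> norm (\<eta> \<omega>) > real n" for \<omega> using real_arch_simple[of "norm (\<eta> \<omega>)"] by (auto simp: not_less)
    then show ?thesis by auto
  qed
  ultimately have "(\<lambda>n. q (real n)) \<longlonglongrightarrow> 0" by simp
  then have "eventually (\<lambda>n. q (real n) < 1/16) sequentially" by (rule order_tendstoD) simp
  then obtain n0 where n0: "\<And>n. n \<ge> n0 \<Longrightarrow> q (real n) < 1/16" by (auto simp: eventually_sequentially)
  define s where "s = real (Suc n0)"
  \<comment> \<open>With this bound \<open>1 - q s\<close> is at least \<open>1/4\<close> and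
    \<open>q t\<close> is at most \<open>1/16\<close> for \<open>t \<ge> s\<close>; together they
    give the factor \<open>1/4\<close> in the tail condition.\<close>
  have s: "s \<ge> 1" "q s < 1/16" unfolding s_def using n0[of "Suc n0"] by auto
  show ?thesis
  \<comment> \<open>For \<open>t \<ge> 12 * s\<close> one has
    \<open>sqrt 2 * t + s \<le> 3/2 * t\<close>, because \<open>1.415 + 1/12 < 1.5\<close>.\<close>
  proof (rule M.integrable_norm_sq_of_geometric_tail[OF \<eta>, where u="12 * s"])
    show "12 * s > 0" using s by simp
    fix t assume t: "t \<ge> 12 * s"
    have "measure M {\<omega> \<in> space M. norm (\<eta> \<omega>) \<le> s} = 1 - q s"
    proof -
      have "{\<omega> \<in> space M. norm (\<eta> \<omega>) \<le> s} = space M - {\<omega> \<in> space M. norm (\<eta> \<omega>) > s}" by auto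
      then show ?thesis unfolding q_def by (simp add: M.prob_compl)
    qed
    then have "(1 - q s) * q (sqrt 2 * t + s) \<le> (q t)\<^sup>2"
      using gauss_tail_inequality[OF assms, of s "sqrt 2 * t + s"] by (simp add: q_def)
    moreover have "(1 - q s) * q (sqrt 2 * t + s) \<ge> 1/4 * q (sqrt 2 * t + s)" using s q0 by (intro mult_right_mono) auto
    moreover have "(q t)\<^sup>2 \<le> 1/16 * q t" unfolding power2_eq_square using qmono[of s t] t s q0[of t] by (intro mult_right_mono) auto
    ultimately have 1: "q (sqrt 2 * t + s) \<le> q t / 4" by linarith
    have "sqrt 2 \<le> 1415/1000" by (rule real_le_lsqrt) (auto simp: power2_eq_square)
    then have "sqrt 2 * t \<le> 1415/1000 * t" using t s by (intro mult_right_mono) auto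
    then have "q (3/2 * t) \<le> q (sqrt 2 * t + s)" using t s(1) by (intro qmono) linarith
    then show "measure M {\<omega> \<in> space M. norm (\<eta> \<omega>) > 3/2 * t} \<le> measure M {\<omega> \<in> space M. norm (\<eta> \<omega>) > t} / 4"
      using 1 unfolding q_def by linarith
  qed
qed

section \<open>Hilbert spaces of functions\<close>

text \<open>The common core of the Cauchy-Schwarz inequalities for integrals and for
  \<open>ip\<close>. It is also used with \<open>a = 0\<close>, where it forces
  \<open>b = 0\<close>: the first-order condition at a minimum.\<close>

lemma discriminant_le:
  fixes a b c :: real
  assumes "\<And>t. 0 \<le> a + 2 * t * b + t\<^sup>2 * c"
  shows "b\<^sup>2 \<le> a * c"
proof (cases "c = 0")
  case True
  have "b = 0"
  proof (rule ccontr)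
    assume "b \<noteq> 0"
    then show False using assms[of "- (a + 1) / (2 * b)"] True by (simp add: field_simps)
  qed
  then show ?thesis using True by simp
next
  case False
  have "c \<ge> 0"
  proof (rule ccontr)
    assume "\<not> c \<ge> 0"
    then have c: "c < 0" by simp
    \<comment> \<open>Large enough for the negative quadratic term to outweigh the linear and the
      constant term.\<close>
    define t where "t = (1 + \<bar>a\<bar> + 2 * \<bar>b\<bar>) / (- c) + 1"
    have t: "t \<ge> 1" unfolding t_def using divide_nonneg_pos[of "1 + \<bar>a\<bar> + 2 * \<bar>b\<bar>" "- c"] c by simp
    have "t * c = - (1 + \<bar>a\<bar> + 2 * \<bar>b\<bar>) + c" unfolding t_def using c by (simp add: field_simps)
    then have "t * c < - (\<bar>a\<bar> + 2 * \<bar>b\<bar>)" using c by linarith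
    then have "t * (t * c) < t * - (\<bar>a\<bar> + 2 * \<bar>b\<bar>)" using t by (intro mult_strict_left_mono) auto
    also have "\<dots> \<le> - \<bar>a\<bar> - 2 * t * \<bar>b\<bar>" using t mult_right_mono[of 1 t "\<bar>a\<bar>"] by (simp add: algebra_simps)
    also have "\<dots> \<le> - a - 2 * t * b"
    proof -
      have "2 * t * - b \<ge> 2 * t * - \<bar>b\<bar>" using t by (intro mult_left_mono) auto
      then show ?thesis using abs_ge_self[of a] by linarith
    qed
    finally have "t * (t * c) < - a - 2 * t * b" .
    then show False using assms[of t] by (simp add: power2_eq_square algebra_simps)
  qed
  then have c: "c > 0" using False by simp
  have "0 \<le> a + 2 * (- b / c) * b + (- b / c)\<^sup>2 * c" by (rule assms)
  also have "\<dots> = a - b\<^sup>2 / c" using c by (simp add: power2_eq_square field_simps)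
  finally show ?thesis using c by (simp add: field_simps)
qed

lemma integral_product_Cauchy_Schwarz:
  fixes f g :: "'a \<Rightarrow> real"
  assumes [measurable]: "f \<in> borel_measurable M" "g \<in> borel_measurable M"
    and f: "integrable M (\<lambda>\<omega>. (f \<omega>)\<^sup>2)" and g: "integrable M (\<lambda>\<omega>. (g \<omega>)\<^sup>2)"
  shows "(\<integral>\<omega>. f \<omega> * g \<omega> \<partial>M)\<^sup>2 \<le> (\<integral>\<omega>. (f \<omega>)\<^sup>2 \<partial>M) * (\<integral>\<omega>. (g \<omega>)\<^sup>2 \<partial>M)"
proof (rule discriminant_le)
  fix t :: real
  have i: "integrable M (\<lambda>\<omega>. f \<omega> * g \<omega>)" using f g by (intro product_integrable_of_squares) auto
  have "0 \<le> (\<integral>\<omega>. (f \<omega> + t * g \<omega>)\<^sup>2 \<partial>M)" by simp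
  also have "\<dots> = (\<integral>\<omega>. (f \<omega>)\<^sup>2 + 2 * t * (f \<omega> * g \<omega>) + t\<^sup>2 * (g \<omega>)\<^sup>2 \<partial>M)"
    by (intro Bochner_Integration.integral_cong) (auto simp: power2_eq_square algebra_simps)
  also have "\<dots> = (\<integral>\<omega>. (f \<omega>)\<^sup>2 \<partial>M) + 2 * t * (\<integral>\<omega>. f \<omega> * g \<omega> \<partial>M) + t\<^sup>2 * (\<integral>\<omega>. (g \<omega>)\<^sup>2 \<partial>M)"
    using f g i by simp
  finally show "0 \<le> (\<integral>\<omega>. (f \<omega>)\<^sup>2 \<partial>M) + 2 * t * (\<integral>\<omega>. f \<omega> * g \<omega> \<partial>M) + t\<^sup>2 * (\<integral>\<omega>. (g \<omega>)\<^sup>2 \<partial>M)" .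
qed

text \<open>Convergence of squared norms under norm convergence, freed from its Hilbert space:
  \<open>L\<close> is the squared norm of the limit, \<open>a n\<close> that of the difference, and
  \<open>b n\<close> their inner product. It serves both \<open>H\<close> and the square integrable
  variables.\<close>

lemma tendsto_of_square_perturbation:
  fixes a b x :: "nat \<Rightarrow> real"
  assumes a: "a \<longlonglongrightarrow> 0" and b: "\<And>n. (b n)\<^sup>2 \<le> L * a n" and x: "\<And>n. x n = L + 2 * b n + a n"
  shows "x \<longlonglongrightarrow> L"
proof -
  have "(\<lambda>n. sqrt (L * a n)) \<longlonglongrightarrow> 0" using tendsto_real_sqrt[OF tendsto_mult_left[OF a, of L]] by simp
  then have "b \<longlonglongrightarrow> 0"
    by (rule Lim_null_comparison[rotated]) (use b in \<open>auto intro!: always_eventually real_le_rsqrt\<close>)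
  then have "(\<lambda>n. L + 2 * b n + a n) \<longlonglongrightarrow> L + 2 * 0 + 0" using a by (intro tendsto_intros)
  moreover have "x = (\<lambda>n. L + 2 * b n + a n)" using x by blast
  ultimately show ?thesis by simp
qed

definition lin_comb :: "'i set \<Rightarrow> ('i \<Rightarrow> real) \<Rightarrow> ('i \<Rightarrow> 't \<Rightarrow> real) \<Rightarrow> 't \<Rightarrow> real" where
  "lin_comb F a v = (\<lambda>s. \<Sum>k\<in>F. a k * v k s)"

locale function_hilbert =
  fixes H :: "('t \<Rightarrow> real) set" and ip :: "('t \<Rightarrow> real) \<Rightarrow> ('t \<Rightarrow> real) \<Rightarrow> real"
  assumes hilbert: "hilbert_function_space H ip"
begin

lemma zero_in: "(\<lambda>s. 0) \<in> H" and add_in: "x \<in> H \<Longrightarrow> y \<in> H \<Longrightarrow> (\<lambda>s. x s + y s) \<in> H"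
  and scale_in: "x \<in> H \<Longrightarrow> (\<lambda>s. c * x s) \<in> H"
  using hilbert by (auto simp: hilbert_function_space_def function_subspace_def)

lemma ip_sym: "x \<in> H \<Longrightarrow> y \<in> H \<Longrightarrow> ip x y = ip y x"
  and ip_add_left: "x \<in> H \<Longrightarrow> y \<in> H \<Longrightarrow> z \<in> H \<Longrightarrow> ip (\<lambda>s. x s + y s) z = ip x z + ip y z"
  and ip_scale_left: "x \<in> H \<Longrightarrow> y \<in> H \<Longrightarrow> ip (\<lambda>s. c * x s) y = c * ip x y"
  and ip_nonneg: "x \<in> H \<Longrightarrow> 0 \<le> ip x x"
  and ip_eq_0: "x \<in> H \<Longrightarrow> ip x x = 0 \<Longrightarrow> x = (\<lambda>s. 0)"
  using hilbert by (auto simp: hilbert_function_space_def inner_product_on_def)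

lemma ip_add_right: "x \<in> H \<Longrightarrow> y \<in> H \<Longrightarrow> z \<in> H \<Longrightarrow> ip z (\<lambda>s. x s + y s) = ip z x + ip z y"
  using ip_add_left[of x y z] by (simp add: ip_sym[of z] add_in)

lemma ip_scale_right: "x \<in> H \<Longrightarrow> y \<in> H \<Longrightarrow> ip y (\<lambda>s. c * x s) = c * ip y x"
  using ip_scale_left[of x y c] by (simp add: ip_sym[of y] scale_in)

lemma diff_in: "x \<in> H \<Longrightarrow> y \<in> H \<Longrightarrow> (\<lambda>s. x s - y s) \<in> H"
  using add_in[OF _ scale_in[of y "-1"], of x] by simp

lemma ip_diff_left: "x \<in> H \<Longrightarrow> y \<in> H \<Longrightarrow> z \<in> H \<Longrightarrow> ip (\<lambda>s. x s - y s) z = ip x z - ip y z"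
  using ip_add_left[of x "\<lambda>s. (-1) * y s" z] ip_scale_left[of y z "-1"] scale_in[of y "-1"] by simp

lemma ip_diff_right: "x \<in> H \<Longrightarrow> y \<in> H \<Longrightarrow> z \<in> H \<Longrightarrow> ip z (\<lambda>s. x s - y s) = ip z x - ip z y"
  using ip_diff_left[of x y z] by (simp add: ip_sym[of z] diff_in)

lemma ip_zero_left [simp]: "y \<in> H \<Longrightarrow> ip (\<lambda>s. 0) y = 0"
  using ip_scale_left[of "\<lambda>s. 0" y 0] zero_in by simp

lemma ip_zero_right [simp]: "y \<in> H \<Longrightarrow> ip y (\<lambda>s. 0) = 0"
  using ip_sym[of y "\<lambda>s. 0"] zero_in by simp

lemma lin_comb_in: "finite F \<Longrightarrow> (\<And>k. k \<in> F \<Longrightarrow> v k \<in> H) \<Longrightarrow> lin_comb F a v \<in> H"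
proof (induction F rule: finite_induct)
  case empty then show ?case using zero_in by (simp add: lin_comb_def)
next
  case (insert k F)
  have "lin_comb (insert k F) a v = (\<lambda>s. a k * v k s + lin_comb F a v s)" using insert.hyps by (auto simp: lin_comb_def)
  then show ?case using insert by (auto intro!: add_in scale_in)
qed

lemma ip_lin_comb_left: "finite F \<Longrightarrow> (\<And>k. k \<in> F \<Longrightarrow> v k \<in> H) \<Longrightarrow> y \<in> H \<Longrightarrow> ip (lin_comb F a v) y = (\<Sum>k\<in>F. a k * ip (v k) y)"
proof (induction F rule: finite_induct)
  case empty then show ?case by (simp add: lin_comb_def)
next
  case (insert k F)
  have "lin_comb (insert k F) a v = (\<lambda>s. a k * v k s + lin_comb F a v s)" using insert.hyps by (auto simp: lin_comb_def)
  then show ?case using insert by (simp add: ip_add_left scale_in lin_comb_in ip_scale_left)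
qed

lemma ip_lin_comb_right: "finite F \<Longrightarrow> (\<And>k. k \<in> F \<Longrightarrow> v k \<in> H) \<Longrightarrow> y \<in> H \<Longrightarrow> ip y (lin_comb F a v) = (\<Sum>k\<in>F. a k * ip y (v k))"
  using ip_lin_comb_left[of F v y a] by (simp add: ip_sym[of y] lin_comb_in)

lemma ip_add_scale:
  assumes "x \<in> H" "y \<in> H"
  shows "ip (\<lambda>s. x s + t * y s) (\<lambda>s. x s + t * y s) = ip x x + 2 * t * ip x y + t\<^sup>2 * ip y y"
  using assms by (simp add: ip_add_left ip_add_right ip_scale_left ip_scale_right scale_in add_in ip_sym[of y x])
    (simp add: power2_eq_square)

lemma ip_Cauchy_Schwarz:
  assumes "x \<in> H" "y \<in> H"
  shows "(ip x y)\<^sup>2 \<le> ip x x * ip y y"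
proof (rule discriminant_le)
  fix t
  show "0 \<le> ip x x + 2 * t * ip x y + t\<^sup>2 * ip y y"
    using ip_nonneg[OF add_in[OF assms(1) scale_in[OF assms(2), of t]]] ip_add_scale[OF assms, of t] by simp
qed

lemma ip_tendsto:
  assumes u: "\<And>n. u n \<in> H" and h: "h \<in> H" and y: "y \<in> H"
    and lim: "(\<lambda>n. ip (\<lambda>s. u n s - h s) (\<lambda>s. u n s - h s)) \<longlonglongrightarrow> 0"
  shows "(\<lambda>n. ip (u n) y) \<longlonglongrightarrow> ip h y"
proof (rule LIM_zero_cancel, rule Lim_null_comparison)
  show "(\<lambda>n. sqrt (ip (\<lambda>s. u n s - h s) (\<lambda>s. u n s - h s) * ip y y)) \<longlonglongrightarrow> 0"
    using tendsto_real_sqrt[OF tendsto_mult_left[OF lim, of "ip y y"]] by (simp add: mult.commute)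
  have "\<bar>ip (u n) y - ip h y\<bar> \<le> sqrt (ip (\<lambda>s. u n s - h s) (\<lambda>s. u n s - h s) * ip y y)" for n
    using ip_Cauchy_Schwarz[of "\<lambda>s. u n s - h s" y] u h y by (intro real_le_rsqrt) (simp add: ip_diff_left diff_in)
  then show "\<forall>\<^sub>F n in sequentially. norm (ip (u n) y - ip h y) \<le> sqrt (ip (\<lambda>s. u n s - h s) (\<lambda>s. u n s - h s) * ip y y)" by simp
qed

lemma ip_norm_tendsto:
  assumes u: "\<And>n. u n \<in> H" and h: "h \<in> H"
    and lim: "(\<lambda>n. ip (\<lambda>s. u n s - h s) (\<lambda>s. u n s - h s)) \<longlonglongrightarrow> 0"
  shows "(\<lambda>n. ip (u n) (u n)) \<longlonglongrightarrow> ip h h"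
proof (rule tendsto_of_square_perturbation[OF lim])
  fix n
  let ?d = "\<lambda>s. u n s - h s"
  have d: "?d \<in> H" using u h by (intro diff_in)
  show "(ip h ?d)\<^sup>2 \<le> ip h h * ip ?d ?d" by (rule ip_Cauchy_Schwarz[OF h d])
  show "ip (u n) (u n) = ip h h + 2 * ip h ?d + ip ?d ?d" using ip_add_scale[OF h d, of 1] by simp
qed

lemma complete:
  assumes u: "\<And>n. u n \<in> H" and cau: "\<And>e. e > 0 \<Longrightarrow> \<exists>N. \<forall>m\<ge>N. \<forall>n\<ge>N. ip (\<lambda>s. u m s - u n s) (\<lambda>s. u m s - u n s) < e"
  shows "\<exists>x\<in>H. (\<lambda>n. ip (\<lambda>s. u n s - x s) (\<lambda>s. u n s - x s)) \<longlonglongrightarrow> 0"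
proof -
  have "ip_complete H ip" using hilbert by (simp add: hilbert_function_space_def)
  moreover have "\<exists>N. \<forall>m\<ge>N. \<forall>n\<ge>N. ip_norm ip (\<lambda>s. u m s - u n s) < e" if "e > 0" for e
  proof -
    obtain N where N: "\<And>m n. m \<ge> N \<Longrightarrow> n \<ge> N \<Longrightarrow> ip (\<lambda>s. u m s - u n s) (\<lambda>s. u m s - u n s) < e\<^sup>2" using cau[of "e\<^sup>2"] \<open>e > 0\<close> by auto
    have "ip_norm ip (\<lambda>s. u m s - u n s) < e" if "m \<ge> N" "n \<ge> N" for m n
      unfolding ip_norm_def using N[OF that] \<open>e > 0\<close> by (intro real_less_lsqrt) (auto intro!: ip_nonneg diff_in u)
    then show ?thesis by blast
  qed
  ultimately obtain x where x: "x \<in> H" "(\<lambda>n. ip_norm ip (\<lambda>s. u n s - x s)) \<longlonglongrightarrow> 0"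
    using u unfolding ip_complete_def by blast
  have "(\<lambda>n. (ip_norm ip (\<lambda>s. u n s - x s))\<^sup>2) \<longlonglongrightarrow> 0" using tendsto_power[OF x(2), of 2] by simp
  moreover have "(ip_norm ip (\<lambda>s. u n s - x s))\<^sup>2 = ip (\<lambda>s. u n s - x s) (\<lambda>s. u n s - x s)" for n
    unfolding ip_norm_def using u x(1) by (simp add: ip_nonneg diff_in)
  ultimately show ?thesis using x(1) by auto
qed

text \<open>Orthogonal projection onto the closure of \<open>S\<close>. As \<open>S\<close> need not
  be closed, the projection \<open>k\<close> is returned together with a sequence in
  \<open>S\<close> converging to it; the construction of \<open>Z\<close> needs such
  approximants.\<close>

lemma projection_sequence:
  assumes S: "function_subspace S" "S \<subseteq> H" and h: "h \<in> H"
  obtains u k where "\<And>n. u n \<in> S" "k \<in> H" "(\<lambda>n. ip (\<lambda>s. u n s - k s) (\<lambda>s. u n s - k s)) \<longlonglongrightarrow> 0"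
    "\<And>y. y \<in> S \<Longrightarrow> ip (\<lambda>s. h s - k s) y = 0"
proof -
  have sS: "(\<lambda>s. x s + y s) \<in> S" if "x \<in> S" "y \<in> S" for x y
    using S(1) that by (auto simp: function_subspace_def)
  have cS: "(\<lambda>s. c * x s) \<in> S" if "x \<in> S" for c x
    using S(1) that by (auto simp: function_subspace_def)
  define N where "N x = ip (\<lambda>s. h s - x s) (\<lambda>s. h s - x s)" for x
  have N0: "N x \<ge> 0" if "x \<in> H" for x unfolding N_def using h that by (intro ip_nonneg diff_in)
  define d where "d = Inf (N ` S)"
  have ne: "N ` S \<noteq> {}" using S(1) by (auto simp: function_subspace_def)
  have bd: "bdd_below (N ` S)" using N0 S(2) by (intro bdd_belowI[of _ 0]) auto
  have dle: "d \<le> N x" if "x \<in> S" for x unfolding d_def using bd that by (intro cInf_lower) auto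
  have "\<exists>x\<in>S. N x < d + 1 / real (Suc n)" for n
    using cInf_lessD[OF ne, of "d + 1 / real (Suc n)"] unfolding d_def by auto
  then obtain u where u: "\<And>n. u n \<in> S" "\<And>n. N (u n) < d + 1 / real (Suc n)" by metis
  have uH: "u n \<in> H" for n using u(1) S(2) by blast
  \<comment> \<open>The parallelogram law. The midpoint \<open>w\<close> of two almost minimizers is
    in \<open>S\<close>, so its distance to \<open>h\<close> is bounded below by \<open>d\<close>,
    which forces the two to be close.\<close>
  have par: "ip (\<lambda>s. u m s - u n s) (\<lambda>s. u m s - u n s) \<le> 2 * (1 / real (Suc m)) + 2 * (1 / real (Suc n))" for m n
  proof -
    define a where "a = (\<lambda>s. h s - u m s)"
    define b where "b = (\<lambda>s. h s - u n s)"
    have ab: "a \<in> H" "b \<in> H" unfolding a_def b_def using h uH by (auto intro: diff_in)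
    define w where "w = (\<lambda>s. 1/2 * (u m s + u n s))"
    have "w \<in> S" unfolding w_def by (rule cS[OF sS[OF u(1)[of m] u(1)[of n]]])
    have e1: "(\<lambda>s. b s + (-1) * a s) = (\<lambda>s. u m s - u n s)" by (auto simp: a_def b_def)
    have e2: "(\<lambda>s. h s - w s) = (\<lambda>s. 1/2 * (b s + 1 * a s))" by (auto simp: a_def b_def w_def field_simps)
    have c: "(\<lambda>s. b s + 1 * a s) \<in> H" using ab by (auto intro: add_in)
    have "N w = 1/4 * ip (\<lambda>s. b s + 1 * a s) (\<lambda>s. b s + 1 * a s)"
      unfolding N_def e2 ip_scale_left[OF c scale_in[OF c]] ip_scale_right[OF c c] by simp
    also have "\<dots> = 1/4 * (ip b b + 2 * ip b a + ip a a)" using ip_add_scale[OF ab(2,1), of 1] by simp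
    finally have "ip b b + 2 * ip b a + ip a a \<ge> 4 * d" using dle[OF \<open>w \<in> S\<close>] by simp
    moreover have "ip (\<lambda>s. u m s - u n s) (\<lambda>s. u m s - u n s) = ip b b - 2 * ip b a + ip a a"
      using ip_add_scale[OF ab(2,1), of "-1"] unfolding e1 by simp
    moreover have "ip a a < d + 1 / real (Suc m)" "ip b b < d + 1 / real (Suc n)" using u(2) unfolding N_def a_def b_def by auto
    ultimately show ?thesis by linarith
  qed
  have "\<exists>N. \<forall>m\<ge>N. \<forall>n\<ge>N. ip (\<lambda>s. u m s - u n s) (\<lambda>s. u m s - u n s) < e" if "e > 0" for e
  proof -
    obtain N where N: "inverse (real (Suc N)) < e / 4" using reals_Archimedean[of "e/4"] \<open>e > 0\<close> by auto
    have "ip (\<lambda>s. u m s - u n s) (\<lambda>s. u m s - u n s) < e" if "m \<ge> N" "n \<ge> N" for m n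
    proof -
      have "1 / real (Suc m) \<le> 1 / real (Suc N)" "1 / real (Suc n) \<le> 1 / real (Suc N)" using that by (auto intro!: divide_left_mono)
      then show ?thesis using par[of m n] N by (simp add: inverse_eq_divide)
    qed
    then show ?thesis by blast
  qed
  from complete[OF uH this] obtain k where k: "k \<in> H" "(\<lambda>n. ip (\<lambda>s. u n s - k s) (\<lambda>s. u n s - k s)) \<longlonglongrightarrow> 0" by auto
  have "ip (\<lambda>s. h s - k s) y = 0" if y: "y \<in> S" for y
  proof -
    have yH: "y \<in> H" using y S(2) by blast
    have conv: "(\<lambda>n. N (u n)) \<longlonglongrightarrow> N k"
    proof -
      have e: "(\<lambda>s. (h s - u n s) - (h s - k s)) = (\<lambda>s. (-1) * (u n s - k s))" for n by auto
      have c: "(\<lambda>s. u n s - k s) \<in> H" for n using uH k by (intro diff_in)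
      have "(\<lambda>n. ip (\<lambda>s. (h s - u n s) - (h s - k s)) (\<lambda>s. (h s - u n s) - (h s - k s))) \<longlonglongrightarrow> 0"
        unfolding e using k(2) by (simp only: ip_scale_left[OF c scale_in[OF c]] ip_scale_right[OF c c]) simp
      then show ?thesis unfolding N_def by (rule ip_norm_tendsto[rotated 2]) (use h uH k in \<open>auto intro: diff_in\<close>)
    qed
    have "N k \<le> d"
    proof (rule LIMSEQ_le[OF conv])
      show "(\<lambda>n. d + 1 / real (Suc n)) \<longlonglongrightarrow> d" using tendsto_add[OF tendsto_const LIMSEQ_inverse_real_of_nat] by (simp add: inverse_eq_divide)
      show "\<exists>N0. \<forall>n\<ge>N0. N (u n) \<le> d + 1 / real (Suc n)" using u(2) less_imp_le by blast
    qed
    have hk: "(\<lambda>s. h s - k s) \<in> H" using h k by (intro diff_in)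
    \<comment> \<open>\<open>k\<close> may lie outside of \<open>S\<close>, so the variation by
      \<open>t * y\<close> is made at \<open>u n\<close>, which stays in \<open>S\<close>, and
      passed to the limit.\<close>
    have "0 \<le> 0 + 2 * t * ip (\<lambda>s. h s - k s) y + t\<^sup>2 * ip y y" for t
    proof -
      have un: "(\<lambda>s. u n s + (- t) * y s) \<in> S" for n by (rule sS[OF u(1) cS[OF y]])
      have e: "(\<lambda>s. h s - (u n s + (- t) * y s)) = (\<lambda>s. (h s - u n s) + t * y s)" for n by auto
      have hu: "(\<lambda>s. h s - u n s) \<in> H" for n using h uH by (intro diff_in)
      have N': "N (\<lambda>s. u n s + (- t) * y s) = N (u n) + 2 * t * ip (\<lambda>s. h s - u n s) y + t\<^sup>2 * ip y y" for n
        unfolding N_def e by (rule ip_add_scale[OF hu yH])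
      have e3: "ip (\<lambda>s. h s - u n s) y = ip h y - ip (u n) y" for n using h uH yH by (simp add: ip_diff_left)
      have e4: "ip (\<lambda>s. h s - k s) y = ip h y - ip k y" using h k yH by (simp add: ip_diff_left)
      have "(\<lambda>n. N (u n) + 2 * t * ip (\<lambda>s. h s - u n s) y + t\<^sup>2 * ip y y) \<longlonglongrightarrow> N k + 2 * t * ip (\<lambda>s. h s - k s) y + t\<^sup>2 * ip y y"
        unfolding e3 e4 by (intro tendsto_intros conv ip_tendsto uH k yH)
      then have "d \<le> N k + 2 * t * ip (\<lambda>s. h s - k s) y + t\<^sup>2 * ip y y"
        by (rule LIMSEQ_le_const) (use dle[OF un] in \<open>simp only: N', blast\<close>)
      then show ?thesis using \<open>N k \<le> d\<close> by linarith
    qed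
    from discriminant_le[OF this] show ?thesis by simp
  qed
  then show thesis using that u(1) k by blast
qed

end

section \<open>Isonormal processes\<close>

text \<open>Linearity of \<open>Z\<close> is not part of the data; it holds almost surely and
  follows from \<open>Z_ip\<close>. Measurability is required also outside of \<open>H\<close>, so
  that it carries no side condition.\<close>

locale isonormal = function_hilbert H ip + prob_space M
  for H :: "('t \<Rightarrow> real) set" and ip and M :: "'w measure" +
  fixes Z :: "('t \<Rightarrow> real) \<Rightarrow> 'w \<Rightarrow> real"
  assumes Z_measurable [measurable]: "\<And>h. Z h \<in> borel_measurable M"
    and Z_sq: "h \<in> H \<Longrightarrow> integrable M (\<lambda>\<omega>. (Z h \<omega>)\<^sup>2)"
    and Z_ip: "h \<in> H \<Longrightarrow> g \<in> H \<Longrightarrow> (\<integral>\<omega>. Z h \<omega> * Z g \<omega> \<partial>M) = ip h g"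
    and Z_char: "h \<in> H \<Longrightarrow> (CLINT \<omega>|M. iexp (Z h \<omega>)) = of_real (exp (- ip h h / 2))"
begin

lemma Z_prod: "h \<in> H \<Longrightarrow> g \<in> H \<Longrightarrow> integrable M (\<lambda>\<omega>. Z h \<omega> * Z g \<omega>)"
  by (intro product_integrable_of_squares Z_sq) auto

text \<open>The mean square of the difference of both sides expands, by \<open>Z_ip\<close>, to the
  squared norm of the zero vector.\<close>

lemma Z_lin_comb:
  assumes F: "finite F" and v: "\<And>k. k \<in> F \<Longrightarrow> v k \<in> H"
  shows "AE \<omega> in M. Z (lin_comb F a v) \<omega> = (\<Sum>k\<in>F. a k * Z (v k) \<omega>)"
proof -
  have l: "lin_comb F a v \<in> H" using F v by (rule lin_comb_in)
  define D where "D \<omega> = Z (lin_comb F a v) \<omega> - (\<Sum>k\<in>F. a k * Z (v k) \<omega>)" for \<omega>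
  have e: "(D \<omega>)\<^sup>2 = Z (lin_comb F a v) \<omega> * Z (lin_comb F a v) \<omega> - 2 * (\<Sum>k\<in>F. a k * (Z (v k) \<omega> * Z (lin_comb F a v) \<omega>))
      + (\<Sum>k\<in>F. \<Sum>j\<in>F. a k * a j * (Z (v k) \<omega> * Z (v j) \<omega>))" for \<omega>
    unfolding D_def power2_eq_square by (simp add: algebra_simps sum_product sum_distrib_left sum_distrib_right)
  have i1: "integrable M (\<lambda>\<omega>. \<Sum>k\<in>F. a k * (Z (v k) \<omega> * Z (lin_comb F a v) \<omega>))"
    using v l by (auto intro!: Bochner_Integration.integrable_sum Z_prod)
  have i2: "integrable M (\<lambda>\<omega>. \<Sum>k\<in>F. \<Sum>j\<in>F. a k * a j * (Z (v k) \<omega> * Z (v j) \<omega>))"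
    using v by (auto intro!: Bochner_Integration.integrable_sum Z_prod)
  have i: "integrable M (\<lambda>\<omega>. (D \<omega>)\<^sup>2)"
    unfolding e using i1 i2 Z_prod[OF l l] by simp
  have "(\<integral>\<omega>. (D \<omega>)\<^sup>2 \<partial>M) = ip (lin_comb F a v) (lin_comb F a v) - 2 * (\<Sum>k\<in>F. a k * ip (v k) (lin_comb F a v)) + (\<Sum>k\<in>F. \<Sum>j\<in>F. a k * a j * ip (v k) (v j))"
  proof -
    have "(\<integral>\<omega>. (\<Sum>k\<in>F. a k * (Z (v k) \<omega> * Z (lin_comb F a v) \<omega>)) \<partial>M) = (\<Sum>k\<in>F. a k * ip (v k) (lin_comb F a v))"
      using v l by (subst Bochner_Integration.integral_sum) (auto intro!: Z_prod simp: Z_ip)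
    moreover have "(\<integral>\<omega>. (\<Sum>k\<in>F. \<Sum>j\<in>F. a k * a j * (Z (v k) \<omega> * Z (v j) \<omega>)) \<partial>M) = (\<Sum>k\<in>F. \<Sum>j\<in>F. a k * a j * ip (v k) (v j))"
      using v by (subst Bochner_Integration.integral_sum, force intro!: Bochner_Integration.integrable_sum Z_prod,
        intro sum.cong refl, subst Bochner_Integration.integral_sum) (auto intro!: Z_prod simp: Z_ip)
    ultimately show ?thesis unfolding e using i1 i2 Z_prod[OF l l] Z_ip[OF l l] by simp
  qed
  also have "\<dots> = 0"
  proof -
    have "(\<Sum>k\<in>F. a k * ip (v k) (lin_comb F a v)) = ip (lin_comb F a v) (lin_comb F a v)"
      using ip_lin_comb_left[OF F v l] by simp
    moreover have "(\<Sum>k\<in>F. \<Sum>j\<in>F. a k * a j * ip (v k) (v j)) = (\<Sum>k\<in>F. a k * ip (v k) (lin_comb F a v))"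
      using F v by (intro sum.cong) (auto simp: ip_lin_comb_right sum_distrib_left mult.assoc)
    ultimately show ?thesis by simp
  qed
  finally have "AE \<omega> in M. (D \<omega>)\<^sup>2 = 0"
    using integral_nonneg_eq_0_iff_AE[OF i] by simp
  then show ?thesis by eventually_elim (simp add: D_def)
qed

text \<open>Equality with \<open>Z\<close> is demanded only almost surely, because coordinates of
  random elements are known only up to null sets.\<close>

lemma gauss_family_Z:
  fixes v :: "'i \<Rightarrow> 't \<Rightarrow> real"
  assumes v: "\<And>i. v i \<in> H" and Y[measurable]: "\<And>i. Y i \<in> borel_measurable M" and YZ: "\<And>i. AE \<omega> in M. Y i \<omega> = Z (v i) \<omega>"
  shows "gauss_family M Y (\<lambda>i j. ip (v i) (v j))"
  unfolding gauss_family_def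
proof (intro conjI allI impI)
  fix F :: "'i set" and c assume F: "finite F"
  have "AE \<omega> in M. \<forall>i\<in>F. Y i \<omega> = Z (v i) \<omega>" using F YZ by (simp add: AE_finite_all)
  then have "AE \<omega> in M. (\<Sum>i\<in>F. c i * Y i \<omega>) = Z (lin_comb F c v) \<omega>"
    using Z_lin_comb[where F=F and v=v and a=c, OF F v] by eventually_elim simp
  then have "AE \<omega> in M. iexp (\<Sum>i\<in>F. c i * Y i \<omega>) = iexp (Z (lin_comb F c v) \<omega>)"
    by eventually_elim (simp only:)
  then have "(CLINT \<omega>|M. iexp (\<Sum>i\<in>F. c i * Y i \<omega>)) = (CLINT \<omega>|M. iexp (Z (lin_comb F c v) \<omega>))"
    by (intro integral_cong_AE) measurable
  also have "\<dots> = of_real (exp (- ip (lin_comb F c v) (lin_comb F c v) / 2))" using F v by (intro Z_char lin_comb_in)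
  also have "ip (lin_comb F c v) (lin_comb F c v) = (\<Sum>i\<in>F. \<Sum>j\<in>F. c i * c j * ip (v i) (v j))"
    using F v by (simp add: ip_lin_comb_left ip_lin_comb_right lin_comb_in sum_distrib_left mult.assoc)
      (subst sum.swap, simp add: mult.left_commute)
  finally show "(CLINT \<omega>|M. iexp (\<Sum>i\<in>F. c i * Y i \<omega>)) = of_real (exp (- (\<Sum>i\<in>F. \<Sum>j\<in>F. c i * c j * ip (v i) (v j)) / 2))" .
qed simp

end

text \<open>Sending the kernel function at \<open>t\<close> to \<open>\<xi> t\<close> is isometric
  on linear combinations, as both sides have Gram matrix \<open>K\<close>. It extends to all of
  \<open>H\<close> by mean square limits, and Gaussian characteristic functions survive these
  limits.\<close>

lemma isonormal_exists:
  fixes \<xi> :: "'t \<Rightarrow> 'w \<Rightarrow> real"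
  assumes M: "prob_space M" and gp: "centered_gaussian_process M \<xi>" and K: "K = covariance_function M \<xi>"
    and rk: "is_rkhs K H ip"
  shows "\<exists>Z. isonormal H ip M Z \<and> (\<forall>t. AE \<omega> in M. \<xi> t \<omega> = Z (\<lambda>s. K s t) \<omega>)"
proof -
  interpret prob_space M by fact
  interpret function_hilbert H ip using rk by unfold_locales (simp add: is_rkhs_def)
  have KH: "(\<lambda>s. K s t) \<in> H" for t using rk by (simp add: is_rkhs_def)
  have rep: "ip x (\<lambda>s. K s t) = x t" if "x \<in> H" for x t using rk that by (simp add: is_rkhs_def)
  have [measurable]: "\<xi> t \<in> borel_measurable M" for t using gp by (simp add: centered_gaussian_process_def)
  note gf = gaussian_process_gauss_family[OF gp]
  define k where "k t = (\<lambda>s. K s t)" for t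
  have kH: "k t \<in> H" for t using KH by (simp add: k_def)
  have ipk: "ip (k s) (k t) = K s t" for s t
    unfolding ip_sym[OF kH kH, of s t] unfolding k_def using rep[OF KH] by simp
  \<comment> \<open>A relation rather than a map: kernel functions may be linearly dependent, so a
    combination need not determine its coefficients or its random variable pointwise.\<close>
  define S where "S = {(lin_comb F c k, \<lambda>\<omega>. \<Sum>t\<in>F. c t * \<xi> t \<omega>) | F c. finite F}"
  have S_diff: "(\<lambda>s. u s + a * u' s, \<lambda>\<omega>. U \<omega> + a * U' \<omega>) \<in> S" if uU: "(u, U) \<in> S" "(u', U') \<in> S" for u U u' U' a
  proof -
    obtain F c F' c' where F: "finite F" "finite F'" and e: "u = lin_comb F c k" "U = (\<lambda>\<omega>. \<Sum>t\<in>F. c t * \<xi> t \<omega>)"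
      "u' = lin_comb F' c' k" "U' = (\<lambda>\<omega>. \<Sum>t\<in>F'. c' t * \<xi> t \<omega>)"
      using uU unfolding S_def by auto
    define d where "d t = (if t \<in> F then c t else 0) + a * (if t \<in> F' then c' t else 0)" for t
    have ds: "(\<Sum>t\<in>F \<union> F'. d t * f t) = (\<Sum>t\<in>F. c t * f t) + a * (\<Sum>t\<in>F'. c' t * f t)" for f :: "'t \<Rightarrow> real"
    proof -
      have "(\<Sum>t\<in>F \<union> F'. d t * f t) = (\<Sum>t\<in>F \<union> F'. (if t \<in> F then c t * f t else 0)) + (\<Sum>t\<in>F \<union> F'. (if t \<in> F' then a * (c' t * f t) else 0))"
        unfolding sum.distrib[symmetric] by (intro sum.cong) (auto simp: d_def algebra_simps)
      also have "(\<Sum>t\<in>F \<union> F'. (if t \<in> F then c t * f t else 0)) = (\<Sum>t\<in>F. c t * f t)"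
        using F by (intro sum.mono_neutral_cong_right) auto
      also have "(\<Sum>t\<in>F \<union> F'. (if t \<in> F' then a * (c' t * f t) else 0)) = (\<Sum>t\<in>F'. a * (c' t * f t))"
        using F by (intro sum.mono_neutral_cong_right) auto
      finally show ?thesis by (simp add: sum_distrib_left)
    qed
    have "(\<lambda>s. u s + a * u' s) = lin_comb (F \<union> F') d k" "(\<lambda>\<omega>. U \<omega> + a * U' \<omega>) = (\<lambda>\<omega>. \<Sum>t\<in>F \<union> F'. d t * \<xi> t \<omega>)"
      unfolding e lin_comb_def ds by auto
    then show ?thesis using F unfolding S_def by blast
  qed
  have S_props: "u \<in> H" "U \<in> borel_measurable M" "integrable M (\<lambda>\<omega>. (U \<omega>)\<^sup>2)" "(\<integral>\<omega>. (U \<omega>)\<^sup>2 \<partial>M) = ip u u"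
    "(CLINT \<omega>|M. iexp (U \<omega>)) = of_real (exp (- ip u u / 2))" if uU: "(u, U) \<in> S" for u U
  proof -
    obtain F c where F: "finite F" and e: "u = lin_comb F c k" "U = (\<lambda>\<omega>. \<Sum>t\<in>F. c t * \<xi> t \<omega>)"
      using uU unfolding S_def by auto
    show "u \<in> H" unfolding e using F kH by (intro lin_comb_in) auto
    show "U \<in> borel_measurable M" unfolding e by measurable
    have g: "centered_gaussian_rv M U" using gp F by (simp add: e centered_gaussian_process_def centered_gaussian_vector_def)
    show "integrable M (\<lambda>\<omega>. (U \<omega>)\<^sup>2)" by (rule centered_gaussian_rv_char(1)[OF g])
    have i: "integrable M (\<lambda>\<omega>. \<xi> s \<omega> * \<xi> t \<omega>)" for s t by (intro product_integrable_of_squares gf(1)) auto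
    have "(\<integral>\<omega>. (U \<omega>)\<^sup>2 \<partial>M) = (\<integral>\<omega>. (\<Sum>s\<in>F. \<Sum>t\<in>F. c s * c t * (\<xi> s \<omega> * \<xi> t \<omega>)) \<partial>M)"
      by (intro Bochner_Integration.integral_cong) (auto simp: e power2_eq_square sum_product mult_ac)
    also have "\<dots> = (\<Sum>s\<in>F. \<Sum>t\<in>F. c s * c t * K s t)" using i by (simp add: K covariance_function_def)
    also have "\<dots> = ip u u"
      unfolding e using F kH by (simp add: ip_lin_comb_left ip_lin_comb_right lin_comb_in ipk sum_distrib_left mult.assoc)
        (subst sum.swap, simp add: mult.left_commute)
    finally show v: "(\<integral>\<omega>. (U \<omega>)\<^sup>2 \<partial>M) = ip u u" .
    show "(CLINT \<omega>|M. iexp (U \<omega>)) = of_real (exp (- ip u u / 2))"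
      using centered_gaussian_rv_char(2)[OF g] unfolding v .
  qed
  \<comment> \<open>The closure of the relation \<open>S\<close>. A variable paired with
    \<open>h\<close> is unique up to null sets, because differences are paired with the zero
    function and have mean square zero.\<close>
  define cp where "cp h Z \<longleftrightarrow> Z \<in> borel_measurable M \<and> (\<exists>u U. (\<forall>n::nat. (u n, U n) \<in> S) \<and>
      (\<lambda>n. ip (\<lambda>s. u n s - h s) (\<lambda>s. u n s - h s)) \<longlonglongrightarrow> 0 \<and> (\<forall>n. integrable M (\<lambda>\<omega>. (U n \<omega> - Z \<omega>)\<^sup>2)) \<and>
      (\<lambda>n. \<integral>\<omega>. (U n \<omega> - Z \<omega>)\<^sup>2 \<partial>M) \<longlonglongrightarrow> 0)" for h Z
  have cp_props: "integrable M (\<lambda>\<omega>. (Z \<omega>)\<^sup>2)" "(\<integral>\<omega>. (Z \<omega>)\<^sup>2 \<partial>M) = ip h h"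
    "(CLINT \<omega>|M. iexp (Z \<omega>)) = of_real (exp (- ip h h / 2))" if h: "h \<in> H" and c: "cp h Z" for h Z
  proof -
    obtain u U where [measurable]: "Z \<in> borel_measurable M" and uU: "\<And>n. (u n, U n) \<in> S"
      and lu: "(\<lambda>n. ip (\<lambda>s. u n s - h s) (\<lambda>s. u n s - h s)) \<longlonglongrightarrow> 0"
      and iU: "\<And>n. integrable M (\<lambda>\<omega>. (U n \<omega> - Z \<omega>)\<^sup>2)" and lU: "(\<lambda>n. \<integral>\<omega>. (U n \<omega> - Z \<omega>)\<^sup>2 \<partial>M) \<longlonglongrightarrow> 0"
      using c unfolding cp_def by blast
    note [measurable] = S_props(2)[OF uU]
    show iZ: "integrable M (\<lambda>\<omega>. (Z \<omega>)\<^sup>2)"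
      using integrable_norm_sq_diff(1)[of "U 0" M "\<lambda>\<omega>. U 0 \<omega> - Z \<omega>"] iU[of 0] S_props(3)[OF uU, of 0] by simp
    have l1: "(\<lambda>n. ip (u n) (u n)) \<longlonglongrightarrow> ip h h" by (rule ip_norm_tendsto[OF S_props(1)[OF uU] h lu])
    have "(\<lambda>n. \<integral>\<omega>. (U n \<omega>)\<^sup>2 \<partial>M) \<longlonglongrightarrow> (\<integral>\<omega>. (Z \<omega>)\<^sup>2 \<partial>M)"
    proof (rule tendsto_of_square_perturbation[OF lU])
      fix n
      show "(\<integral>\<omega>. Z \<omega> * (U n \<omega> - Z \<omega>) \<partial>M)\<^sup>2 \<le> (\<integral>\<omega>. (Z \<omega>)\<^sup>2 \<partial>M) * (\<integral>\<omega>. (U n \<omega> - Z \<omega>)\<^sup>2 \<partial>M)"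
        by (rule integral_product_Cauchy_Schwarz) (simp_all add: iZ iU)
      have ip: "integrable M (\<lambda>\<omega>. Z \<omega> * (U n \<omega> - Z \<omega>))"
        by (rule product_integrable_of_squares) (simp_all add: iZ iU)
      have "(\<integral>\<omega>. (U n \<omega>)\<^sup>2 \<partial>M) = (\<integral>\<omega>. (Z \<omega>)\<^sup>2 + 2 * (Z \<omega> * (U n \<omega> - Z \<omega>)) + (U n \<omega> - Z \<omega>)\<^sup>2 \<partial>M)"
        by (intro Bochner_Integration.integral_cong) (auto simp: power2_eq_square algebra_simps)
      also have "\<dots> = (\<integral>\<omega>. (Z \<omega>)\<^sup>2 \<partial>M) + 2 * (\<integral>\<omega>. Z \<omega> * (U n \<omega> - Z \<omega>) \<partial>M) + (\<integral>\<omega>. (U n \<omega> - Z \<omega>)\<^sup>2 \<partial>M)"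
        using iZ ip iU[of n] by simp
      finally show "(\<integral>\<omega>. (U n \<omega>)\<^sup>2 \<partial>M) = (\<integral>\<omega>. (Z \<omega>)\<^sup>2 \<partial>M) + 2 * (\<integral>\<omega>. Z \<omega> * (U n \<omega> - Z \<omega>) \<partial>M) + (\<integral>\<omega>. (U n \<omega> - Z \<omega>)\<^sup>2 \<partial>M)" .
    qed
    then show "(\<integral>\<omega>. (Z \<omega>)\<^sup>2 \<partial>M) = ip h h"
      using l1 LIMSEQ_unique by (simp add: S_props(4)[OF uU])
    have "(\<lambda>n. CLINT \<omega>|M. iexp (U n \<omega>)) \<longlonglongrightarrow> (CLINT \<omega>|M. iexp (Z \<omega>))"
      by (rule char_tendsto_L2[OF _ _ iU lU]) auto
    moreover have "(\<lambda>n. CLINT \<omega>|M. iexp (U n \<omega>)) \<longlonglongrightarrow> of_real (exp (- ip h h / 2))"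
      unfolding S_props(5)[OF uU] by (intro tendsto_intros l1) simp
    ultimately show "(CLINT \<omega>|M. iexp (Z \<omega>)) = of_real (exp (- ip h h / 2))" by (rule LIMSEQ_unique)
  qed
  have cp_add: "cp (\<lambda>s. h s + g s) (\<lambda>\<omega>. Z \<omega> + W \<omega>)" if h: "h \<in> H" "g \<in> H" and c: "cp h Z" "cp g W" for h g Z W
  proof -
    obtain u U where [measurable]: "Z \<in> borel_measurable M" and uU: "\<And>n. (u n, U n) \<in> S"
      and lu: "(\<lambda>n. ip (\<lambda>s. u n s - h s) (\<lambda>s. u n s - h s)) \<longlonglongrightarrow> 0"
      and iU: "\<And>n. integrable M (\<lambda>\<omega>. (U n \<omega> - Z \<omega>)\<^sup>2)" and lU: "(\<lambda>n. \<integral>\<omega>. (U n \<omega> - Z \<omega>)\<^sup>2 \<partial>M) \<longlonglongrightarrow> 0"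
      using c(1) unfolding cp_def by blast
    obtain v V where [measurable]: "W \<in> borel_measurable M" and vV: "\<And>n. (v n, V n) \<in> S"
      and lv: "(\<lambda>n. ip (\<lambda>s. v n s - g s) (\<lambda>s. v n s - g s)) \<longlonglongrightarrow> 0"
      and iV: "\<And>n. integrable M (\<lambda>\<omega>. (V n \<omega> - W \<omega>)\<^sup>2)" and lV: "(\<lambda>n. \<integral>\<omega>. (V n \<omega> - W \<omega>)\<^sup>2 \<partial>M) \<longlonglongrightarrow> 0"
      using c(2) unfolding cp_def by blast
    note [measurable] = S_props(2)[OF uU] S_props(2)[OF vV]
    have i: "integrable M (\<lambda>\<omega>. (norm ((U n \<omega> - Z \<omega>) + (V n \<omega> - W \<omega>)))\<^sup>2)"
      "(\<integral>\<omega>. (norm ((U n \<omega> - Z \<omega>) + (V n \<omega> - W \<omega>)))\<^sup>2 \<partial>M) \<le> 2 * (\<integral>\<omega>. (U n \<omega> - Z \<omega>)\<^sup>2 \<partial>M) + 2 * (\<integral>\<omega>. (V n \<omega> - W \<omega>)\<^sup>2 \<partial>M)" for n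
      using integrable_norm_sq_add[of "\<lambda>\<omega>. U n \<omega> - Z \<omega>" M "\<lambda>\<omega>. V n \<omega> - W \<omega>"] iU iV by simp_all
    have l: "(\<lambda>n. 2 * a n + 2 * b n) \<longlonglongrightarrow> 0" if "a \<longlonglongrightarrow> 0" "b \<longlonglongrightarrow> 0" for a b :: "nat \<Rightarrow> real"
      using tendsto_add[OF tendsto_mult_left[OF that(1), of 2] tendsto_mult_left[OF that(2), of 2]] by simp
    show ?thesis unfolding cp_def
    proof (intro conjI exI allI)
      show "(\<lambda>s. u n s + 1 * v n s, \<lambda>\<omega>. U n \<omega> + 1 * V n \<omega>) \<in> S" for n by (rule S_diff[OF uU vV])
      show "(\<lambda>n. ip (\<lambda>s. u n s + 1 * v n s - (h s + g s)) (\<lambda>s. u n s + 1 * v n s - (h s + g s))) \<longlonglongrightarrow> 0"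
      proof (rule Lim_null_comparison[OF _ l[OF lu lv]], rule always_eventually, rule allI)
        fix n
        define x y where "x = (\<lambda>s. u n s - h s)" and "y = (\<lambda>s. v n s - g s)"
        have xy: "x \<in> H" "y \<in> H" unfolding x_def y_def using h S_props(1)[OF uU] S_props(1)[OF vV] by (auto intro: diff_in)
        have e: "(\<lambda>s. u n s + 1 * v n s - (h s + g s)) = (\<lambda>s. x s + 1 * y s)" by (auto simp: x_def y_def)
        have "ip (\<lambda>s. x s + 1 * y s) (\<lambda>s. x s + 1 * y s) \<ge> 0" "ip (\<lambda>s. x s + (-1) * y s) (\<lambda>s. x s + (-1) * y s) \<ge> 0"
          by (intro ip_nonneg add_in scale_in xy)+
        then show "norm (ip (\<lambda>s. u n s + 1 * v n s - (h s + g s)) (\<lambda>s. u n s + 1 * v n s - (h s + g s))) \<le> 2 * ip (\<lambda>s. u n s - h s) (\<lambda>s. u n s - h s) + 2 * ip (\<lambda>s. v n s - g s) (\<lambda>s. v n s - g s)"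
          unfolding e x_def[symmetric] y_def[symmetric] ip_add_scale[OF xy] by simp
      qed
      show "integrable M (\<lambda>\<omega>. (U n \<omega> + 1 * V n \<omega> - (Z \<omega> + W \<omega>))\<^sup>2)" for n
        using i(1)[of n] by (simp add: algebra_simps)
      show "(\<lambda>n. \<integral>\<omega>. (U n \<omega> + 1 * V n \<omega> - (Z \<omega> + W \<omega>))\<^sup>2 \<partial>M) \<longlonglongrightarrow> 0"
      proof (rule Lim_null_comparison[OF _ l[OF lU lV]], rule always_eventually, rule allI)
        fix n
        show "norm (\<integral>\<omega>. (U n \<omega> + 1 * V n \<omega> - (Z \<omega> + W \<omega>))\<^sup>2 \<partial>M) \<le> 2 * (\<integral>\<omega>. (U n \<omega> - Z \<omega>)\<^sup>2 \<partial>M) + 2 * (\<integral>\<omega>. (V n \<omega> - W \<omega>)\<^sup>2 \<partial>M)"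
          using i(2)[of n] by (simp add: algebra_simps)
      qed
    qed simp
  qed
  have ex: "\<exists>Z. cp h Z" if h: "h \<in> H" for h
  proof -
    have fs: "function_subspace (fst ` S)" unfolding function_subspace_def
    proof (intro conjI ballI allI)
      have "(lin_comb {} (\<lambda>_. 0) k, \<lambda>\<omega>. \<Sum>t\<in>{}. 0 * \<xi> t \<omega>) \<in> S" unfolding S_def by blast
      then have z: "(\<lambda>s. 0, \<lambda>\<omega>. 0) \<in> S" by (simp add: lin_comb_def)
      then show "(\<lambda>s. 0) \<in> fst ` S" by force
      fix x assume "x \<in> fst ` S"
      then obtain X where X: "(x, X) \<in> S" by force
      show "(\<lambda>s. c * x s) \<in> fst ` S" for c using S_diff[OF z X, of c] by force
      fix y assume "y \<in> fst ` S"
      then obtain Y where Y: "(y, Y) \<in> S" by force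
      show "(\<lambda>s. x s + y s) \<in> fst ` S" using S_diff[OF X Y, of 1] by force
    qed
    have sub: "fst ` S \<subseteq> H" using S_props(1) by force
    obtain u g where u: "\<And>n. u n \<in> fst ` S" and g: "g \<in> H" and lu: "(\<lambda>n. ip (\<lambda>s. u n s - g s) (\<lambda>s. u n s - g s)) \<longlonglongrightarrow> 0"
      and orth: "\<And>y. y \<in> fst ` S \<Longrightarrow> ip (\<lambda>s. h s - g s) y = 0"
      using projection_sequence[OF fs sub h] by blast
    \<comment> \<open>Density of the kernel functions: the residual is orthogonal to the kernel
      function at \<open>t\<close>, and this inner product is its value at \<open>t\<close>.\<close>
    have "h t = g t" for t
    proof -
      have "(lin_comb {t} (\<lambda>_. 1) k, \<lambda>\<omega>. \<Sum>t\<in>{t}. 1 * \<xi> t \<omega>) \<in> S" unfolding S_def by blast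
      then have "k t \<in> fst ` S" by (force simp: lin_comb_def)
      from orth[OF this] show ?thesis using rep[OF diff_in[OF h g], of t] by (simp add: k_def)
    qed
    then have hg: "g = h" by auto
    have "\<forall>n. \<exists>X. (u n, X) \<in> S"
    proof
      fix n
      obtain p where "p \<in> S" "u n = fst p" using u[of n] by auto
      then show "\<exists>X. (u n, X) \<in> S" by (intro exI[of _ "snd p"]) simp
    qed
    from choice[OF this] obtain U where uU: "\<And>n. (u n, U n) \<in> S" by blast
    note [measurable] = S_props(2)[OF uU]
    have dS: "(\<lambda>s. u m s + (-1) * u n s, \<lambda>\<omega>. U m \<omega> + (-1) * U n \<omega>) \<in> S" for m n by (rule S_diff[OF uU uU])
    have dI: "integrable M (\<lambda>\<omega>. (norm (U m \<omega> - U n \<omega>))\<^sup>2)" for m n using S_props(3)[OF dS[of m n]] by simp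
    have dV: "(\<integral>\<omega>. (norm (U m \<omega> - U n \<omega>))\<^sup>2 \<partial>M) = ip (\<lambda>s. u m s - u n s) (\<lambda>s. u m s - u n s)" for m n using S_props(4)[OF dS[of m n]] by simp
    have cauU: "\<exists>N. \<forall>m\<ge>N. \<forall>n\<ge>N. (\<integral>\<omega>. (norm (U m \<omega> - U n \<omega>))\<^sup>2 \<partial>M) < e" if "e > 0" for e
    proof -
      obtain N where N: "\<And>n. n \<ge> N \<Longrightarrow> norm (ip (\<lambda>s. u n s - h s) (\<lambda>s. u n s - h s) - 0) < e / 4"
        using LIMSEQ_D[OF lu[unfolded hg], of "e/4"] \<open>e > 0\<close> by auto
      have "(\<integral>\<omega>. (norm (U m \<omega> - U n \<omega>))\<^sup>2 \<partial>M) < e" if "m \<ge> N" "n \<ge> N" for m n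
      proof -
        define x y where "x = (\<lambda>s. u m s - h s)" and "y = (\<lambda>s. u n s - h s)"
        have xy: "x \<in> H" "y \<in> H" unfolding x_def y_def using h S_props(1)[OF uU] by (auto intro: diff_in)
        have e: "(\<lambda>s. u m s - u n s) = (\<lambda>s. x s + (-1) * y s)" by (auto simp: x_def y_def)
        have "ip (\<lambda>s. x s + 1 * y s) (\<lambda>s. x s + 1 * y s) \<ge> 0" by (intro ip_nonneg add_in scale_in xy)
        moreover have "ip x x < e/4" "ip y y < e/4" using N[OF that(1)] N[OF that(2)] unfolding x_def y_def by auto
        ultimately show ?thesis unfolding dV e ip_add_scale[OF xy] by simp
      qed
      then show ?thesis by blast
    qed
    obtain Z where "Z \<in> borel_measurable M" "\<And>n. integrable M (\<lambda>\<omega>. (norm (U n \<omega> - Z \<omega>))\<^sup>2)"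
      "(\<lambda>n. \<integral>\<omega>. (norm (U n \<omega> - Z \<omega>))\<^sup>2 \<partial>M) \<longlonglongrightarrow> 0"
      using L2_complete[where f=U, OF S_props(2)[OF uU] dI cauU] by blast
    then have "cp h Z" unfolding cp_def using uU lu hg by (intro conjI exI[of _ u] exI[of _ U] allI) auto
    then show ?thesis by blast
  qed
  define Z where "Z h = (if h \<in> H then (SOME Z. cp h Z) else (\<lambda>_. 0))" for h
  have cpZ: "cp h (Z h)" if "h \<in> H" for h unfolding Z_def using someI_ex[OF ex[OF that]] that by simp
  have Zm: "Z h \<in> borel_measurable M" for h
    by (cases "h \<in> H") (use cpZ[of h] in \<open>auto simp: cp_def Z_def[of h]\<close>)
  note [measurable] = Zm
  have "isonormal H ip M Z"
  proof unfold_locales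
    fix h g assume h: "h \<in> H" "g \<in> H"
    note a = cp_props[OF h(1) cpZ[OF h(1)]] cp_props[OF h(2) cpZ[OF h(2)]] cp_props[OF add_in[OF h] cp_add[OF h cpZ[OF h(1)] cpZ[OF h(2)]]]
    have i: "integrable M (\<lambda>\<omega>. Z h \<omega> * Z g \<omega>)" by (intro product_integrable_of_squares a) auto
    \<comment> \<open>Polarization: closure pairs are known to preserve squared norms, and the sum
      \<open>Z h + Z g\<close> is paired with \<open>h + g\<close> although it may differ from the
      chosen variable of \<open>h + g\<close>.\<close>
    have "(\<integral>\<omega>. (Z h \<omega> + Z g \<omega>)\<^sup>2 \<partial>M) = (\<integral>\<omega>. (Z h \<omega>)\<^sup>2 + 2 * (Z h \<omega> * Z g \<omega>) + (Z g \<omega>)\<^sup>2 \<partial>M)"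
      by (intro Bochner_Integration.integral_cong) (auto simp: power2_eq_square algebra_simps)
    also have "\<dots> = ip h h + 2 * (\<integral>\<omega>. Z h \<omega> * Z g \<omega> \<partial>M) + ip g g" using a i by simp
    finally show "(\<integral>\<omega>. Z h \<omega> * Z g \<omega> \<partial>M) = ip h g"
      using a(8) ip_add_scale[OF h, of 1] by simp
  qed (use Zm cp_props cpZ in auto)
  moreover have "AE \<omega> in M. \<xi> t \<omega> = Z (\<lambda>s. K s t) \<omega>" for t
  proof -
    have cpt: "cp (k t) (\<xi> t)" unfolding cp_def
    proof (intro conjI exI[of _ "\<lambda>_. k t"] exI[of _ "\<lambda>_. \<xi> t"] allI)
      have "(lin_comb {t} (\<lambda>_. 1) k, \<lambda>\<omega>. \<Sum>t\<in>{t}. 1 * \<xi> t \<omega>) \<in> S" unfolding S_def by blast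
      then show "(k t, \<xi> t) \<in> S" by (simp add: lin_comb_def)
      show "(\<lambda>n. ip (\<lambda>s. k t s - k t s) (\<lambda>s. k t s - k t s)) \<longlonglongrightarrow> 0" using zero_in by simp
    qed simp_all
    have nH: "(\<lambda>s. (-1) * k t s) \<in> H" by (intro scale_in kH)
    obtain u U where um: "Z (k t) \<in> borel_measurable M" and uU: "\<And>n::nat. (u n, U n) \<in> S"
      and lu: "(\<lambda>n. ip (\<lambda>s. u n s - k t s) (\<lambda>s. u n s - k t s)) \<longlonglongrightarrow> 0"
      and iU: "\<And>n. integrable M (\<lambda>\<omega>. (U n \<omega> - Z (k t) \<omega>)\<^sup>2)" and lU: "(\<lambda>n. \<integral>\<omega>. (U n \<omega> - Z (k t) \<omega>)\<^sup>2 \<partial>M) \<longlonglongrightarrow> 0"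
      using cpZ[OF kH[of t]] unfolding cp_def by blast
    have "cp (\<lambda>s. (-1) * k t s) (\<lambda>\<omega>. - Z (k t) \<omega>)" unfolding cp_def
    proof (intro conjI exI allI)
      have z: "(lin_comb {} (\<lambda>_. 0) k, \<lambda>\<omega>. \<Sum>t\<in>{}. 0 * \<xi> t \<omega>) \<in> S" unfolding S_def by blast
      show "(\<lambda>s. (-1) * u n s, \<lambda>\<omega>. - U n \<omega>) \<in> S" for n using S_diff[OF z uU, of "-1" n] by (simp add: lin_comb_def)
      have c: "(\<lambda>s. u n s - k t s) \<in> H" for n using S_props(1)[OF uU] kH by (intro diff_in)
      have e: "(\<lambda>s. (-1) * u n s - (-1) * k t s) = (\<lambda>s. (-1) * (u n s - k t s))" for n by auto
      show "(\<lambda>n. ip (\<lambda>s. (-1) * u n s - (-1) * k t s) (\<lambda>s. (-1) * u n s - (-1) * k t s)) \<longlonglongrightarrow> 0"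
        unfolding e ip_scale_left[OF c scale_in[OF c]] ip_scale_right[OF c c] using lu by simp
      have e2: "(- U n \<omega> - - Z (k t) \<omega>)\<^sup>2 = (U n \<omega> - Z (k t) \<omega>)\<^sup>2" for n \<omega> by (simp add: power2_eq_square algebra_simps)
      show "integrable M (\<lambda>\<omega>. (- U n \<omega> - - Z (k t) \<omega>)\<^sup>2)" for n unfolding e2 by (rule iU)
      show "(\<lambda>n. \<integral>\<omega>. (- U n \<omega> - - Z (k t) \<omega>)\<^sup>2 \<partial>M) \<longlonglongrightarrow> 0" unfolding e2 by (rule lU)
    qed simp
    \<comment> \<open>Both \<open>\<xi> t\<close> and the chosen variable are paired with the same
      kernel function, so their difference is paired with zero.\<close>
    from cp_add[OF kH nH cpt this] have c0: "cp (\<lambda>s. 0) (\<lambda>\<omega>. \<xi> t \<omega> - Z (k t) \<omega>)" by simp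
    have "(\<integral>\<omega>. (\<xi> t \<omega> - Z (k t) \<omega>)\<^sup>2 \<partial>M) = 0" using cp_props(2)[OF zero_in c0] zero_in by simp
    then have "AE \<omega> in M. (\<xi> t \<omega> - Z (k t) \<omega>)\<^sup>2 = 0"
      using integral_nonneg_eq_0_iff_AE[OF cp_props(1)[OF zero_in c0]] by simp
    then show ?thesis by eventually_elim (simp add: k_def)
  qed
  ultimately show ?thesis by blast
qed

section \<open>Orthogonal projections\<close>

context function_hilbert begin

text \<open>Zero vectors are allowed, so that the Gram-Schmidt process needs no linear independence.\<close>

definition orthonormal_or_zero :: "'i set \<Rightarrow> ('i \<Rightarrow> 't \<Rightarrow> real) \<Rightarrow> bool" where
  "orthonormal_or_zero D e \<longleftrightarrow> finite D \<and> (\<forall>k\<in>D. e k \<in> H) \<and> (\<forall>j\<in>D. \<forall>k\<in>D. j \<noteq> k \<longrightarrow> ip (e j) (e k) = 0) \<and>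
     (\<forall>k\<in>D. ip (e k) (e k) = 0 \<or> ip (e k) (e k) = 1)"

definition proj :: "'i set \<Rightarrow> ('i \<Rightarrow> 't \<Rightarrow> real) \<Rightarrow> ('t \<Rightarrow> real) \<Rightarrow> 't \<Rightarrow> real" where
  "proj D e x = lin_comb D (\<lambda>k. ip x (e k)) e"

lemma orthonormal_or_zero_in: "orthonormal_or_zero D e \<Longrightarrow> k \<in> D \<Longrightarrow> e k \<in> H"
  by (simp add: orthonormal_or_zero_def)

lemma proj_in: "orthonormal_or_zero D e \<Longrightarrow> proj D e x \<in> H"
  unfolding proj_def by (intro lin_comb_in) (auto simp: orthonormal_or_zero_def)

text \<open>The substitute for unit length: if the vector is zero, then both sides vanish.\<close>

lemma orthonormal_or_zero_ip:
  assumes "orthonormal_or_zero D e" "k \<in> D" "x \<in> H"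
  shows "ip (e k) (e k) * ip x (e k) = ip x (e k)"
proof (cases "ip (e k) (e k) = 0")
  case True
  then have "e k = (\<lambda>s. 0)" using assms by (intro ip_eq_0) (auto simp: orthonormal_or_zero_def)
  then show ?thesis using assms by simp
next
  case False
  then show ?thesis using assms by (auto simp: orthonormal_or_zero_def)
qed

lemma ip_proj:
  assumes "orthonormal_or_zero D e" "x \<in> H" "y \<in> H"
  shows "ip (proj D e x) y = (\<Sum>k\<in>D. ip x (e k) * ip y (e k))"
  unfolding proj_def using assms by (subst ip_lin_comb_left) (auto simp: orthonormal_or_zero_def ip_sym[of y])

lemma ip_proj_basis:
  assumes "orthonormal_or_zero D e" "x \<in> H" "j \<in> D"
  shows "ip (proj D e x) (e j) = ip x (e j)"
proof -
  have "ip (proj D e x) (e j) = (\<Sum>k\<in>D. ip x (e k) * ip (e j) (e k))" using assms by (intro ip_proj) (auto simp: orthonormal_or_zero_def)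
  also have "\<dots> = (\<Sum>k\<in>D. if k = j then ip x (e j) else 0)"
  proof (rule sum.cong)
    fix k assume k: "k \<in> D"
    show "ip x (e k) * ip (e j) (e k) = (if k = j then ip x (e j) else 0)"
      using assms k orthonormal_or_zero_ip[OF assms(1,3,2)] by (auto simp: orthonormal_or_zero_def mult.commute)
  qed simp
  also have "\<dots> = ip x (e j)" using assms by (simp add: orthonormal_or_zero_def)
  finally show ?thesis .
qed

lemma ip_proj_proj:
  assumes "orthonormal_or_zero D e" "x \<in> H" "y \<in> H"
  shows "ip (proj D e x) (proj D e y) = ip (proj D e x) y"
proof -
  have "ip (proj D e x) (proj D e y) = (\<Sum>k\<in>D. ip (proj D e x) (e k) * ip y (e k))"
    using assms by (subst ip_sym) (auto simp: proj_in ip_proj mult.commute)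
  also have "\<dots> = ip (proj D e x) y" using assms by (simp add: ip_proj_basis ip_proj)
  finally show ?thesis .
qed

text \<open>Expanding leaves \<open>ip x y\<close> plus terms that cancel, because a projection is
  self-adjoint and idempotent.\<close>

lemma ip_reflect:
  assumes D: "orthonormal_or_zero D e" and x: "x \<in> H" and y: "y \<in> H"
  shows "ip (\<lambda>s. 2 * proj D e x s - x s) (\<lambda>s. 2 * proj D e y s - y s) = ip x y"
proof -
  note p = proj_in[OF D]
  have "ip (proj D e x) y = ip x (proj D e y)"
    using D x y p by (simp add: ip_sym[of x "proj D e y"] ip_proj mult.commute)
  then show ?thesis
    using x y p by (simp add: ip_diff_left ip_diff_right scale_in diff_in ip_scale_left ip_scale_right ip_proj_proj[OF D x y])
qed

lemma ip_residual_proj: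
  assumes D: "orthonormal_or_zero D e" and x: "x \<in> H" and y: "y \<in> H"
  shows "ip x (\<lambda>s. y s - proj D e y s) = ip x y - (\<Sum>k\<in>D. ip x (e k) * ip y (e k))"
  using assms proj_in[OF D] by (simp add: ip_diff_right ip_sym[of x "proj D e y"] ip_proj mult.commute)

end

text \<open>With this congruence the recursive calls under the sum are known to have
  \<open>j < n\<close>, on which termination of the next function rests.\<close>

declare sum.cong [fundef_cong]

text \<open>If \<open>w = 0\<close>, then \<open>1 / sqrt 0 = 0\<close> and the vector is zero.\<close>

fun gram_schmidt :: "(('t \<Rightarrow> real) \<Rightarrow> ('t \<Rightarrow> real) \<Rightarrow> real) \<Rightarrow> (nat \<Rightarrow> 't \<Rightarrow> real) \<Rightarrow> nat \<Rightarrow> 't \<Rightarrow> real" where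
  "gram_schmidt ip v n = (let w = (\<lambda>s. v n s - (\<Sum>j<n. ip (v n) (gram_schmidt ip v j) * gram_schmidt ip v j s)) in (\<lambda>s. (1 / sqrt (ip w w)) * w s))"

declare gram_schmidt.simps [simp del]

context function_hilbert begin

text \<open>Both claims are proved in one induction. The residual \<open>w\<close> is orthogonal to
  the earlier vectors by the induction hypothesis, and \<open>v n\<close> is its projection plus
  \<open>w\<close>, where \<open>w\<close> is a multiple of the new vector.\<close>

lemma gram_schmidt_orthonormal_or_zero_step:
  assumes v: "\<And>n. v n \<in> H"
  shows "orthonormal_or_zero {..<n} (gram_schmidt ip v) \<and> (\<forall>j<n. v j = proj {..j} (gram_schmidt ip v) (v j))"
proof (induction n)
  case 0 then show ?case by (simp add: orthonormal_or_zero_def)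
next
  case (Suc n)
  let ?e = "gram_schmidt ip v"
  have D: "orthonormal_or_zero {..<n} ?e" using Suc by simp
  define w where "w = (\<lambda>s. v n s - proj {..<n} ?e (v n) s)"
  have w: "w \<in> H" unfolding w_def by (intro diff_in v proj_in D)
  have en: "?e n = (\<lambda>s. (1 / sqrt (ip w w)) * w s)"
    by (subst gram_schmidt.simps) (simp add: w_def proj_def lin_comb_def Let_def)
  have eH: "?e n \<in> H" unfolding en by (rule scale_in[OF w])
  have worth: "ip w (?e j) = 0" if "j < n" for j
    using that D v unfolding w_def by (subst ip_diff_left) (auto simp: proj_in ip_proj_basis orthonormal_or_zero_in)
  have eorth: "ip (?e n) (?e j) = 0" "ip (?e j) (?e n) = 0" if "j < n" for j
  proof -
    have jH: "?e j \<in> H" using D that by (auto simp: orthonormal_or_zero_def)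
    show "ip (?e n) (?e j) = 0" unfolding en using worth[OF that] by (simp only: ip_scale_left[OF w jH])
    then show "ip (?e j) (?e n) = 0" using ip_sym[OF eH jH] by simp
  qed
  have en1: "ip (?e n) (?e n) = (1 / sqrt (ip w w)) * ((1 / sqrt (ip w w)) * ip w w)"
    unfolding en by (simp only: ip_scale_left[OF w scale_in[OF w]] ip_scale_right[OF w w])
  have w0: "ip w w \<ge> 0" by (rule ip_nonneg[OF w])
  have enorm: "ip (?e n) (?e n) = 0 \<or> ip (?e n) (?e n) = 1"
    unfolding en1 using w0 by (cases "ip w w = 0") (auto simp: field_simps)
  have D': "orthonormal_or_zero {..<Suc n} ?e"
    using D eH eorth enorm unfolding orthonormal_or_zero_def by (auto simp: less_Suc_eq)
  have "ip (v n) (?e n) = ip w (?e n)"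
  proof -
    have "ip (proj {..<n} ?e (v n)) (?e n) = 0"
      using ip_proj[OF D v eH] eorth by simp
    then show ?thesis unfolding w_def using v D eH by (simp add: ip_diff_left proj_in)
  qed
  also have "\<dots> = (1 / sqrt (ip w w)) * ip w w" unfolding en by (rule ip_scale_right[OF w w])
  finally have c: "ip (v n) (?e n) = (1 / sqrt (ip w w)) * ip w w" .
  \<comment> \<open>This remains true if \<open>w = 0\<close>, which is how linearly dependent
    vectors are covered.\<close>
  have "ip (v n) (?e n) * ?e n s = w s" for s
  proof (cases "ip w w = 0")
    case True
    then have "w = (\<lambda>s. 0)" by (rule ip_eq_0[OF w])
    then show ?thesis by (simp add: en)
  next
    case False
    then show ?thesis unfolding c fun_cong[OF en, of s] using w0 by (simp add: field_simps)
  qed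
  then have "v n = proj {..n} ?e (v n)"
    by (auto simp: proj_def lin_comb_def lessThan_Suc_atMost[symmetric] w_def fun_eq_iff)
  then show ?case using D' Suc by (auto simp: less_Suc_eq)
qed

lemma gram_schmidt_orthonormal_or_zero: "(\<And>n. v n \<in> H) \<Longrightarrow> finite D \<Longrightarrow> orthonormal_or_zero D (gram_schmidt ip v)"
proof -
  assume v: "\<And>n. v n \<in> H" and "finite D"
  then obtain m where "D \<subseteq> {..<m}" using finite_nat_iff_bounded by auto
  then have m: "\<And>k. k \<in> D \<Longrightarrow> k \<in> {..<m}" by auto
  have "orthonormal_or_zero {..<m} (gram_schmidt ip v)" by (rule conjunct1[OF gram_schmidt_orthonormal_or_zero_step[OF v]])
  then show ?thesis using \<open>finite D\<close> m unfolding orthonormal_or_zero_def by meson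
qed

text \<open>By the expansion up to index \<open>n\<close>, \<open>v n\<close> is a combination of
  the first \<open>n + 1\<close> vectors; the later ones are orthogonal to these and add
  nothing.\<close>

lemma gram_schmidt_expand:
  assumes v: "\<And>n. v n \<in> H" and "n < m"
  shows "v n = proj {..<m} (gram_schmidt ip v) (v n)"
proof -
  have D: "orthonormal_or_zero {..<m} (gram_schmidt ip v)" by (intro gram_schmidt_orthonormal_or_zero v) simp
  have "\<forall>j<Suc n. v j = proj {..j} (gram_schmidt ip v) (v j)" by (rule conjunct2[OF gram_schmidt_orthonormal_or_zero_step[OF v]])
  from this[rule_format, OF lessI] have e: "v n = proj {..n} (gram_schmidt ip v) (v n)" .
  have D': "orthonormal_or_zero {..n} (gram_schmidt ip v)" by (intro gram_schmidt_orthonormal_or_zero v) simp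
  have "ip (v n) (gram_schmidt ip v k) = 0" if "k \<in> {..<m} - {..n}" for k
  proof -
    have "ip (v n) (gram_schmidt ip v k) = ip (proj {..n} (gram_schmidt ip v) (v n)) (gram_schmidt ip v k)" using arg_cong[OF e, of "\<lambda>x. ip x (gram_schmidt ip v k)"] .
    also have "\<dots> = (\<Sum>j\<in>{..n}. ip (v n) (gram_schmidt ip v j) * ip (gram_schmidt ip v k) (gram_schmidt ip v j))"
      using that by (intro ip_proj D' v orthonormal_or_zero_in[OF D]) auto
    also have "\<dots> = 0"
    proof (rule sum.neutral, rule ballI)
      fix j assume j: "j \<in> {..n}"
      have "k \<in> {..<m}" "j \<in> {..<m}" "k \<noteq> j" using j that \<open>n < m\<close> by auto
      then have "ip (gram_schmidt ip v k) (gram_schmidt ip v j) = 0" using D unfolding orthonormal_or_zero_def by meson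
      then show "ip (v n) (gram_schmidt ip v j) * ip (gram_schmidt ip v k) (gram_schmidt ip v j) = 0" by simp
    qed
    finally show ?thesis .
  qed
  then have "proj {..<m} (gram_schmidt ip v) (v n) = proj {..n} (gram_schmidt ip v) (v n)"
    unfolding proj_def lin_comb_def using \<open>n < m\<close> by (intro ext sum.mono_neutral_right) auto
  then show ?thesis using e by metis
qed

end

section \<open>Projections and reflections of a Gaussian element\<close>

locale isonormal_banach = isonormal H ip M Z
  for H :: "('t \<Rightarrow> real) set" and ip and M :: "'w measure" and Z +
  fixes \<phi> :: "'x::{banach,second_countable_topology} \<Rightarrow> nat \<Rightarrow> real"
  assumes \<phi>_cont: "continuous_on UNIV \<phi>" and \<phi>_inj: "inj \<phi>"
    and \<phi>_lin: "\<And>a b x y n. \<phi> (a *\<^sub>R x + b *\<^sub>R y) n = a * \<phi> x n + b * \<phi> y n"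
begin

lemma \<phi>_measurable [measurable]: "(\<lambda>x. \<phi> x n) \<in> borel_measurable borel"
  using borel_measurable_continuous_onI[OF \<phi>_cont] by (simp add: measurable_into_borel_coordinate)

lemma \<phi>_zero: "\<phi> 0 n = 0" using \<phi>_lin[of 0 0 0 0 n] by simp

lemma \<phi>_sum: "\<phi> (\<Sum>k\<in>D. a k *\<^sub>R x k) n = (\<Sum>k\<in>D. a k * \<phi> (x k) n)"
proof (induction D rule: infinite_finite_induct)
  case (insert k D)
  then show ?case using \<phi>_lin[of "a k" "x k" 1 "\<Sum>k\<in>D. a k *\<^sub>R x k" n] by simp
qed (simp_all add: \<phi>_zero)

lemma gauss_family_\<phi>:
  assumes \<zeta>[measurable]: "\<zeta> \<in> borel_measurable M" and v: "\<And>n. v n \<in> H"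
    and e: "\<And>n. AE \<omega> in M. \<phi> (\<zeta> \<omega>) n = Z (v n) \<omega>"
  shows "gauss_family M (\<lambda>n \<omega>. \<phi> (\<zeta> \<omega>) n) (\<lambda>i j. ip (v i) (v j))"
  by (rule gauss_family_Z[OF v _ e]) measurable

lemma square_integrable_of_Z:
  assumes \<zeta>[measurable]: "\<zeta> \<in> borel_measurable M" and v: "\<And>n. v n \<in> H"
    and e: "\<And>n. AE \<omega> in M. \<phi> (\<zeta> \<omega>) n = Z (v n) \<omega>"
  shows "integrable M (\<lambda>\<omega>. (norm (\<zeta> \<omega>))\<^sup>2)"
  by (rule gauss_square_integrable[OF prob_space_axioms \<phi>_cont \<phi>_inj \<phi>_lin \<zeta> gauss_family_\<phi>[OF assms]])

text \<open>The reflection \<open>2 P - 1\<close> is an isometry, so it leaves the distribution invariant.\<close>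

lemma reflection_law:
  assumes D: "orthonormal_or_zero D e" and \<zeta>[measurable]: "\<zeta> \<in> borel_measurable M" and v: "\<And>n. v n \<in> H"
    and \<zeta>v: "\<And>n. AE \<omega> in M. \<phi> (\<zeta> \<omega>) n = Z (v n) \<omega>"
    and x: "\<And>k n. k \<in> D \<Longrightarrow> \<phi> (x k) n = ip (e k) (v n)"
  defines "S \<equiv> (\<lambda>\<omega>. \<Sum>k\<in>D. Z (e k) \<omega> *\<^sub>R x k)"
  shows "AE \<omega> in M. \<phi> (S \<omega>) n = Z (proj D e (v n)) \<omega>"
    and "distr M borel (\<lambda>\<omega>. 2 *\<^sub>R S \<omega> - \<zeta> \<omega>) = distr M borel \<zeta>"
proof -
  have [measurable]: "S \<in> borel_measurable M" unfolding S_def by measurable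
  have fD: "finite D" and eH: "\<And>k. k \<in> D \<Longrightarrow> e k \<in> H" using D by (auto simp: orthonormal_or_zero_def)
  show S: "AE \<omega> in M. \<phi> (S \<omega>) n = Z (proj D e (v n)) \<omega>" for n
  proof -
    have "AE \<omega> in M. Z (proj D e (v n)) \<omega> = (\<Sum>k\<in>D. ip (v n) (e k) * Z (e k) \<omega>)"
      unfolding proj_def by (rule Z_lin_comb[OF fD eH])
    then show ?thesis
    proof eventually_elim
      case (elim \<omega>)
      then show ?case unfolding S_def \<phi>_sum
        by simp (intro sum.cong refl, simp add: x ip_sym[OF v eH])
    qed
  qed
  \<comment> \<open>The reflected vectors. The coordinates of
    \<open>2 *\<^sub>R S \<omega> - \<zeta> \<omega>\<close> are their images under
    \<open>Z\<close>, and \<open>ip_reflect\<close> says that their covariances are those of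
    \<open>v\<close>.\<close>
  define v' where "v' n = (\<lambda>s. 2 * proj D e (v n) s - v n s)" for n
  have v': "v' n \<in> H" for n unfolding v'_def by (intro diff_in scale_in proj_in D v)
  have S': "AE \<omega> in M. \<phi> (2 *\<^sub>R S \<omega> - \<zeta> \<omega>) n = Z (v' n) \<omega>" for n
  proof -
    have "lin_comb {True, False} (\<lambda>b. if b then 2 else -1) (\<lambda>b. if b then proj D e (v n) else v n) = v' n"
      by (auto simp: lin_comb_def v'_def)
    moreover have "AE \<omega> in M. Z (lin_comb {True, False} (\<lambda>b. if b then 2 else -1) (\<lambda>b. if b then proj D e (v n) else v n)) \<omega>
       = (\<Sum>b\<in>{True, False}. (if b then 2 else -1) * Z (if b then proj D e (v n) else v n) \<omega>)"
      using v proj_in[OF D] by (intro Z_lin_comb) auto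
    ultimately have "AE \<omega> in M. Z (v' n) \<omega> = 2 * Z (proj D e (v n)) \<omega> - Z (v n) \<omega>" by simp
    then show ?thesis using S[of n] \<zeta>v[of n]
    proof eventually_elim
      case (elim \<omega>)
      then show ?case using \<phi>_lin[of 2 "S \<omega>" "-1" "\<zeta> \<omega>" n] by simp
    qed
  qed
  show "distr M borel (\<lambda>\<omega>. 2 *\<^sub>R S \<omega> - \<zeta> \<omega>) = distr M borel \<zeta>"
  proof (rule distr_borel_eqI_gauss_family[OF prob_space_axioms prob_space_axioms \<phi>_cont \<phi>_inj])
    show "gauss_family M (\<lambda>i \<omega>. \<phi> (\<zeta> \<omega>) i) (\<lambda>i j. ip (v i) (v j))" by (rule gauss_family_\<phi>[OF \<zeta> v \<zeta>v])
    have "gauss_family M (\<lambda>i \<omega>. \<phi> (2 *\<^sub>R S \<omega> - \<zeta> \<omega>) i) (\<lambda>i j. ip (v' i) (v' j))"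
      by (rule gauss_family_\<phi>[OF _ v' S']) measurable
    then show "gauss_family M (\<lambda>i \<omega>. \<phi> (2 *\<^sub>R S \<omega> - \<zeta> \<omega>) i) (\<lambda>i j. ip (v i) (v j))"
      unfolding v'_def ip_reflect[OF D v v] .
  qed measurable
qed

lemma integrable_sum_Z:
  fixes x :: "'i \<Rightarrow> 'x"
  assumes "finite D" "\<And>k. k \<in> D \<Longrightarrow> e k \<in> H"
  shows "integrable M (\<lambda>\<omega>. (norm (\<Sum>k\<in>D. Z (e k) \<omega> *\<^sub>R x k))\<^sup>2)"
  using assms
proof (induction D rule: finite_induct)
  case (insert k D)
  have i: "integrable M (\<lambda>\<omega>. (norm (Z (e k) \<omega> *\<^sub>R x k))\<^sup>2)"
    using Z_sq[of "e k"] insert.prems by (simp add: power_mult_distrib)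
  have j: "integrable M (\<lambda>\<omega>. (norm (\<Sum>k\<in>D. Z (e k) \<omega> *\<^sub>R x k))\<^sup>2)" using insert by simp
  have "integrable M (\<lambda>\<omega>. (norm (Z (e k) \<omega> *\<^sub>R x k + (\<Sum>k\<in>D. Z (e k) \<omega> *\<^sub>R x k)))\<^sup>2)"
    by (rule integrable_norm_sq_add(1)[of "\<lambda>\<omega>. Z (e k) \<omega> *\<^sub>R x k" M "\<lambda>\<omega>. \<Sum>k\<in>D. Z (e k) \<omega> *\<^sub>R x k", OF _ _ i j]) measurable
  then show ?case using insert.hyps by simp
qed simp

text \<open>\<open>2 S = (2 S - \<zeta>) + \<zeta>\<close>, and both summands have the law of
  \<open>\<zeta>\<close>. The elementary bound for the square of a sum gives at most four times the
  second moment of \<open>\<zeta>\<close>, and the factor 4 cancels.\<close>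

lemma projection_contracts:
  assumes D: "orthonormal_or_zero D e" and \<zeta>[measurable]: "\<zeta> \<in> borel_measurable M" and v: "\<And>n. v n \<in> H"
    and \<zeta>v: "\<And>n. AE \<omega> in M. \<phi> (\<zeta> \<omega>) n = Z (v n) \<omega>"
    and x: "\<And>k n. k \<in> D \<Longrightarrow> \<phi> (x k) n = ip (e k) (v n)"
    and int: "integrable M (\<lambda>\<omega>. (norm (\<zeta> \<omega>))\<^sup>2)"
  shows "(\<integral>\<omega>. (norm (\<Sum>k\<in>D. Z (e k) \<omega> *\<^sub>R x k))\<^sup>2 \<partial>M) \<le> (\<integral>\<omega>. (norm (\<zeta> \<omega>))\<^sup>2 \<partial>M)"
proof -
  define S where "S = (\<lambda>\<omega>. \<Sum>k\<in>D. Z (e k) \<omega> *\<^sub>R x k)"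
  have [measurable]: "S \<in> borel_measurable M" unfolding S_def by measurable
  have d: "distr M borel (\<lambda>\<omega>. 2 *\<^sub>R S \<omega> - \<zeta> \<omega>) = distr M borel \<zeta>"
    unfolding S_def by (rule reflection_law(2)[OF assms(1-5)])
  have i1: "integrable M (\<lambda>\<omega>. (norm (2 *\<^sub>R S \<omega> - \<zeta> \<omega>))\<^sup>2)"
  proof -
    have "integrable (distr M borel \<zeta>) (\<lambda>x. (norm x)\<^sup>2)" using int by (subst integrable_distr_eq) auto
    then show ?thesis unfolding d[symmetric] by (subst (asm) integrable_distr_eq) auto
  qed
  have e1: "(\<integral>\<omega>. (norm (2 *\<^sub>R S \<omega> - \<zeta> \<omega>))\<^sup>2 \<partial>M) = (\<integral>\<omega>. (norm (\<zeta> \<omega>))\<^sup>2 \<partial>M)"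
  proof -
    have "(\<integral>\<omega>. (norm (2 *\<^sub>R S \<omega> - \<zeta> \<omega>))\<^sup>2 \<partial>M) = (\<integral>x. (norm x)\<^sup>2 \<partial>distr M borel (\<lambda>\<omega>. 2 *\<^sub>R S \<omega> - \<zeta> \<omega>))"
      by (subst integral_distr) auto
    also have "\<dots> = (\<integral>\<omega>. (norm (\<zeta> \<omega>))\<^sup>2 \<partial>M)" unfolding d by (subst integral_distr) auto
    finally show ?thesis .
  qed
  have "4 * (\<integral>\<omega>. (norm (S \<omega>))\<^sup>2 \<partial>M) = (\<integral>\<omega>. (norm ((2 *\<^sub>R S \<omega> - \<zeta> \<omega>) + \<zeta> \<omega>))\<^sup>2 \<partial>M)"
    by (simp add: power_mult_distrib)
  also have "\<dots> \<le> 2 * (\<integral>\<omega>. (norm (2 *\<^sub>R S \<omega> - \<zeta> \<omega>))\<^sup>2 \<partial>M) + 2 * (\<integral>\<omega>. (norm (\<zeta> \<omega>))\<^sup>2 \<partial>M)"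
    by (rule integrable_norm_sq_add(2)[OF _ _ i1 int]) measurable
  finally show ?thesis using e1 unfolding S_def by linarith
qed

end

section \<open>Radonifying norms\<close>

lemma prob_space_std_gaussian_sequence: "prob_space std_gaussian_sequence"
  unfolding std_gaussian_sequence_def by (intro prob_space_PiM prob_space_normal_density) simp

lemma measurable_std_gaussian_sequence [measurable]: "(\<lambda>g. g k) \<in> borel_measurable std_gaussian_sequence"
proof -
  have "(\<lambda>g. g k) \<in> measurable std_gaussian_sequence (density lborel (\<lambda>x. ennreal (std_normal_density x)))"
    unfolding std_gaussian_sequence_def by (rule measurable_component_singleton) simp
  then show ?thesis by (simp cong: measurable_cong_sets)
qed

text \<open>Under the product measure the coordinates are independent with standard normal laws, so
  the characteristic function of the sum is a product.\<close>

lemma char_std_gaussian_sequence: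
  "(CLINT g|std_gaussian_sequence. iexp (\<Sum>k<n. a k * g k)) = of_real (exp (- (\<Sum>k<n. (a k)\<^sup>2) / 2))"
proof -
  let ?N = "density lborel (\<lambda>x. ennreal (std_normal_density x))"
  interpret prob_space std_gaussian_sequence by (rule prob_space_std_gaussian_sequence)
  have pN: "prob_space ?N" by (rule prob_space_normal_density) simp
  have comp: "distr std_gaussian_sequence ?N (\<lambda>g. g k) = ?N" for k
    unfolding std_gaussian_sequence_def by (rule distr_PiM_component) (auto intro: pN)
  have m: "(\<lambda>g. g k) \<in> measurable std_gaussian_sequence ?N" for k
    unfolding std_gaussian_sequence_def by (rule measurable_component_singleton) simp
  have "indep_vars (\<lambda>_. ?N) (\<lambda>k g. g k) UNIV"
  proof (subst indep_vars_iff_distr_eq_PiM)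
    show "(\<lambda>g. g k) \<in> measurable std_gaussian_sequence ?N" for k :: nat by (rule m)
    have "distr std_gaussian_sequence (PiM UNIV (\<lambda>_. ?N)) (\<lambda>g. \<lambda>i\<in>UNIV. g i) = std_gaussian_sequence"
      by (simp add: std_gaussian_sequence_def restrict_def distr_id)
    then show "distr std_gaussian_sequence (PiM UNIV (\<lambda>_. ?N)) (\<lambda>g. \<lambda>i\<in>UNIV. g i) = PiM UNIV (\<lambda>i. distr std_gaussian_sequence ?N (\<lambda>g. g i))"
      by (simp add: comp) (simp add: std_gaussian_sequence_def)
  qed simp
  then have "indep_vars (\<lambda>_. borel) (\<lambda>k g. a k * g k) UNIV"
    by (rule indep_vars_compose2) (auto cong: measurable_cong_sets)
  then have ind: "indep_vars (\<lambda>_. borel) (\<lambda>k g. a k * g k) {..<n}" by (rule indep_vars_subset) simp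
  have c1: "char (distr std_gaussian_sequence borel (\<lambda>g. a k * g k)) 1 = of_real (exp (- (a k)\<^sup>2 / 2))" for k
  proof -
    have "char (distr std_gaussian_sequence borel (\<lambda>g. a k * g k)) 1 = (CLINT g|std_gaussian_sequence. iexp (a k * g k))"
      unfolding char_def by (subst integral_distr) auto
    also have "\<dots> = (CLINT x|distr std_gaussian_sequence ?N (\<lambda>g. g k). iexp (a k * x))"
      by (subst integral_distr) (auto simp: m)
    also have "\<dots> = char std_normal_distribution (a k)" unfolding comp char_def ..
    finally show ?thesis by (simp add: char_std_normal_distribution)
  qed
  have "(CLINT g|std_gaussian_sequence. iexp (\<Sum>k<n. a k * g k)) = char (distr std_gaussian_sequence borel (\<lambda>g. \<Sum>k<n. a k * g k)) 1"
    unfolding char_def by (subst integral_distr) auto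
  also have "\<dots> = (\<Prod>k<n. char (distr std_gaussian_sequence borel (\<lambda>g. a k * g k)) 1)" by (rule char_distr_sum[OF ind])
  also have "\<dots> = of_real (exp (- (\<Sum>k<n. (a k)\<^sup>2) / 2))"
    by (simp only: c1 of_real_prod[symmetric] exp_sum[OF finite_lessThan, symmetric]) (simp add: sum_negf sum_divide_distrib)
  finally show ?thesis .
qed

context isonormal_banach begin

lemma orthonormal_system_or_zero: "orthonormal_system H ip n h \<Longrightarrow> orthonormal_or_zero {..<n} h"
  by (auto simp: orthonormal_system_def orthonormal_or_zero_def)

text \<open>Along an orthonormal system the variables \<open>Z (h k)\<close> are independent
  standard Gaussian. The expectations in the \<gamma>-norm can thus be computed on \<open>M\<close>,
  where they can be compared with the random element.\<close>

lemma std_gaussian_norm: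
  fixes x :: "nat \<Rightarrow> 'x"
  assumes h: "orthonormal_system H ip n h"
  shows "(\<integral>g. (norm (\<Sum>k<n. g k *\<^sub>R x k))\<^sup>2 \<partial>std_gaussian_sequence) = (\<integral>\<omega>. (norm (\<Sum>k<n. Z (h k) \<omega> *\<^sub>R x k))\<^sup>2 \<partial>M)"
proof -
  have hH: "h k \<in> H" if "k < n" for k using h that by (simp add: orthonormal_system_def)
  have "distr std_gaussian_sequence borel (\<lambda>g. \<Sum>k<n. g k *\<^sub>R x k) = distr M borel (\<lambda>\<omega>. \<Sum>k<n. Z (h k) \<omega> *\<^sub>R x k)"
  proof (rule distr_borel_eqI_char[OF prob_space_std_gaussian_sequence prob_space_axioms \<phi>_cont \<phi>_inj])
    fix F :: "nat set" and c :: "nat \<Rightarrow> real" assume F: "finite F"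
    define a where "a k = (\<Sum>i\<in>F. c i * \<phi> (x k) i)" for k
    have e: "(\<Sum>i\<in>F. c i * \<phi> (\<Sum>k<n. g k *\<^sub>R x k) i) = (\<Sum>k<n. a k * g k)" for g :: "nat \<Rightarrow> real"
    proof -
      have "(\<Sum>i\<in>F. c i * \<phi> (\<Sum>k<n. g k *\<^sub>R x k) i) = (\<Sum>i\<in>F. \<Sum>k<n. c i * (g k * \<phi> (x k) i))"
        unfolding \<phi>_sum by (simp add: sum_distrib_left)
      also have "\<dots> = (\<Sum>k<n. \<Sum>i\<in>F. c i * (g k * \<phi> (x k) i))" by (rule sum.swap)
      also have "\<dots> = (\<Sum>k<n. a k * g k)" unfolding a_def sum_distrib_right by (intro sum.cong) (auto simp: mult_ac)
      finally show ?thesis .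
    qed
    \<comment> \<open>\<open>h\<close> is constrained below \<open>n\<close> only; padding by zero
      gives a family of vectors of \<open>H\<close> for all indices.\<close>
    define v where "v k = (if k < n then h k else (\<lambda>s. 0))" for k
    have g: "gauss_family M (\<lambda>k. Z (v k)) (\<lambda>i j. ip (v i) (v j))"
      by (rule gauss_family_Z) (auto simp: v_def hH zero_in)
    have "(CLINT \<omega>|M. iexp (\<Sum>k<n. a k * Z (h k) \<omega>)) = (CLINT \<omega>|M. iexp (\<Sum>k<n. a k * Z (v k) \<omega>))"
      by (simp add: v_def)
    also have "\<dots> = of_real (exp (- (\<Sum>i<n. \<Sum>j<n. a i * a j * ip (v i) (v j)) / 2))"
      using g unfolding gauss_family_def by blast
    also have "(\<Sum>i<n. \<Sum>j<n. a i * a j * ip (v i) (v j)) = (\<Sum>i<n. \<Sum>j<n. if j = i then (a i)\<^sup>2 else 0)"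
      using h by (intro sum.cong refl) (auto simp: v_def orthonormal_system_def power2_eq_square)
    also have "\<dots> = (\<Sum>k<n. (a k)\<^sup>2)" by simp
    finally show "(CLINT g|std_gaussian_sequence. iexp (\<Sum>i\<in>F. c i * \<phi> (\<Sum>k<n. g k *\<^sub>R x k) i)) = (CLINT \<omega>|M. iexp (\<Sum>i\<in>F. c i * \<phi> (\<Sum>k<n. Z (h k) \<omega> *\<^sub>R x k) i))"
      unfolding e char_std_gaussian_sequence by simp
  qed measurable
  then have d: "(\<integral>z. (norm z)\<^sup>2 \<partial>distr std_gaussian_sequence borel (\<lambda>g. \<Sum>k<n. g k *\<^sub>R x k)) = (\<integral>z. (norm z)\<^sup>2 \<partial>distr M borel (\<lambda>\<omega>. \<Sum>k<n. Z (h k) \<omega> *\<^sub>R x k))" by simp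
  show ?thesis using d by (simp add: integral_distr)
qed

lemma gamma_values_eq:
  fixes A :: "('t \<Rightarrow> real) \<Rightarrow> 'x"
  shows "gamma_values H ip A = {sqrt (\<integral>\<omega>. (norm (\<Sum>k<n. Z (h k) \<omega> *\<^sub>R A (h k)))\<^sup>2 \<partial>M) | n h. orthonormal_system H ip n h}"
  unfolding gamma_values_def by (intro Collect_cong ex_cong1 iffI; elim conjE; simp add: std_gaussian_norm)

lemma gamma_valuesI:
  fixes A :: "('t \<Rightarrow> real) \<Rightarrow> 'x"
  assumes le: "\<And>n h. orthonormal_system H ip n h \<Longrightarrow> (\<integral>\<omega>. (norm (\<Sum>k<n. Z (h k) \<omega> *\<^sub>R A (h k)))\<^sup>2 \<partial>M) \<le> C"
  shows "bdd_above (gamma_values H ip A)" and "gamma_norm H ip A \<le> sqrt C"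
proof -
  have 1: "y \<le> sqrt C" if "y \<in> gamma_values H ip A" for y
    using that le unfolding gamma_values_eq by auto
  then show "bdd_above (gamma_values H ip A)" by (rule bdd_aboveI)
  \<comment> \<open>The empty system keeps the set of values nonempty, even if \<open>H\<close> is
    trivial.\<close>
  have "orthonormal_system H ip 0 (\<lambda>_ _. 0)" by (simp add: orthonormal_system_def)
  then have "gamma_values H ip A \<noteq> {}" unfolding gamma_values_def by blast
  then show "gamma_norm H ip A \<le> sqrt C" unfolding gamma_norm_def using 1 by (rule cSup_least)
qed

lemma gamma_values_bound:
  fixes A :: "('t \<Rightarrow> real) \<Rightarrow> 'x"
  assumes "bdd_above (gamma_values H ip A)" "orthonormal_system H ip n h"
  shows "(\<integral>\<omega>. (norm (\<Sum>k<n. Z (h k) \<omega> *\<^sub>R A (h k)))\<^sup>2 \<partial>M) \<le> (gamma_norm H ip A)\<^sup>2"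
proof -
  have "sqrt (\<integral>\<omega>. (norm (\<Sum>k<n. Z (h k) \<omega> *\<^sub>R A (h k)))\<^sup>2 \<partial>M) \<le> gamma_norm H ip A"
    unfolding gamma_norm_def by (rule cSup_upper[OF _ assms(1)]) (use assms(2) in \<open>auto simp: gamma_values_eq\<close>)
  then show ?thesis by (rule sqrt_le_D)
qed

end

section \<open>Approximation by functions of finitely many coordinates\<close>

definition cylinder :: "('x \<Rightarrow> nat \<Rightarrow> real) \<Rightarrow> nat \<Rightarrow> ('x \<Rightarrow> 'y) \<Rightarrow> bool" where
  "cylinder \<phi> m f \<longleftrightarrow> (\<forall>x y. (\<forall>j<m. \<phi> x j = \<phi> y j) \<longrightarrow> f x = f y)"

lemma cylinder_mono: "cylinder \<phi> m f \<Longrightarrow> m \<le> n \<Longrightarrow> cylinder \<phi> n f"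
  unfolding cylinder_def by (meson order_less_le_trans)

text \<open>A Dynkin class argument. Sets depending on finitely many coordinates form an
  intersection-stable generator, and the property of being approximable in mean square passes to
  complements and to countable disjoint unions.\<close>

lemma indicator_cylinder_approx:
  fixes \<phi> :: "'x::{complete_space,second_countable_topology} \<Rightarrow> nat \<Rightarrow> real"
  assumes N: "prob_space N" and sN: "sets N = sets borel"
    and cont: "continuous_on UNIV \<phi>" and inj: "inj \<phi>" and A: "A \<in> sets borel"
  shows "\<forall>e>0. \<exists>m g. g \<in> borel_measurable borel \<and> cylinder \<phi> m g \<and> integrable N (\<lambda>x. (indicator A x - g x)\<^sup>2) \<and>
      (\<integral>x. (indicator A x - g x)\<^sup>2 \<partial>N) < (e :: real)"
proof -
  interpret N: prob_space N by fact
  have mN: "f \<in> borel_measurable N \<longleftrightarrow> f \<in> borel_measurable borel" for f :: "'x \<Rightarrow> real"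
    by (intro arg_cong2[where f="(\<in>)"] refl measurable_cong_sets sN)
  define P where "P A \<longleftrightarrow> (\<forall>e>0. \<exists>m g. g \<in> borel_measurable borel \<and> cylinder \<phi> m g \<and> integrable N (\<lambda>x. (indicator A x - g x)\<^sup>2) \<and>
      (\<integral>x. (indicator A x - g x)\<^sup>2 \<partial>N) < (e :: real))" for A
  define G where "G = {A :: 'x set. A \<in> sets borel \<and> (\<exists>m. cylinder \<phi> m (\<lambda>x. x \<in> A))}"
  have \<phi>m: "(\<lambda>x. \<phi> x i) \<in> borel_measurable borel" for i
    using borel_measurable_continuous_onI[OF cont] by (simp add: measurable_into_borel_coordinate)
  \<comment> \<open>The coordinates are measurable for the \<sigma>-algebra generated by
    \<open>G\<close>, and every Borel set is a preimage under the coordinate map.\<close>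
  have gen: "A \<in> sigma_sets UNIV G"
  proof -
    obtain D where D: "D \<in> sets borel" "A = \<phi> -` D" using borel_eq_vimage_continuous_inj[OF cont inj A] by blast
    have "(\<lambda>x. \<phi> x) \<in> borel_measurable (sigma UNIV G)"
      unfolding measurable_into_borel_coordinate
    proof
      fix i
      have "cylinder \<phi> (Suc i) (\<lambda>x. x \<in> (\<lambda>x. \<phi> x i) -` B)" for B by (auto simp: cylinder_def)
      then have "(\<lambda>x. \<phi> x i) -` B \<in> G" if "B \<in> sets borel" for B
        using measurable_sets[OF \<phi>m that] unfolding G_def by auto
      then show "(\<lambda>x. \<phi> x i) \<in> borel_measurable (sigma UNIV G)"
        by (intro measurableI) (auto simp: G_def)
    qed
    from measurable_sets[OF this D(1)] D(2) show ?thesis by simp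
  qed
  have Is: "Int_stable G"
  proof (rule Int_stableI)
    fix a b assume "a \<in> G" "b \<in> G"
    then obtain m n where ab: "a \<in> sets borel" "b \<in> sets borel" "cylinder \<phi> m (\<lambda>x. x \<in> a)" "cylinder \<phi> n (\<lambda>x. x \<in> b)" by (auto simp: G_def)
    have "cylinder \<phi> (max m n) (\<lambda>x. x \<in> a)" "cylinder \<phi> (max m n) (\<lambda>x. x \<in> b)"
      using ab cylinder_mono by (metis max.cobounded1, metis max.cobounded2)
    then have "cylinder \<phi> (max m n) (\<lambda>x. x \<in> a \<inter> b)" unfolding cylinder_def by blast
    then show "a \<inter> b \<in> G" using ab by (auto simp: G_def)
  qed
  have Gp: "G \<subseteq> Pow UNIV" by simp
  from Is Gp gen have "P A"
  proof (induction A rule: sigma_sets_induct_disjoint)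
    case (basic A)
    then obtain m where m: "A \<in> sets borel" "cylinder \<phi> m (\<lambda>x. x \<in> A)" by (auto simp: G_def)
    have "cylinder \<phi> m (indicator A :: 'x \<Rightarrow> real)" using m(2) by (auto simp: cylinder_def indicator_def)
    then show ?case unfolding P_def using m(1) by (intro allI impI exI[of _ m] exI[of _ "indicator A"]) auto
  next
    case empty
    have "cylinder \<phi> 0 (\<lambda>_. 0 :: real)" by (simp add: cylinder_def)
    then show ?case unfolding P_def by (intro allI impI exI[of _ 0] exI[of _ "\<lambda>_. 0"]) auto
  next
    case (compl A)
    show ?case unfolding P_def
    proof (intro allI impI)
      fix e :: real assume "e > 0"
      then obtain m g where g: "g \<in> borel_measurable borel" "cylinder \<phi> m g" "integrable N (\<lambda>x. (indicator A x - g x)\<^sup>2)"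
        "(\<integral>x. (indicator A x - g x)\<^sup>2 \<partial>N) < e" using compl unfolding P_def by blast
      have e: "(indicator (UNIV - A) x - (1 - g x))\<^sup>2 = (indicator A x - g x)\<^sup>2" for x :: 'x
        by (auto simp: indicator_def power2_eq_square algebra_simps)
      show "\<exists>m g. g \<in> borel_measurable borel \<and> cylinder \<phi> m g \<and> integrable N (\<lambda>x. (indicator (UNIV - A) x - g x)\<^sup>2) \<and>
        (\<integral>x. (indicator (UNIV - A) x - g x)\<^sup>2 \<partial>N) < e"
      proof (intro exI conjI)
        show "(\<lambda>x. 1 - g x) \<in> borel_measurable borel" using g(1) by measurable
        show "cylinder \<phi> m (\<lambda>x. 1 - g x)" using g(2) unfolding cylinder_def by metis
      qed (use g e in simp_all)
    qed
  next
    case (union A)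
    have AB: "A i \<in> sets borel" for i
    proof -
      have "G \<subseteq> sets borel" by (auto simp: G_def)
      then have "sigma_sets UNIV G \<subseteq> sets borel" using sets.sigma_sets_subset[of G borel] by simp
      then show ?thesis using union(2) by blast
    qed
    show ?case unfolding P_def
    proof (intro allI impI)
      fix e :: real assume e: "e > 0"
      define U where "U n = (\<Union>i<n. A i)" for n :: nat
      have UB: "U n \<in> sets borel" "(\<Union>i. A i) \<in> sets borel" for n using AB by (auto simp: U_def)
      have "(\<lambda>n. measure N (U n)) \<longlonglongrightarrow> measure N (\<Union>n. U n)"
      proof (rule N.finite_Lim_measure_incseq)
        show "range U \<subseteq> sets N" using UB by (auto simp: sN)
        show "incseq U" by (auto simp: U_def incseq_def intro: order_less_le_trans)
      qed
      moreover have "(\<Union>n. U n) = (\<Union>i. A i)" by (auto simp: U_def)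
      ultimately have "(\<lambda>n. measure N (U n)) \<longlonglongrightarrow> measure N (\<Union>i. A i)" by simp
      from LIMSEQ_D[OF this, of "e/4"] e obtain n where n: "\<bar>measure N (U n) - measure N (\<Union>i. A i)\<bar> < e / 4"
        by auto
      have U_sub: "U n \<subseteq> (\<Union>i. A i)" by (auto simp: U_def)
      have d1: "(\<integral>x. (indicator (\<Union>i. A i) x - indicator (U n) x :: real)\<^sup>2 \<partial>N) < e / 4"
      proof -
        have "(\<integral>x. (indicator (\<Union>i. A i) x - indicator (U n) x :: real)\<^sup>2 \<partial>N) = (\<integral>x. indicator ((\<Union>i. A i) - U n) x \<partial>N)"
          using U_sub by (intro Bochner_Integration.integral_cong) (auto simp: indicator_def)
        also have "\<dots> = measure N ((\<Union>i. A i) - U n)" using UB by (simp add: sN)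
        also have "\<dots> = measure N (\<Union>i. A i) - measure N (U n)" using UB U_sub by (intro N.finite_measure_Diff) (auto simp: sN)
        finally show ?thesis using n by linarith
      qed
      \<comment> \<open>Each of the \<open>n\<close> sets is approximated up to
        \<open>d / Suc n\<close>. Cauchy-Schwarz costs a factor \<open>n\<close> and the sum
        another, so the total is at most \<open>n * d\<close>, hence at most
        \<open>e / 4\<close>.\<close>
      define d where "d = e / (4 * real (Suc n))"
      have "d > 0" using e by (simp add: d_def)
      then have d': "d / real (Suc n) > 0" by simp
      have "\<forall>i. \<exists>m g. g \<in> borel_measurable borel \<and> cylinder \<phi> m g \<and> integrable N (\<lambda>x. (indicator (A i) x - g x)\<^sup>2) \<and>
          (\<integral>x. (indicator (A i) x - g x)\<^sup>2 \<partial>N) < d / real (Suc n)"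
        using union(3) d' unfolding P_def by simp
      from choice[OF this] obtain m where "\<forall>i. \<exists>g. g \<in> borel_measurable borel \<and> cylinder \<phi> (m i) g \<and> integrable N (\<lambda>x. (indicator (A i) x - g x)\<^sup>2) \<and>
          (\<integral>x. (indicator (A i) x - g x)\<^sup>2 \<partial>N) < d / real (Suc n)" ..
      from choice[OF this] obtain g where gg: "\<forall>i. g i \<in> borel_measurable borel \<and> cylinder \<phi> (m i) (g i) \<and> integrable N (\<lambda>x. (indicator (A i) x - g i x)\<^sup>2) \<and>
          (\<integral>x. (indicator (A i) x - g i x)\<^sup>2 \<partial>N) < d / real (Suc n)" ..
      have g: "\<And>i. g i \<in> borel_measurable borel" "\<And>i. cylinder \<phi> (m i) (g i)" "\<And>i. integrable N (\<lambda>x. (indicator (A i) x - g i x)\<^sup>2)"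
        "\<And>i. (\<integral>x. (indicator (A i) x - g i x)\<^sup>2 \<partial>N) < d / real (Suc n)" using gg by simp_all
      define f where "f x = (\<Sum>i<n. g i x)" for x
      have fm: "f \<in> borel_measurable borel" unfolding f_def using g(1) by measurable
      define m' where "m' = (\<Sum>i<n. m i)"
      have fc: "cylinder \<phi> m' f"
      proof -
        have "cylinder \<phi> m' (g i)" if "i < n" for i
          using g(2) by (rule cylinder_mono) (use that in \<open>auto simp: m'_def intro: member_le_sum\<close>)
        then show ?thesis unfolding cylinder_def f_def by (meson lessThan_iff sum.cong)
      qed
      have ind: "indicator (U n) x = (\<Sum>i<n. indicator (A i) x :: real)" for x
        unfolding U_def using union(1) by (intro indicator_UN_disjoint) (auto simp: disjoint_family_on_def)
      have b: "(indicator (U n) x - f x)\<^sup>2 \<le> real n * (\<Sum>i<n. (indicator (A i) x - g i x)\<^sup>2)" for x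
        unfolding ind f_def sum_subtractf[symmetric] using sum_squared_le_sum_of_squares[of "\<lambda>i. indicator (A i) x - g i x" "{..<n}"] by (simp add: mult.commute)
      have i2: "integrable N (\<lambda>x. real n * (\<Sum>i<n. (indicator (A i) x - g i x)\<^sup>2))" using g(3) by simp
      have i3: "integrable N (\<lambda>x. (indicator (U n) x - f x)\<^sup>2)"
        by (rule Bochner_Integration.integrable_bound[OF i2]) (use fm UB in \<open>auto simp: mN intro!: AE_I2 order_trans[OF b abs_ge_self]\<close>)
      have "(\<integral>x. (indicator (U n) x - f x)\<^sup>2 \<partial>N) \<le> (\<integral>x. real n * (\<Sum>i<n. (indicator (A i) x - g i x)\<^sup>2) \<partial>N)"
        by (rule integral_mono[OF i3 i2]) (rule b)
      also have "\<dots> = real n * (\<Sum>i<n. \<integral>x. (indicator (A i) x - g i x)\<^sup>2 \<partial>N)" using g(3) by simp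
      also have "\<dots> \<le> real n * (\<Sum>i<n. d / real (Suc n))"
        using g(4) by (intro mult_left_mono sum_mono) (auto intro: less_imp_le)
      also have "\<dots> = real n * d * (real n / real (Suc n))" by simp
      also have "\<dots> \<le> real n * d * 1" using \<open>d > 0\<close> by (intro mult_left_mono) auto
      also have "\<dots> \<le> e / 4" using e unfolding d_def by (simp add: field_simps)
      finally have d2: "(\<integral>x. (indicator (U n) x - f x)\<^sup>2 \<partial>N) \<le> e / 4" .
      have i1: "integrable N (\<lambda>x. (indicator (\<Union>i. A i) x - indicator (U n) x :: real)\<^sup>2)"
      proof (rule N.integrable_const_bound[where B=1])
        show "AE x in N. norm ((indicator (\<Union>i. A i) x - indicator (U n) x :: real)\<^sup>2) \<le> 1" by (auto simp: indicator_def)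
        show "(\<lambda>x. (indicator (\<Union>i. A i) x - indicator (U n) x :: real)\<^sup>2) \<in> borel_measurable N" using UB by (simp add: mN)
      qed
      have s: "integrable N (\<lambda>x. (indicator (\<Union>i. A i) x - f x)\<^sup>2)"
        "(\<integral>x. (indicator (\<Union>i. A i) x - f x)\<^sup>2 \<partial>N) \<le> 2 * (\<integral>x. (indicator (\<Union>i. A i) x - indicator (U n) x :: real)\<^sup>2 \<partial>N) + 2 * (\<integral>x. (indicator (U n) x - f x)\<^sup>2 \<partial>N)"
        using integrable_norm_sq_add[of "\<lambda>x. indicator (\<Union>i. A i) x - indicator (U n) x :: real" N "\<lambda>x. indicator (U n) x - f x"] i1 i3 fm UB
        by (simp_all add: mN)
      have "(\<integral>x. (indicator (\<Union>i. A i) x - f x)\<^sup>2 \<partial>N) < e" using s(2) d1 d2 by linarith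
      then show "\<exists>m g. g \<in> borel_measurable borel \<and> cylinder \<phi> m g \<and> integrable N (\<lambda>x. (indicator (\<Union>i. A i) x - g x)\<^sup>2) \<and>
        (\<integral>x. (indicator (\<Union>i. A i) x - g x)\<^sup>2 \<partial>N) < e"
        using fm fc s(1) by blast
    qed
  qed
  then show ?thesis unfolding P_def .
qed

text \<open>The identity map is approximated in mean square by a simple function, and the indicators
  of its finitely many level sets are then replaced by cylinder functions.\<close>

lemma cylinder_approx:
  fixes \<phi> :: "'x::{banach,second_countable_topology} \<Rightarrow> nat \<Rightarrow> real"
  assumes N: "prob_space N" and sN: "sets N = sets borel"
    and cont: "continuous_on UNIV \<phi>" and inj: "inj \<phi>"
    and sq: "integrable N (\<lambda>x. (norm x)\<^sup>2)" and e: "e > 0"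
  shows "\<exists>m f. f \<in> borel_measurable borel \<and> cylinder \<phi> m f \<and> integrable N (\<lambda>x. (norm (x - f x))\<^sup>2) \<and>
      (\<integral>x. (norm (x - f x))\<^sup>2 \<partial>N) < (e :: real)"
proof -
  interpret N: prob_space N by fact
  have spN: "space N = UNIV" using sets_eq_imp_space_eq[OF sN] by simp
  have mN: "f \<in> borel_measurable N \<longleftrightarrow> f \<in> borel_measurable borel" for f :: "'x \<Rightarrow> 'y::topological_space"
    by (intro arg_cong2[where f="(\<in>)"] refl measurable_cong_sets sN)
  have idm: "(\<lambda>x::'x. x) \<in> borel_measurable N" by (simp add: mN)
  obtain s where s: "\<And>i. simple_function N (s i)" "\<And>x. (\<lambda>i. s i x) \<longlonglongrightarrow> x" "\<And>i x. dist (s i x) 0 \<le> 2 * dist x (0::'x)"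
    using borel_measurable_implies_sequence_metric[OF idm, of 0] spN by auto
  have sm: "s i \<in> borel_measurable N" for i using s(1) by (rule borel_measurable_simple_function)
  note [measurable] = sm idm
  \<comment> \<open>\<open>9 = (1 + 2)\<^sup>2\<close>, since \<open>s i x\<close> has at most twice
    the norm of \<open>x\<close>. This gives the integrable majorant for dominated
    convergence.\<close>
  have b9: "(norm (x - s i x))\<^sup>2 \<le> 9 * (norm x)\<^sup>2" for i x
  proof -
    have "norm (x - s i x) \<le> norm x + norm (s i x)" by (rule norm_triangle_ineq4)
    also have "\<dots> \<le> 3 * norm x" using s(3)[of i x] by simp
    finally have "(norm (x - s i x))\<^sup>2 \<le> (3 * norm x)\<^sup>2" by (intro power_mono) auto
    then show ?thesis by (simp add: power_mult_distrib)
  qed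
  have "(\<lambda>i. \<integral>x. (norm (x - s i x))\<^sup>2 \<partial>N) \<longlonglongrightarrow> (\<integral>x. 0 \<partial>N)"
  proof (rule integral_dominated_convergence[where w="\<lambda>x. 9 * (norm x)\<^sup>2"])
    show "AE x in N. (\<lambda>i. (norm (x - s i x))\<^sup>2) \<longlonglongrightarrow> 0"
    proof (rule AE_I2)
      fix x
      have "(\<lambda>i. (norm (x - s i x))\<^sup>2) \<longlonglongrightarrow> (norm (x - x))\<^sup>2" by (intro tendsto_intros s)
      then show "(\<lambda>i. (norm (x - s i x))\<^sup>2) \<longlonglongrightarrow> 0" by simp
    qed
  qed (use sq b9 in auto)
  then have "(\<lambda>i. \<integral>x. (norm (x - s i x))\<^sup>2 \<partial>N) \<longlonglongrightarrow> 0" by simp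
  from LIMSEQ_D[OF this, of "e/4"] e obtain i where i: "(\<integral>x. (norm (x - s i x))\<^sup>2 \<partial>N) < e / 4"
    by auto
  have int_s: "integrable N (\<lambda>x. (norm (x - s i x))\<^sup>2)"
  proof (rule Bochner_Integration.integrable_bound[where f="\<lambda>x. 9 * (norm x)\<^sup>2"])
    show "integrable N (\<lambda>x. 9 * (norm x)\<^sup>2)" using sq by simp
    show "AE x in N. norm ((norm (x - s i x))\<^sup>2) \<le> norm (9 * (norm x)\<^sup>2)" using b9 by simp
  qed measurable
  define Y where "Y = range (s i)"
  have Y: "finite Y" using simple_functionD(1)[OF s(1)[of i]] spN by (simp add: Y_def)
  define A where "A y = s i -` {y}" for y
  have AB: "A y \<in> sets borel" for y
    using simple_functionD(2)[OF s(1)[of i], of "{y}"] spN sN by (simp add: A_def)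
  \<comment> \<open>The factor lost in passing from the error of \<open>f\<close> to the errors of
    the indicators. It may vanish, hence \<open>c + 1\<close> in the next denominator.\<close>
  define c where "c = (\<Sum>y\<in>Y. (norm y)\<^sup>2) * real (card Y)"
  have c0: "c \<ge> 0" unfolding c_def by (simp add: sum_nonneg)
  define d where "d = e / (4 * (c + 1))"
  have d: "d > 0" "c * d \<le> e / 4" using e c0 by (auto simp: d_def field_simps)
  have "\<forall>y. \<exists>m g. g \<in> borel_measurable borel \<and> cylinder \<phi> m g \<and> integrable N (\<lambda>x. (indicator (A y) x - g x)\<^sup>2) \<and>
      (\<integral>x. (indicator (A y) x - g x)\<^sup>2 \<partial>N) < d"
    by (intro allI indicator_cylinder_approx[OF N sN cont inj AB, rule_format] d(1))
  from choice[OF this] obtain m where "\<forall>y. \<exists>g. g \<in> borel_measurable borel \<and> cylinder \<phi> (m y) g \<and> integrable N (\<lambda>x. (indicator (A y) x - g x)\<^sup>2) \<and>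
      (\<integral>x. (indicator (A y) x - g x)\<^sup>2 \<partial>N) < d" ..
  from choice[OF this] obtain g where gg: "\<forall>y. g y \<in> borel_measurable borel \<and> cylinder \<phi> (m y) (g y) \<and> integrable N (\<lambda>x. (indicator (A y) x - g y x)\<^sup>2) \<and>
      (\<integral>x. (indicator (A y) x - g y x)\<^sup>2 \<partial>N) < d" ..
  have g: "\<And>y. g y \<in> borel_measurable borel" "\<And>y. cylinder \<phi> (m y) (g y)" "\<And>y. integrable N (\<lambda>x. (indicator (A y) x - g y x)\<^sup>2)"
    "\<And>y. (\<integral>x. (indicator (A y) x - g y x)\<^sup>2 \<partial>N) < d" using gg by simp_all
  define f where "f x = (\<Sum>y\<in>Y. g y x *\<^sub>R y)" for x
  have fm: "f \<in> borel_measurable borel" unfolding f_def using g(1) by measurable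
  define m' where "m' = (\<Sum>y\<in>Y. m y)"
  have fc: "cylinder \<phi> m' f"
  proof -
    have "cylinder \<phi> m' (g y)" if "y \<in> Y" for y
      using g(2) by (rule cylinder_mono) (use that Y in \<open>auto simp: m'_def intro: member_le_sum\<close>)
    then show ?thesis unfolding cylinder_def f_def by (metis (no_types, lifting) sum.cong)
  qed
  have se: "s i x = (\<Sum>y\<in>Y. indicator (A y) x *\<^sub>R y)" for x
  proof -
    have "(\<Sum>y\<in>Y. indicator (A y) x *\<^sub>R y) = (\<Sum>y\<in>Y. if y = s i x then s i x else 0)"
      by (intro sum.cong) (auto simp: A_def indicator_def)
    also have "\<dots> = s i x" using Y by (simp add: Y_def)
    finally show ?thesis by simp
  qed
  have b: "(norm (s i x - f x))\<^sup>2 \<le> (\<Sum>y\<in>Y. (norm y)\<^sup>2) * (\<Sum>y\<in>Y. (indicator (A y) x - g y x)\<^sup>2)" for x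
  proof -
    have "s i x - f x = (\<Sum>y\<in>Y. (indicator (A y) x - g y x) *\<^sub>R y)"
      unfolding se f_def by (simp add: sum_subtractf scaleR_diff_left)
    then have "norm (s i x - f x) \<le> (\<Sum>y\<in>Y. \<bar>indicator (A y) x - g y x\<bar> * norm y)"
      using norm_sum[of "\<lambda>y. (indicator (A y) x - g y x) *\<^sub>R y" Y] by simp
    then have "(norm (s i x - f x))\<^sup>2 \<le> (\<Sum>y\<in>Y. \<bar>indicator (A y) x - g y x\<bar> * norm y)\<^sup>2" by (intro power_mono) auto
    also have "\<dots> \<le> (\<Sum>y\<in>Y. \<bar>indicator (A y) x - g y x\<bar>\<^sup>2) * (\<Sum>y\<in>Y. (norm y)\<^sup>2)"
      by (rule Cauchy_Schwarz_ineq_sum)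
    finally show ?thesis by (simp add: mult.commute)
  qed
  have i2: "integrable N (\<lambda>x. (\<Sum>y\<in>Y. (norm y)\<^sup>2) * (\<Sum>y\<in>Y. (indicator (A y) x - g y x)\<^sup>2))" using g(3) by simp
  have fmN: "f \<in> borel_measurable N" using fm by (simp add: mN)
  note [measurable] = fmN
  have i3: "integrable N (\<lambda>x. (norm (s i x - f x))\<^sup>2)"
    by (rule Bochner_Integration.integrable_bound[OF i2]) (auto intro!: AE_I2 order_trans[OF b abs_ge_self])
  have "(\<integral>x. (norm (s i x - f x))\<^sup>2 \<partial>N) \<le> (\<integral>x. (\<Sum>y\<in>Y. (norm y)\<^sup>2) * (\<Sum>y\<in>Y. (indicator (A y) x - g y x)\<^sup>2) \<partial>N)"
    by (rule integral_mono[OF i3 i2]) (rule b)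
  also have "\<dots> = (\<Sum>y\<in>Y. (norm y)\<^sup>2) * (\<Sum>y\<in>Y. \<integral>x. (indicator (A y) x - g y x)\<^sup>2 \<partial>N)" using g(3) by simp
  also have "\<dots> \<le> (\<Sum>y\<in>Y. (norm y)\<^sup>2) * (\<Sum>y\<in>Y. d)"
    using g(4) by (intro mult_left_mono sum_mono) (auto intro: less_imp_le sum_nonneg)
  also have "\<dots> = c * d" by (simp add: c_def)
  finally have d2: "(\<integral>x. (norm (s i x - f x))\<^sup>2 \<partial>N) \<le> e / 4" using d(2) by linarith
  have s2: "integrable N (\<lambda>x. (norm (x - f x))\<^sup>2)"
    "(\<integral>x. (norm (x - f x))\<^sup>2 \<partial>N) \<le> 2 * (\<integral>x. (norm (x - s i x))\<^sup>2 \<partial>N) + 2 * (\<integral>x. (norm (s i x - f x))\<^sup>2 \<partial>N)"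
    using integrable_norm_sq_add[of "\<lambda>x. x - s i x" N "\<lambda>x. s i x - f x"] int_s i3 by (simp_all add: sm fmN idm)
  have "(\<integral>x. (norm (x - f x))\<^sup>2 \<partial>N) < e" using s2(2) i d2 by linarith
  then show ?thesis using fm fc s2(1) by blast
qed

section \<open>Processes with paths in the space\<close>

text \<open>The open sets where an evaluation does not vanish cover all nonzero vectors. Countably
  many of them suffice by the Lindelof property, and linearity turns a nonzero value at
  \<open>x - y\<close> into separation of \<open>x\<close> and \<open>y\<close>.\<close>

lemma rkbs_separating_sequence:
  fixes evl :: "'x::{banach,second_countable_topology} \<Rightarrow> 't \<Rightarrow> real"
  assumes "rkbs evl"
  obtains t :: "nat \<Rightarrow> 't" where "inj (\<lambda>x n. evl x (t n))"
proof -
  have bl: "bounded_linear (\<lambda>x. evl x t)" for t using assms by (simp add: rkbs_def)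
  define U where "U t = {x. evl x t \<noteq> 0}" for t
  have "open (U t)" for t unfolding U_def
    by (intro open_Collect_neq continuous_intros linear_continuous_on bl)
  then have oU: "\<And>S. S \<in> range U \<Longrightarrow> open S" by auto
  obtain F where F: "F \<subseteq> range U" "countable F" "\<Union>F = \<Union>(range U)"
    by (rule Lindelof[OF oU]) (assumption, rule that)
  obtain T0 where T0: "countable T0" "F = U ` T0" using F(1,2) countable_subset_image[of F U UNIV] by auto
  \<comment> \<open>For a trivial space \<open>T0\<close> may be empty; adding one arbitrary index
    makes the set enumerable by a sequence.\<close>
  define t where "t = from_nat_into (insert undefined T0)"
  have rt: "range t = insert undefined T0" unfolding t_def using T0(1) by (intro range_from_nat_into) auto
  have "inj (\<lambda>x n. evl x (t n))"
  proof (rule injI)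
    fix x y assume e: "(\<lambda>n. evl x (t n)) = (\<lambda>n. evl y (t n))"
    have d: "evl (x - y) s = evl x s - evl y s" for s using linear_diff[OF bounded_linear.linear[OF bl[of s]]] .
    show "x = y"
    proof (rule ccontr)
      assume "x \<noteq> y"
      have "evl (x - y) \<noteq> evl 0"
        using assms \<open>x \<noteq> y\<close> unfolding rkbs_def by (simp add: inj_eq)
      moreover have "evl 0 s = 0" for s using linear_0[OF bounded_linear.linear[OF bl[of s]]] .
      ultimately obtain s where "evl (x - y) s \<noteq> 0" by (metis ext)
      then have "x - y \<in> \<Union>(range U)" by (auto simp: U_def)
      then obtain s' where "s' \<in> T0" "evl (x - y) s' \<noteq> 0" unfolding F(3)[symmetric] T0(2) by (auto simp: U_def)
      then obtain n where "evl (x - y) (t n) \<noteq> 0" using rt by (metis imageE insertI2)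
      then show False using fun_cong[OF e, of n] d by simp
    qed
  qed
  then show thesis by (rule that)
qed

lemma rkbs_coordinates:
  fixes evl :: "'x::{banach,second_countable_topology} \<Rightarrow> 't \<Rightarrow> real"
  assumes "rkbs evl"
  shows "continuous_on UNIV (\<lambda>x n. evl x (t n))"
    and "evl (a *\<^sub>R x + b *\<^sub>R y) s = a * evl x s + b * evl y s"
proof -
  have bl: "bounded_linear (\<lambda>x. evl x t)" for t using assms by (simp add: rkbs_def)
  show "continuous_on UNIV (\<lambda>x n. evl x (t n))"
    by (rule continuous_on_coordinatewise_then_product) (rule linear_continuous_on[OF bl])
  interpret bounded_linear "\<lambda>x. evl x s" by (rule bl)
  show "evl (a *\<^sub>R x + b *\<^sub>R y) s = a * evl x s + b * evl y s" by (simp add: add scaleR)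
qed

lemma (in isonormal) Z_diff:
  assumes "x \<in> H" "y \<in> H"
  shows "AE \<omega> in M. Z (\<lambda>s. x s - y s) \<omega> = Z x \<omega> - Z y \<omega>"
proof -
  have "lin_comb {True, False} (\<lambda>b. if b then 1 else -1) (\<lambda>b. if b then x else y) = (\<lambda>s. x s - y s)"
    by (auto simp: lin_comb_def)
  moreover have "AE \<omega> in M. Z (lin_comb {True, False} (\<lambda>b. if b then 1 else -1) (\<lambda>b. if b then x else y)) \<omega>
     = (\<Sum>b\<in>{True, False}. (if b then 1 else -1) * Z (if b then x else y) \<omega>)"
    using assms by (intro Z_lin_comb) auto
  ultimately show ?thesis by simp
qed

context isonormal_banach begin

text \<open>With the projection onto the first \<open>m\<close> kernel functions, \<open>2 S - \<zeta>\<close> has the distribution of \<open>\<zeta>\<close>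
  and the same first \<open>m\<close> coordinates, so an approximation of \<open>\<zeta>\<close> by a cylinder function
  approximates \<open>2 S - \<zeta>\<close> equally well.\<close>

lemma projection_residual_small:
  assumes \<zeta>[measurable]: "\<zeta> \<in> borel_measurable M" and v: "\<And>n. v n \<in> H"
    and \<zeta>v: "\<And>n. AE \<omega> in M. \<phi> (\<zeta> \<omega>) n = Z (v n) \<omega>"
    and x: "\<And>k n. \<phi> (x k) n = ip (gram_schmidt ip v k) (v n)" and e: "e > 0"
  shows "\<exists>m. (\<integral>\<omega>. (norm (\<zeta> \<omega> - (\<Sum>k<m. Z (gram_schmidt ip v k) \<omega> *\<^sub>R x k)))\<^sup>2 \<partial>M) < e"
proof -
  define N where "N = distr M borel \<zeta>"
  have sq: "integrable M (\<lambda>\<omega>. (norm (\<zeta> \<omega>))\<^sup>2)" by (rule square_integrable_of_Z[OF \<zeta> v \<zeta>v])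
  have pN: "prob_space N" unfolding N_def by (rule prob_space_distr) simp
  have sN: "sets N = sets borel" by (simp add: N_def)
  have "integrable N (\<lambda>x. (norm x)\<^sup>2)" unfolding N_def using sq by (subst integrable_distr_eq) auto
  from cylinder_approx[OF pN sN \<phi>_cont \<phi>_inj this e] obtain m f where
    f[measurable]: "f \<in> borel_measurable borel" and cyl: "cylinder \<phi> m f"
    and fi: "integrable N (\<lambda>x. (norm (x - f x))\<^sup>2)" and fe: "(\<integral>x. (norm (x - f x))\<^sup>2 \<partial>N) < e" by blast
  have D: "orthonormal_or_zero {..<m} (gram_schmidt ip v)" by (rule gram_schmidt_orthonormal_or_zero[OF v]) simp
  define S where "S \<omega> = (\<Sum>k<m. Z (gram_schmidt ip v k) \<omega> *\<^sub>R x k)" for \<omega>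
  have [measurable]: "S \<in> borel_measurable M" unfolding S_def by measurable
  note rl = reflection_law[OF D \<zeta> v \<zeta>v x, folded S_def]
  have "AE \<omega> in M. \<forall>j\<in>{..<m}. \<phi> (2 *\<^sub>R S \<omega> - \<zeta> \<omega>) j = \<phi> (\<zeta> \<omega>) j"
  proof (rule AE_finite_allI)
    fix j assume "j \<in> {..<m}"
    then have "v j = proj {..<m} (gram_schmidt ip v) (v j)" by (intro gram_schmidt_expand v) simp
    then have "AE \<omega> in M. \<phi> (S \<omega>) j = Z (v j) \<omega>" using rl(1)[of j] by metis
    then show "AE \<omega> in M. \<phi> (2 *\<^sub>R S \<omega> - \<zeta> \<omega>) j = \<phi> (\<zeta> \<omega>) j" using \<zeta>v[of j]
    proof eventually_elim
      case (elim \<omega>)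
      then show ?case using \<phi>_lin[of 2 "S \<omega>" "-1" "\<zeta> \<omega>" j] by simp
    qed
  qed simp
  then have ff: "AE \<omega> in M. f (2 *\<^sub>R S \<omega> - \<zeta> \<omega>) = f (\<zeta> \<omega>)"
    by eventually_elim (use cyl in \<open>auto simp: cylinder_def\<close>)
  have i1: "integrable M (\<lambda>\<omega>. (norm (\<zeta> \<omega> - f (\<zeta> \<omega>)))\<^sup>2)" "(\<integral>\<omega>. (norm (\<zeta> \<omega> - f (\<zeta> \<omega>)))\<^sup>2 \<partial>M) < e"
    using fi fe unfolding N_def by (simp_all add: integrable_distr_eq integral_distr)
  define \<zeta>' where "\<zeta>' \<omega> = 2 *\<^sub>R S \<omega> - \<zeta> \<omega>" for \<omega>
  have [measurable]: "\<zeta>' \<in> borel_measurable M" unfolding \<zeta>'_def by measurable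
  have N': "N = distr M borel \<zeta>'" unfolding N_def \<zeta>'_def by (rule rl(2)[symmetric])
  have i2: "integrable M (\<lambda>\<omega>. (norm (\<zeta>' \<omega> - f (\<zeta>' \<omega>)))\<^sup>2)" "(\<integral>\<omega>. (norm (\<zeta>' \<omega> - f (\<zeta>' \<omega>)))\<^sup>2 \<partial>M) < e"
    using fi fe unfolding N' by (simp_all add: integrable_distr_eq integral_distr)
  \<comment> \<open>\<open>2 (\<zeta> - S) = \<zeta> - \<zeta>'\<close>, and \<open>f\<close> takes
    the same value at both terms, so it may be subtracted from each. Both errors are below
    \<open>e\<close> because the laws agree, and the factor 4 cancels.\<close>
  have "4 * (\<integral>\<omega>. (norm (\<zeta> \<omega> - S \<omega>))\<^sup>2 \<partial>M) = (\<integral>\<omega>. (norm (2 *\<^sub>R (\<zeta> \<omega> - S \<omega>)))\<^sup>2 \<partial>M)"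
    by (simp add: power_mult_distrib)
  also have "\<dots> = (\<integral>\<omega>. (norm ((\<zeta> \<omega> - f (\<zeta> \<omega>)) - (\<zeta>' \<omega> - f (\<zeta>' \<omega>))))\<^sup>2 \<partial>M)"
  proof (rule integral_cong_AE)
    show "AE \<omega> in M. (norm (2 *\<^sub>R (\<zeta> \<omega> - S \<omega>)))\<^sup>2 = (norm ((\<zeta> \<omega> - f (\<zeta> \<omega>)) - (\<zeta>' \<omega> - f (\<zeta>' \<omega>))))\<^sup>2"
      using ff
    proof eventually_elim
      case (elim \<omega>)
      have "2 *\<^sub>R (\<zeta> \<omega> - S \<omega>) = (\<zeta> \<omega> - f (\<zeta> \<omega>)) - (\<zeta>' \<omega> - f (\<zeta>' \<omega>))"
        using elim unfolding \<zeta>'_def by (simp add: scaleR_2 algebra_simps)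
      then show ?case by (simp only:)
    qed
  qed measurable
  also have "\<dots> \<le> 2 * (\<integral>\<omega>. (norm (\<zeta> \<omega> - f (\<zeta> \<omega>)))\<^sup>2 \<partial>M) + 2 * (\<integral>\<omega>. (norm (\<zeta>' \<omega> - f (\<zeta>' \<omega>)))\<^sup>2 \<partial>M)"
    by (rule integrable_norm_sq_diff(2)[OF _ _ i1(1) i2(1)]) measurable
  finally have "(\<integral>\<omega>. (norm (\<zeta> \<omega> - S \<omega>))\<^sup>2 \<partial>M) < e" using i1(2) i2(2) by linarith
  then show ?thesis unfolding S_def by blast
qed

end

section \<open>From a random element to a radonifying inclusion\<close>

lemma rkbs_inclusion_evl:
  assumes "rkbs evl" "h \<in> rkbs_space evl"
  shows "evl (rkbs_inclusion evl h) = h"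
proof -
  obtain x where x: "h = evl x" using assms by (auto simp: rkbs_space_def)
  then have "\<exists>!x. evl x = h" using assms by (auto simp: rkbs_def inj_eq)
  then show ?thesis unfolding rkbs_inclusion_def by (rule theI')
qed

text \<open>Three operators are estimated in the same way: the inclusion, its finite-rank
  approximation \<open>F\<close> and their difference. They are matched with the random elements
  \<open>\<eta>\<close>, \<open>S\<close> and \<open>R = \<eta> - S\<close>, whose second moments
  bound the squared \<gamma>-norms.\<close>

lemma gamma_radonifying_of_element:
  fixes evl :: "'x::{banach,second_countable_topology} \<Rightarrow> 't \<Rightarrow> real"
  assumes rk: "rkbs evl" and RK: "is_rkhs K H ip" and iso: "isonormal H ip M Z"
    and \<eta>[measurable]: "\<eta> \<in> borel_measurable M"
    and \<eta>Z: "\<And>t. AE \<omega> in M. evl (\<eta> \<omega>) t = Z (\<lambda>s. K s t) \<omega>"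
  shows "H \<subseteq> rkbs_space evl" and "gamma_radonifying H ip (rkbs_inclusion evl)"
proof -
  interpret isonormal H ip M Z by (rule iso)
  have inj: "inj evl" and bl: "bounded_linear (\<lambda>x. evl x t)" for t using rk by (auto simp: rkbs_def)
  obtain t :: "nat \<Rightarrow> 't" where t: "inj (\<lambda>x n. evl x (t n))" by (rule rkbs_separating_sequence[OF rk])
  interpret isonormal_banach H ip M Z "\<lambda>x n. evl x (t n)"
    by unfold_locales (simp_all add: t rkbs_coordinates[OF rk])
  define k where "k n = (\<lambda>s. K s (t n))" for n
  have KH: "(\<lambda>s. K s u) \<in> H" and rep: "x \<in> H \<Longrightarrow> ip x (\<lambda>s. K s u) = x u" for x u
    using RK by (auto simp: is_rkhs_def)
  have kH: "k n \<in> H" and repk: "x \<in> H \<Longrightarrow> ip x (k n) = x (t n)" for x n unfolding k_def by (rule KH, rule rep)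
  have \<eta>k: "AE \<omega> in M. evl (\<eta> \<omega>) (t n) = Z (k n) \<omega>" for n unfolding k_def by (rule \<eta>Z)
  have sq: "integrable M (\<lambda>\<omega>. (norm (\<eta> \<omega>))\<^sup>2)" by (rule square_integrable_of_Z[OF \<eta> kH \<eta>k])
  have Zn: "integrable M (\<lambda>\<omega>. Z h \<omega> * norm (\<eta> \<omega>))" if "h \<in> H" for h
    by (intro product_integrable_of_squares Z_sq that sq) auto
  have Z\<eta>: "integrable M (\<lambda>\<omega>. Z h \<omega> *\<^sub>R \<eta> \<omega>)" if "h \<in> H" for h
    by (rule Bochner_Integration.integrable_bound[OF Zn[OF that]]) auto
  \<comment> \<open>Evaluation passes under the Bochner integral and reproduces the value of
    \<open>h\<close>. So \<open>h\<close> is found to lie in \<open>X\<close>, before any inclusion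
    map is available.\<close>
  define J where "J h = (\<integral>\<omega>. Z h \<omega> *\<^sub>R \<eta> \<omega> \<partial>M)" for h
  have Jh: "evl (J h) = h" if h: "h \<in> H" for h
  proof
    fix u
    have "evl (J h) u = (\<integral>\<omega>. evl (Z h \<omega> *\<^sub>R \<eta> \<omega>) u \<partial>M)"
      unfolding J_def by (rule integral_bounded_linear[OF bl Z\<eta>[OF h], symmetric])
    also have "\<dots> = (\<integral>\<omega>. Z h \<omega> * Z (\<lambda>s. K s u) \<omega> \<partial>M)"
    proof (rule integral_cong_AE)
      have "(\<lambda>x. evl x u) \<in> borel_measurable borel"
        by (intro borel_measurable_continuous_onI linear_continuous_on bl)
      then show "(\<lambda>\<omega>. evl (Z h \<omega> *\<^sub>R \<eta> \<omega>) u) \<in> borel_measurable M" by measurable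
      show "AE \<omega> in M. evl (Z h \<omega> *\<^sub>R \<eta> \<omega>) u = Z h \<omega> * Z (\<lambda>s. K s u) \<omega>"
        using \<eta>Z[of u]
      proof eventually_elim
        case (elim \<omega>)
        then show ?case using rkbs_coordinates(2)[OF rk, of "Z h \<omega>" "\<eta> \<omega>" 0 0 u] by simp
      qed
    qed measurable
    also have "\<dots> = h u" using Z_ip[OF h KH] rep[OF h] by simp
    finally show "evl (J h) u = h u" .
  qed
  show sub: "H \<subseteq> rkbs_space evl"
  proof
    fix h assume "h \<in> H"
    then have "h = evl (J h)" using Jh by simp
    then show "h \<in> rkbs_space evl" unfolding rkbs_space_def by blast
  qed
  define \<iota> where "\<iota> = rkbs_inclusion evl"
  have \<iota>e: "evl (\<iota> h) = h" if "h \<in> H" for h unfolding \<iota>_def using sub that by (intro rkbs_inclusion_evl[OF rk]) auto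
  have \<iota>J: "\<iota> h = J h" if "h \<in> H" for h using \<iota>e[OF that] Jh[OF that] inj by (metis injD)
  have \<iota>ip: "evl (\<iota> h) (t n) = ip h (k n)" if "h \<in> H" for h n using \<iota>e[OF that] repk[OF that] by simp
  have evl_eqI: "x = y" if "\<And>u. evl x u = evl y u" for x y using inj that by (metis ext injD)
  note lin = rkbs_coordinates(2)[OF rk]
  have bop: "bounded_operator_on H ip \<iota>" unfolding bounded_operator_on_def
  proof (intro conjI ballI allI exI)
    fix x y assume xy: "x \<in> H" "y \<in> H"
    show "\<iota> (\<lambda>s. x s + y s) = \<iota> x + \<iota> y"
      by (rule evl_eqI) (use lin[of 1 "\<iota> x" 1 "\<iota> y"] \<iota>e xy in \<open>simp add: add_in\<close>)
  next
    fix c x assume x: "x \<in> H"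
    show "\<iota> (\<lambda>s. c * x s) = c *\<^sub>R \<iota> x"
      by (rule evl_eqI) (use lin[of c "\<iota> x" 0 0] \<iota>e x in \<open>simp add: scale_in\<close>)
  next
    fix h assume h: "h \<in> H"
    have "norm (\<iota> h) \<le> (\<integral>\<omega>. \<bar>Z h \<omega>\<bar> * norm (\<eta> \<omega>) \<partial>M)"
      unfolding \<iota>J[OF h] J_def using integral_norm_bound[of M "\<lambda>\<omega>. Z h \<omega> *\<^sub>R \<eta> \<omega>"] by simp
    also have "\<dots> \<le> sqrt ((\<integral>\<omega>. \<bar>Z h \<omega>\<bar>\<^sup>2 \<partial>M) * (\<integral>\<omega>. (norm (\<eta> \<omega>))\<^sup>2 \<partial>M))"
      by (intro real_le_rsqrt integral_product_Cauchy_Schwarz) (use sq Z_sq[OF h] in auto)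
    also have "(\<integral>\<omega>. \<bar>Z h \<omega>\<bar>\<^sup>2 \<partial>M) = ip h h" using Z_ip[OF h h] by (simp add: power2_eq_square)
    finally show "norm (\<iota> h) \<le> sqrt (\<integral>\<omega>. (norm (\<eta> \<omega>))\<^sup>2 \<partial>M) * ip_norm ip h"
      by (simp add: ip_norm_def real_sqrt_mult mult.commute)
  qed
  \<comment> \<open>The operator \<open>A\<close> and the element \<open>\<zeta>\<close> are linked
    by the vectors \<open>v\<close>: the coordinates of \<open>A h\<close> are
    \<open>ip h (v n)\<close> and those of \<open>\<zeta>\<close> are \<open>Z (v n)\<close>. The
    random sum is then a projection of \<open>\<zeta>\<close>.\<close>
  have gam: "(\<integral>\<omega>. (norm (\<Sum>j<n. Z (h j) \<omega> *\<^sub>R A (h j)))\<^sup>2 \<partial>M) \<le> (\<integral>\<omega>. (norm (\<zeta> \<omega>))\<^sup>2 \<partial>M)"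
    if on: "orthonormal_system H ip n h" and [measurable]: "\<zeta> \<in> borel_measurable M" and v: "\<And>n. v n \<in> H"
      and \<zeta>v: "\<And>n. AE \<omega> in M. evl (\<zeta> \<omega>) (t n) = Z (v n) \<omega>"
      and A: "\<And>h n. h \<in> H \<Longrightarrow> evl (A h) (t n) = ip h (v n)" for n h A \<zeta> v
  proof (rule projection_contracts[OF orthonormal_system_or_zero[OF on] _ v \<zeta>v])
    show "evl (A (h j)) (t m) = ip (h j) (v m)" if "j \<in> {..<n}" for j m
      using on that by (intro A) (auto simp: orthonormal_system_def)
    show "integrable M (\<lambda>\<omega>. (norm (\<zeta> \<omega>))\<^sup>2)" by (rule square_integrable_of_Z[OF _ v \<zeta>v]) simp
  qed simp
  have \<iota>\<gamma>: "\<iota> \<in> gamma_infty H ip"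
    unfolding gamma_infty_def using bop gamma_valuesI(1)[OF gam[OF _ \<eta> kH \<eta>k \<iota>ip]] by simp
  have "\<exists>F\<in>gamma_infty H ip. finite_rank_on H F \<and> gamma_norm H ip (\<lambda>h. \<iota> h - F h) < \<epsilon>" if \<epsilon>: "\<epsilon> > 0" for \<epsilon>
  proof -
    define e where "e = gram_schmidt ip k"
    have eH: "e j \<in> H" for j using orthonormal_or_zero_in[OF gram_schmidt_orthonormal_or_zero[OF kH, of "{j}"]] unfolding e_def by auto
    have xe: "evl (\<iota> (e j)) (t n) = ip (e j) (k n)" for j n by (rule \<iota>ip[OF eH])
    \<comment> \<open>Half of \<open>\<epsilon>\<close>, because a bound for a supremum is not
      strict.\<close>
    from projection_residual_small[OF \<eta> kH \<eta>k, of "\<lambda>j. \<iota> (e j)" "(\<epsilon>/2)\<^sup>2"] \<epsilon> xe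
    obtain m where m: "(\<integral>\<omega>. (norm (\<eta> \<omega> - (\<Sum>j<m. Z (e j) \<omega> *\<^sub>R \<iota> (e j))))\<^sup>2 \<partial>M) < (\<epsilon>/2)\<^sup>2"
      unfolding e_def by auto
    have D: "orthonormal_or_zero {..<m} e" unfolding e_def by (rule gram_schmidt_orthonormal_or_zero[OF kH]) simp
    define S where "S \<omega> = (\<Sum>j<m. Z (e j) \<omega> *\<^sub>R \<iota> (e j))" for \<omega>
    have [measurable]: "S \<in> borel_measurable M" unfolding S_def by measurable
    have Sk: "AE \<omega> in M. evl (S \<omega>) (t n) = Z (proj {..<m} e (k n)) \<omega>" for n
      unfolding S_def by (rule reflection_law(1)[OF D \<eta> kH \<eta>k]) (rule xe)
    \<comment> \<open>The inclusion composed with the projection onto the first \<open>m\<close>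
      Gram-Schmidt vectors.\<close>
    define F where "F h = (\<Sum>j<m. ip h (e j) *\<^sub>R \<iota> (e j))" for h
    have Fe: "evl (F h) (t n) = (\<Sum>j<m. ip h (e j) * ip (k n) (e j))" for h n
      unfolding F_def \<phi>_sum xe by (simp add: ip_sym[OF eH kH])
    have Fip: "evl (F h) (t n) = ip h (proj {..<m} e (k n))" if h: "h \<in> H" for h n
      unfolding Fe using ip_proj[OF D kH h] ip_sym[OF h proj_in[OF D]] by (simp add: mult.commute)
    have bF: "bounded_operator_on H ip F" unfolding bounded_operator_on_def
    proof (intro conjI ballI allI exI)
      fix x y assume xy: "x \<in> H" "y \<in> H"
      show "F (\<lambda>s. x s + y s) = F x + F y"
        unfolding F_def using xy eH by (simp add: ip_add_left scaleR_add_left sum.distrib)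
    next
      fix c x assume x: "x \<in> H"
      show "F (\<lambda>s. c * x s) = c *\<^sub>R F x"
        unfolding F_def using x eH by (simp add: ip_scale_left scaleR_sum_right)
    next
      fix h assume h: "h \<in> H"
      have b: "\<bar>ip h (e j)\<bar> \<le> ip_norm ip h" if "j < m" for j
      proof -
        have "ip (e j) (e j) = 0 \<or> ip (e j) (e j) = 1" using D that by (simp add: orthonormal_or_zero_def)
        then have "ip (e j) (e j) \<le> 1" by auto
        have "(ip h (e j))\<^sup>2 \<le> ip h h * ip (e j) (e j)" by (rule ip_Cauchy_Schwarz[OF h eH])
        also have "\<dots> \<le> ip h h * 1" using ip_nonneg[OF h] \<open>ip (e j) (e j) \<le> 1\<close> by (rule mult_left_mono[rotated])
        finally show ?thesis unfolding ip_norm_def by (intro real_le_rsqrt) simp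
      qed
      have "norm (F h) \<le> (\<Sum>j<m. norm (ip h (e j) *\<^sub>R \<iota> (e j)))" unfolding F_def by (rule norm_sum)
      also have "\<dots> \<le> (\<Sum>j<m. ip_norm ip h * norm (\<iota> (e j)))" using b by (intro sum_mono) (auto intro: mult_right_mono)
      finally show "norm (F h) \<le> (\<Sum>j<m. norm (\<iota> (e j))) * ip_norm ip h" by (simp add: sum_distrib_left[symmetric] mult.commute)
    qed
    have F\<gamma>: "F \<in> gamma_infty H ip"
      unfolding gamma_infty_def using bF gamma_valuesI(1)[OF gam[OF _ \<open>S \<in> _\<close> proj_in[OF D] Sk Fip]] by simp
    have fr: "finite_rank_on H F" unfolding finite_rank_on_def
    proof (intro exI conjI)
      show "finite ((\<lambda>j. \<iota> (e j)) ` {..<m})" by simp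
      show "F ` H \<subseteq> span ((\<lambda>j. \<iota> (e j)) ` {..<m})"
        unfolding F_def by (auto intro!: span_sum span_scale intro: span_base)
    qed
    define R where "R \<omega> = \<eta> \<omega> - S \<omega>" for \<omega>
    have Rm: "R \<in> borel_measurable M" unfolding R_def by measurable
    have RH: "(\<lambda>s. k n s - proj {..<m} e (k n) s) \<in> H" for n by (intro diff_in kH proj_in D)
    have Rk: "AE \<omega> in M. evl (R \<omega>) (t n) = Z (\<lambda>s. k n s - proj {..<m} e (k n) s) \<omega>" for n
      using \<eta>k[of n] Sk[of n] Z_diff[where x="k n" and y="proj {..<m} e (k n)", OF kH proj_in[OF D]]
    proof eventually_elim
      case (elim \<omega>)
      then show ?case using lin[of 1 "\<eta> \<omega>" "-1" "S \<omega>" "t n"] by (simp add: R_def)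
    qed
    have Rip: "evl (\<iota> h - F h) (t n) = ip h (\<lambda>s. k n s - proj {..<m} e (k n) s)" if h: "h \<in> H" for h n
      unfolding ip_residual_proj[OF D h kH] using lin[of 1 "\<iota> h" "-1" "F h" "t n"] \<iota>ip[OF h] Fe[of h n] by simp
    have "gamma_norm H ip (\<lambda>h. \<iota> h - F h) \<le> sqrt (\<integral>\<omega>. (norm (R \<omega>))\<^sup>2 \<partial>M)"
      by (rule gamma_valuesI(2)[OF gam[OF _ Rm RH Rk Rip]])
    also have "\<dots> \<le> sqrt ((\<epsilon>/2)\<^sup>2)" using m unfolding R_def S_def by (intro real_sqrt_le_mono) simp
    also have "\<dots> < \<epsilon>" using \<epsilon> by simp
    finally show ?thesis using F\<gamma> fr by blast
  qed
  then show "gamma_radonifying H ip (rkbs_inclusion evl)"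
    using \<iota>\<gamma> unfolding gamma_radonifying_def \<iota>_def by blast
qed

text \<open>The images of \<open>X\<close> in sequence space are Borel linear subspaces, so the
  zero-one law applies to them. Probability zero is excluded because the path event is contained in
  the event for the sequence.\<close>

lemma element_of_paths_nonnull:
  fixes evl :: "'x::{banach,second_countable_topology} \<Rightarrow> 't \<Rightarrow> real" and M :: "'w measure"
  assumes rk: "rkbs evl" and RK: "is_rkhs K H ip" and iso: "isonormal H ip M Z" and cm: "complete_measure M"
    and \<xi>[measurable]: "\<And>t. \<xi> t \<in> borel_measurable M" and \<xi>Z: "\<And>t. AE \<omega> in M. \<xi> t \<omega> = Z (\<lambda>s. K s t) \<omega>"
    and nonnull: "{\<omega> \<in> space M. (\<lambda>t. \<xi> t \<omega>) \<in> rkbs_space evl} \<notin> null_sets M"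
  obtains \<eta> where "\<eta> \<in> borel_measurable M" "\<And>t. AE \<omega> in M. \<xi> t \<omega> = evl (\<eta> \<omega>) t"
proof -
  interpret isonormal H ip M Z by (rule iso)
  have KH: "(\<lambda>s. K s u) \<in> H" for u using RK by (auto simp: is_rkhs_def)
  define \<Phi> where "\<Phi> t x = (\<lambda>n. evl x (t n))" for t :: "nat \<Rightarrow> 't" and x
  define \<Psi> where "\<Psi> t \<omega> = (\<lambda>n. \<xi> (t n) \<omega>)" for t :: "nat \<Rightarrow> 't" and \<omega>
  have \<Phi>c: "continuous_on UNIV (\<Phi> t)" for t unfolding \<Phi>_def by (rule rkbs_coordinates(1)[OF rk])
  have \<Psi>m[measurable]: "\<Psi> t \<in> borel_measurable M" for t unfolding \<Psi>_def measurable_into_borel_coordinate by simp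
  have R: "range (\<Phi> t) \<in> sets borel" if "inj (\<Phi> t)" for t by (rule borel_range_continuous_inj[OF \<Phi>c that])
  \<comment> \<open>Stated for every separating sequence, not only for the one that defines
    \<open>\<eta>\<close>: an extended sequence is needed at the end.\<close>
  have B1: "AE \<omega> in M. \<Psi> t \<omega> \<in> range (\<Phi> t)" if inj: "inj (\<Phi> t)" for t
  proof -
    have Bm: "{\<omega> \<in> space M. \<Psi> t \<omega> \<in> range (\<Phi> t)} \<in> sets M" using R[OF inj] by measurable
    have "measure M {\<omega> \<in> space M. \<Psi> t \<omega> \<in> range (\<Phi> t)} \<in> {0, 1}"
    proof (rule gaussian_zero_one[OF prob_space_axioms \<Psi>m _ R[OF inj]])
      show "gauss_family M (\<lambda>n \<omega>. \<Psi> t \<omega> n) (\<lambda>i j. ip (\<lambda>s. K s (t i)) (\<lambda>s. K s (t j)))"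
        unfolding \<Psi>_def by (rule gauss_family_Z[OF KH _ \<xi>Z]) simp
      fix a b x y assume "x \<in> range (\<Phi> t)" "y \<in> range (\<Phi> t)"
      then obtain x' y' where "x = \<Phi> t x'" "y = \<Phi> t y'" by blast
      then have "(\<lambda>i. a * x i + b * y i) = \<Phi> t (a *\<^sub>R x' + b *\<^sub>R y')"
        unfolding \<Phi>_def by (simp add: rkbs_coordinates(2)[OF rk])
      then show "(\<lambda>i. a * x i + b * y i) \<in> range (\<Phi> t)" by blast
    qed
    moreover have "measure M {\<omega> \<in> space M. \<Psi> t \<omega> \<in> range (\<Phi> t)} \<noteq> 0"
    proof
      assume "measure M {\<omega> \<in> space M. \<Psi> t \<omega> \<in> range (\<Phi> t)} = 0"
      then have N: "{\<omega> \<in> space M. \<Psi> t \<omega> \<in> range (\<Phi> t)} \<in> null_sets M"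
        using Bm by (auto simp: emeasure_eq_measure)
      have sub: "{\<omega> \<in> space M. (\<lambda>t. \<xi> t \<omega>) \<in> rkbs_space evl} \<subseteq> {\<omega> \<in> space M. \<Psi> t \<omega> \<in> range (\<Phi> t)}"
      proof
        fix \<omega> assume "\<omega> \<in> {\<omega> \<in> space M. (\<lambda>t. \<xi> t \<omega>) \<in> rkbs_space evl}"
        then obtain x where "\<omega> \<in> space M" "(\<lambda>t. \<xi> t \<omega>) = evl x" by (auto simp: rkbs_space_def)
        then have "\<Psi> t \<omega> = \<Phi> t x" unfolding \<Psi>_def \<Phi>_def by (simp add: fun_eq_iff)
        then show "\<omega> \<in> {\<omega> \<in> space M. \<Psi> t \<omega> \<in> range (\<Phi> t)}" using \<open>\<omega> \<in> space M\<close> by blast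
      qed
      \<comment> \<open>Completeness makes this subset of a null set measurable.\<close>
      have "{\<omega> \<in> space M. (\<lambda>t. \<xi> t \<omega>) \<in> rkbs_space evl} \<in> sets M"
        using complete_measure.complete[OF cm sub N] .
      then have "{\<omega> \<in> space M. (\<lambda>t. \<xi> t \<omega>) \<in> rkbs_space evl} \<in> null_sets M" using null_sets_subset[OF N _ sub] by simp
      then show False using nonnull by simp
    qed
    ultimately have "measure M {\<omega> \<in> space M. \<Psi> t \<omega> \<in> range (\<Phi> t)} = 1" by simp
    then show ?thesis using prob_eq_1[OF Bm] by simp
  qed
  obtain t where t: "inj (\<Phi> t)" using rkbs_separating_sequence[OF rk] unfolding \<Phi>_def by blast
  \<comment> \<open>The value 0 is taken on a null set, which is measurable because the range of
    \<open>\<Phi> t\<close> is Borel.\<close>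
  define \<eta> where "\<eta> \<omega> = (if \<Psi> t \<omega> \<in> range (\<Phi> t) then the_inv (\<Phi> t) (\<Psi> t \<omega>) else 0)" for \<omega>
  have \<eta>eq: "\<eta> \<omega> = x" if "\<Psi> t \<omega> = \<Phi> t x" for \<omega> x using that t by (simp add: \<eta>_def the_inv_f_f)
  have "\<eta> \<in> borel_measurable M"
  proof (rule measurableI)
    fix E :: "'x set" assume "E \<in> sets borel"
    then obtain D where D[measurable]: "D \<in> sets borel" and ED: "E = \<Phi> t -` D" using borel_eq_vimage_continuous_inj[OF \<Phi>c t] by blast
    have [measurable]: "range (\<Phi> t) \<in> sets borel" by (rule R[OF t])
    have "\<eta> \<omega> \<in> E \<longleftrightarrow> (\<Psi> t \<omega> \<in> range (\<Phi> t) \<and> \<Psi> t \<omega> \<in> D) \<or> (\<Psi> t \<omega> \<notin> range (\<Phi> t) \<and> 0 \<in> E)" for \<omega>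
    proof (cases "\<Psi> t \<omega> \<in> range (\<Phi> t)")
      case True
      then obtain x where "\<Psi> t \<omega> = \<Phi> t x" by blast
      then show ?thesis using \<eta>eq[of \<omega> x] by (simp add: ED)
    next
      case False then show ?thesis by (simp add: \<eta>_def)
    qed
    then have "\<eta> -` E \<inter> space M = {\<omega> \<in> space M. (\<Psi> t \<omega> \<in> range (\<Phi> t) \<and> \<Psi> t \<omega> \<in> D) \<or> (\<Psi> t \<omega> \<notin> range (\<Phi> t) \<and> 0 \<in> E)}" by auto
    also have "\<dots> \<in> sets M" by measurable
    finally show "\<eta> -` E \<inter> space M \<in> sets M" .
  qed simp
  moreover have "AE \<omega> in M. \<xi> u \<omega> = evl (\<eta> \<omega>) u" for u
  proof -
    \<comment> \<open>With \<open>u\<close> prepended the sequence still separates. Almost surely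
      one element of \<open>X\<close> matches all of its coordinates; those from \<open>t\<close>
      identify it as \<open>\<eta> \<omega>\<close>, and the first one gives the value at
      \<open>u\<close>.\<close>
    define t' where "t' = case_nat u t"
    have "inj (\<Phi> t')"
    proof (rule injI)
      fix x y assume e: "\<Phi> t' x = \<Phi> t' y"
      have "\<Phi> t x n = \<Phi> t y n" for n using fun_cong[OF e, of "Suc n"] by (simp add: \<Phi>_def t'_def)
      then show "x = y" using t by (metis ext injD)
    qed
    from B1[OF this] show ?thesis
    proof eventually_elim
      case (elim \<omega>)
      then obtain x where x: "\<Psi> t' \<omega> = \<Phi> t' x" by blast
      have "\<Psi> t \<omega> n = \<Phi> t x n" for n using fun_cong[OF x, of "Suc n"] by (simp add: \<Phi>_def \<Psi>_def t'_def)
      then have "\<eta> \<omega> = x" using \<eta>eq[of \<omega> x] by blast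
      then show ?case using fun_cong[OF x, of 0] by (simp add: \<Phi>_def \<Psi>_def t'_def)
    qed
  qed
  ultimately show thesis by (rule that)
qed

section \<open>Bounded functionals and Gaussian limits\<close>

text \<open>Equivalence of norms in finite dimension, by induction. If \<open>b\<close> had distance
  zero from the span of \<open>B\<close>, the coefficients of approximating combinations would be
  Cauchy by the induction hypothesis, and their limit would put \<open>b\<close> in the
  span.\<close>

lemma independent_coefficient_bound:
  fixes B :: "'x::real_normed_vector set"
  assumes "finite B" "independent B"
  shows "\<exists>c>0. \<forall>a. c * (\<Sum>b\<in>B. \<bar>a b\<bar>) \<le> norm (\<Sum>b\<in>B. a b *\<^sub>R b)"
  using assms
proof (induction B rule: finite_induct)
  case empty
  then show ?case by (intro exI[of _ 1]) simp
next
  case (insert b B)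
  have ind: "independent B" and nb: "b \<notin> span B" using insert.prems insert.hyps(2) by (auto simp: independent_insert)
  obtain c where c: "c > 0" "\<And>a. c * (\<Sum>b\<in>B. \<bar>a b\<bar>) \<le> norm (\<Sum>b\<in>B. a b *\<^sub>R b)" using insert.IH[OF ind] by blast
  have "\<exists>d>0. \<forall>a. d \<le> norm (b + (\<Sum>b\<in>B. a b *\<^sub>R b))"
  proof (rule ccontr)
    assume "\<not> ?thesis"
    then have "\<exists>a. norm (b + (\<Sum>b\<in>B. a b *\<^sub>R b)) < 1 / real (Suc n)" for n
      by (metis not_le of_nat_0_less_iff zero_less_Suc zero_less_divide_1_iff)
    then obtain a where a: "\<And>n. norm (b + (\<Sum>b\<in>B. a n b *\<^sub>R b)) < 1 / real (Suc n)" by metis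
    have conv: "convergent (\<lambda>n. a n y)" if y: "y \<in> B" for y
    proof (rule Cauchy_convergent, rule metric_CauchyI)
      fix e :: real assume e: "e > 0"
      obtain N where N: "inverse (real (Suc N)) < c * e / 2" using reals_Archimedean[of "c * e / 2"] e c(1) by auto
      have "dist (a m y) (a n y) < e" if mn: "m \<ge> N" "n \<ge> N" for m n
      proof -
        have "c * \<bar>a m y - a n y\<bar> \<le> c * (\<Sum>b\<in>B. \<bar>a m b - a n b\<bar>)"
          using c(1) y insert.hyps(1) by (intro mult_left_mono member_le_sum[of y B "\<lambda>b. \<bar>a m b - a n b\<bar>"]) auto
        also have "\<dots> \<le> norm (\<Sum>b\<in>B. (a m b - a n b) *\<^sub>R b)" by (rule c(2))
        also have "(\<Sum>b\<in>B. (a m b - a n b) *\<^sub>R b) = (b + (\<Sum>b\<in>B. a m b *\<^sub>R b)) - (b + (\<Sum>b\<in>B. a n b *\<^sub>R b))"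
          by (simp add: scaleR_diff_left sum_subtractf)
        also have "norm \<dots> \<le> norm (b + (\<Sum>b\<in>B. a m b *\<^sub>R b)) + norm (b + (\<Sum>b\<in>B. a n b *\<^sub>R b))" by (rule norm_triangle_ineq4)
        also have "\<dots> < 1 / real (Suc m) + 1 / real (Suc n)" by (intro add_strict_mono a)
        also have "\<dots> \<le> 1 / real (Suc N) + 1 / real (Suc N)" using mn by (intro add_mono divide_left_mono) auto
        also have "\<dots> < c * e" using N by (simp add: inverse_eq_divide)
        finally show ?thesis using c(1) by (simp add: dist_real_def)
      qed
      then show "\<exists>M. \<forall>m\<ge>M. \<forall>n\<ge>M. dist (a m y) (a n y) < e" by blast
    qed
    define l where "l y = lim (\<lambda>n. a n y)" for y
    have l: "(\<lambda>n. a n y) \<longlonglongrightarrow> l y" if "y \<in> B" for y using conv[OF that] by (simp add: l_def convergent_LIMSEQ_iff)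
    have "(\<lambda>n. b + (\<Sum>b\<in>B. a n b *\<^sub>R b)) \<longlonglongrightarrow> b + (\<Sum>b\<in>B. l b *\<^sub>R b)"
      by (intro tendsto_intros l)
    moreover have "(\<lambda>n. b + (\<Sum>b\<in>B. a n b *\<^sub>R b)) \<longlonglongrightarrow> 0"
    proof (rule Lim_null_comparison)
      show "(\<lambda>n. 1 / real (Suc n)) \<longlonglongrightarrow> 0" using LIMSEQ_inverse_real_of_nat by (simp add: inverse_eq_divide)
      show "\<forall>\<^sub>F n in sequentially. norm (b + (\<Sum>b\<in>B. a n b *\<^sub>R b)) \<le> 1 / real (Suc n)"
        by (intro always_eventually allI less_imp_le a)
    qed
    ultimately have "b + (\<Sum>b\<in>B. l b *\<^sub>R b) = 0" by (rule LIMSEQ_unique)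
    then have "b = - (\<Sum>b\<in>B. l b *\<^sub>R b)" by (simp add: eq_neg_iff_add_eq_0)
    also have "\<dots> \<in> span B" by (intro span_neg span_sum span_scale span_base)
    finally show False using nb by simp
  qed
  then obtain d where d: "d > 0" "\<And>a. d \<le> norm (b + (\<Sum>b\<in>B. a b *\<^sub>R b))" by blast
  have d': "d * \<bar>s\<bar> \<le> norm (s *\<^sub>R b + (\<Sum>b\<in>B. a b *\<^sub>R b))" for s a
  proof (cases "s = 0")
    case False
    have "s *\<^sub>R b + (\<Sum>b\<in>B. a b *\<^sub>R b) = s *\<^sub>R (b + (\<Sum>b\<in>B. (a b / s) *\<^sub>R b))"
      using False by (simp add: scaleR_add_right scaleR_sum_right)
    then show ?thesis using mult_left_mono[OF d(2)[of "\<lambda>b. a b / s"], of "\<bar>s\<bar>"] by (simp add: mult.commute)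
  qed simp
  \<comment> \<open>The first term bounds the coefficient of \<open>b\<close> relative to the norm
    of the whole combination. The second bounds the other coefficients, after the multiple of
    \<open>b\<close> is subtracted.\<close>
  define q where "q = 1 / d + (1 + norm b / d) / c"
  have q: "q > 0" unfolding q_def using c d by (intro add_pos_nonneg) auto
  have "(1 / q) * (\<Sum>b\<in>insert b B. \<bar>a b\<bar>) \<le> norm (\<Sum>b\<in>insert b B. a b *\<^sub>R b)" for a
  proof -
    define w where "w = a b *\<^sub>R b + (\<Sum>b\<in>B. a b *\<^sub>R b)"
    have 1: "\<bar>a b\<bar> \<le> norm w / d" using d'[of "a b" a] d(1) by (simp add: w_def field_simps)
    have "norm (\<Sum>b\<in>B. a b *\<^sub>R b) \<le> norm w + \<bar>a b\<bar> * norm b"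
      using norm_triangle_ineq4[of w "a b *\<^sub>R b"] by (simp add: w_def)
    also have "\<dots> \<le> norm w + norm w / d * norm b" using 1 by (intro add_left_mono mult_right_mono) auto
    finally have "c * (\<Sum>b\<in>B. \<bar>a b\<bar>) \<le> norm w * (1 + norm b / d)" using c(2)[of a] by (simp add: algebra_simps)
    then have "(\<Sum>b\<in>B. \<bar>a b\<bar>) \<le> norm w * ((1 + norm b / d) / c)" using c(1) by (simp add: pos_le_divide_eq mult.commute)
    then have "\<bar>a b\<bar> + (\<Sum>b\<in>B. \<bar>a b\<bar>) \<le> norm w * q" using 1 by (simp add: q_def distrib_left)
    then have "(\<Sum>b\<in>insert b B. \<bar>a b\<bar>) \<le> norm (\<Sum>b\<in>insert b B. a b *\<^sub>R b) * q"
      using insert.hyps by (simp add: w_def)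
    then show ?thesis using q by (simp add: pos_divide_le_eq)
  qed
  then show ?case using q by (intro exI[of _ "1/q"]) auto
qed

context function_hilbert begin

text \<open>Parseval's identity becomes an inequality, since coefficients of zero vectors are
  lost.\<close>

lemma ip_lin_comb_orthonormal_or_zero:
  assumes D: "orthonormal_or_zero D e"
  shows "ip (lin_comb D a e) (lin_comb D a e) \<le> (\<Sum>k\<in>D. (a k)\<^sup>2)"
proof -
  have fD: "finite D" and eH: "\<And>k. k \<in> D \<Longrightarrow> e k \<in> H" using D by (auto simp: orthonormal_or_zero_def)
  have "ip (lin_comb D a e) (lin_comb D a e) = (\<Sum>k\<in>D. a k * ip (e k) (lin_comb D a e))" using fD eH by (intro ip_lin_comb_left lin_comb_in) auto
  also have "\<dots> \<le> (\<Sum>k\<in>D. (a k)\<^sup>2)"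
  proof (rule sum_mono)
    fix k assume k: "k \<in> D"
    have "ip (e k) (lin_comb D a e) = (\<Sum>j\<in>D. a j * ip (e k) (e j))" using fD eH k by (intro ip_lin_comb_right) auto
    also have "\<dots> = (\<Sum>j\<in>D. if j = k then a k * ip (e k) (e k) else 0)"
      using D k by (intro sum.cong) (auto simp: orthonormal_or_zero_def)
    also have "\<dots> = a k * ip (e k) (e k)" using fD k by simp
    finally have e: "a k * ip (e k) (lin_comb D a e) = (a k)\<^sup>2 * ip (e k) (e k)" by (simp add: power2_eq_square)
    have "ip (e k) (e k) = 0 \<or> ip (e k) (e k) = 1" using D k by (simp add: orthonormal_or_zero_def)
    then show "a k * ip (e k) (lin_comb D a e) \<le> (a k)\<^sup>2" unfolding e by auto
  qed
  finally show ?thesis .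
qed

text \<open>Bessel's inequality for a bounded functional without a representing vector. With
  \<open>s\<close> the sum of squares, the functional takes the value \<open>s\<close> at the
  combination with coefficients \<open>f (e k)\<close>, whose norm is at most \<open>sqrt s\<close>;
  hence \<open>s \<le> L * sqrt s\<close>.\<close>

lemma Bessel_functional:
  assumes D: "orthonormal_or_zero D e" and add: "\<And>x y. x \<in> H \<Longrightarrow> y \<in> H \<Longrightarrow> f (\<lambda>s. x s + y s) = f x + f y"
    and scale: "\<And>c x. x \<in> H \<Longrightarrow> f (\<lambda>s. c * x s) = c * f x"
    and bd: "\<And>x. x \<in> H \<Longrightarrow> \<bar>f x\<bar> \<le> L * sqrt (ip x x)"
  shows "(\<Sum>k\<in>D. (f (e k))\<^sup>2) \<le> (L :: real)\<^sup>2"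
proof -
  have fD: "finite D" and eH: "\<And>k. k \<in> D \<Longrightarrow> e k \<in> H" using D by (auto simp: orthonormal_or_zero_def)
  have f0: "f (\<lambda>s. 0) = 0" using scale[OF zero_in, of 0] by simp
  have flc: "f (lin_comb F a e) = (\<Sum>k\<in>F. a k * f (e k))" if "F \<subseteq> D" for F a
    using finite_subset[OF that fD] that
  proof (induction F rule: finite_induct)
    case empty then show ?case by (simp add: lin_comb_def f0)
  next
    case (insert k F)
    have e: "lin_comb (insert k F) a e = (\<lambda>s. a k * e k s + lin_comb F a e s)" using insert.hyps by (auto simp: lin_comb_def)
    have "lin_comb F a e \<in> H" using insert eH by (intro lin_comb_in) auto
    then have "f (lin_comb (insert k F) a e) = a k * f (e k) + f (lin_comb F a e)"
      unfolding e using insert.prems eH by (simp add: add scale scale_in)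
    then show ?case using insert by simp
  qed
  define s where "s = (\<Sum>k\<in>D. (f (e k))\<^sup>2)"
  have s0: "s \<ge> 0" unfolding s_def by (simp add: sum_nonneg)
  have "s = f (lin_comb D (\<lambda>k. f (e k)) e)" unfolding flc[OF order_refl] s_def by (simp add: power2_eq_square)
  also have "\<dots> \<le> L * sqrt (ip (lin_comb D (\<lambda>k. f (e k)) e) (lin_comb D (\<lambda>k. f (e k)) e))"
    using bd[OF lin_comb_in[where a="\<lambda>k. f (e k)" and v=e, OF fD eH]] by simp
  finally have 1: "s \<le> L * sqrt (ip (lin_comb D (\<lambda>k. f (e k)) e) (lin_comb D (\<lambda>k. f (e k)) e))" .
  have "s\<^sup>2 \<le> L\<^sup>2 * ip (lin_comb D (\<lambda>k. f (e k)) e) (lin_comb D (\<lambda>k. f (e k)) e)"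
    using power_mono[OF 1 s0, of 2] ip_nonneg[OF lin_comb_in[where a="\<lambda>k. f (e k)" and v=e, OF fD eH]] by (simp add: power_mult_distrib)
  also have "\<dots> \<le> L\<^sup>2 * s" unfolding s_def by (intro mult_left_mono ip_lin_comb_orthonormal_or_zero D) simp
  finally have "s * s \<le> L\<^sup>2 * s" by (simp add: power2_eq_square)
  then have "s \<le> L\<^sup>2" using s0 by (cases "s = 0") auto
  then show ?thesis by (simp add: s_def)
qed

lemma tail_small_of_bounded:
  fixes f :: "nat \<Rightarrow> real"
  assumes "\<And>k. 0 \<le> f k" "\<And>m. (\<Sum>k<m. f k) \<le> C" "\<epsilon> > 0"
  shows "\<exists>l. \<forall>l'\<ge>l. \<forall>m. (\<Sum>k=l'..<m. f k) < \<epsilon>"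
proof -
  have "summable f" by (rule summableI_nonneg_bounded[where x=C]) (use assms in auto)
  then obtain N where N: "\<And>m n. m \<ge> N \<Longrightarrow> norm (sum f {m..<n}) < \<epsilon>"
    using \<open>\<epsilon> > 0\<close> unfolding summable_Cauchy by blast
  have "(\<Sum>k=l'..<m. f k) < \<epsilon>" if "l' \<ge> N" for l' m using N[OF that, of m] by simp
  then show ?thesis by blast
qed

text \<open>Bessel's inequality makes the partial projections Cauchy. Their limit has the same
  coefficients as \<open>x\<close>, and totality identifies it with \<open>x\<close>.\<close>

lemma proj_converges:
  assumes e: "\<And>D. finite D \<Longrightarrow> orthonormal_or_zero D (e :: nat \<Rightarrow> _)" and x: "x \<in> H"
    and total: "\<And>y. y \<in> H \<Longrightarrow> (\<And>k. ip y (e k) = 0) \<Longrightarrow> y = (\<lambda>s. 0)"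
  shows "(\<lambda>m. ip (\<lambda>s. proj {..<m} e x s - x s) (\<lambda>s. proj {..<m} e x s - x s)) \<longlonglongrightarrow> 0"
proof -
  have eH: "e k \<in> H" for k using orthonormal_or_zero_in[OF e[of "{k}"]] by simp
  have P: "proj {..<m} e x \<in> H" for m by (intro proj_in e) simp
  have bes: "(\<Sum>k<m. (ip x (e k))\<^sup>2) \<le> ip x x" for m
  proof -
    have "(\<Sum>k<m. (ip x (e k))\<^sup>2) \<le> (sqrt (ip x x))\<^sup>2"
    proof (rule Bessel_functional[where f="ip x" and e=e])
      fix h assume h: "h \<in> H"
      have "\<bar>ip x h\<bar> \<le> sqrt (ip x x * ip h h)" using ip_Cauchy_Schwarz[OF x h] by (intro real_le_rsqrt) simp
      then show "\<bar>ip x h\<bar> \<le> sqrt (ip x x) * sqrt (ip h h)" by (simp add: real_sqrt_mult)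
    qed (use e x in \<open>auto simp: ip_add_right ip_scale_right\<close>)
    then show ?thesis using ip_nonneg[OF x] by simp
  qed
  have pd: "ip (\<lambda>s. proj {..<m} e x s - proj {..<l} e x s) (\<lambda>s. proj {..<m} e x s - proj {..<l} e x s) \<le> (\<Sum>k=l..<m. (ip x (e k))\<^sup>2)"
    if "l \<le> m" for l m
  proof -
    have "(\<lambda>s. proj {..<m} e x s - proj {..<l} e x s) = lin_comb {l..<m} (\<lambda>k. ip x (e k)) e"
      unfolding proj_def lin_comb_def using sum_diff_nat_ivl[of 0 l m] that by (auto simp: lessThan_atLeast0)
    then show ?thesis using ip_lin_comb_orthonormal_or_zero[OF e[of "{l..<m}"], of "\<lambda>k. ip x (e k)"] by simp
  qed
  have "\<exists>N. \<forall>m\<ge>N. \<forall>n\<ge>N. ip (\<lambda>s. proj {..<m} e x s - proj {..<n} e x s) (\<lambda>s. proj {..<m} e x s - proj {..<n} e x s) < \<epsilon>" if \<epsilon>: "\<epsilon> > 0" for \<epsilon>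
  proof -
    obtain N where N: "\<And>l m. l \<ge> N \<Longrightarrow> (\<Sum>k=l..<m. (ip x (e k))\<^sup>2) < \<epsilon>"
      using tail_small_of_bounded[of "\<lambda>k. (ip x (e k))\<^sup>2" "ip x x" \<epsilon>] bes \<epsilon> by auto
    have "ip (\<lambda>s. proj {..<m} e x s - proj {..<n} e x s) (\<lambda>s. proj {..<m} e x s - proj {..<n} e x s) < \<epsilon>" if mn: "m \<ge> N" "n \<ge> N" for m n
    proof (cases "n \<le> m")
      case True
      then show ?thesis using pd[OF True] N[OF mn(2), of m] by simp
    next
      case False
      define a b where "a = proj {..<m} e x" and "b = proj {..<n} e x"
      have ab: "a \<in> H" "b \<in> H" unfolding a_def b_def by (rule P)+
      have "ip (\<lambda>s. a s - b s) (\<lambda>s. a s - b s) = ip (\<lambda>s. b s - a s) (\<lambda>s. b s - a s)"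
        using ab by (simp add: ip_diff_left ip_diff_right diff_in)
      then show ?thesis using pd[of m n] N[OF mn(1), of n] False unfolding a_def b_def by simp
    qed
    then show ?thesis by blast
  qed
  from complete[OF P this] obtain y where y: "y \<in> H" and ly: "(\<lambda>m. ip (\<lambda>s. proj {..<m} e x s - y s) (\<lambda>s. proj {..<m} e x s - y s)) \<longlonglongrightarrow> 0" by auto
  have "ip y (e k) = ip x (e k)" for k
  proof -
    have "(\<lambda>m. ip (proj {..<m} e x) (e k)) \<longlonglongrightarrow> ip y (e k)" by (rule ip_tendsto[OF P y eH ly])
    moreover have "(\<lambda>m. ip (proj {..<m} e x) (e k)) \<longlonglongrightarrow> ip x (e k)"
    proof (rule tendsto_eventually, rule eventually_sequentiallyI)
      fix m assume "m \<ge> Suc k"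
      then show "ip (proj {..<m} e x) (e k) = ip x (e k)" by (intro ip_proj_basis e x) auto
    qed
    ultimately show ?thesis by (rule LIMSEQ_unique)
  qed
  then have "(\<lambda>s. y s - x s) = (\<lambda>s. 0)" using x y eH by (intro total diff_in) (auto simp: ip_diff_left)
  then have "y = x" by (simp add: fun_eq_iff)
  then show ?thesis using ly by simp
qed

end

text \<open>Variances and characteristic functions both pass to the mean square limit, so the limit
  has the Gaussian characteristic function of its own variance, which may be zero.\<close>

lemma (in isonormal) L2_limit_centered_gaussian:
  assumes h: "\<And>n. h n \<in> H" and [measurable]: "Y \<in> borel_measurable M"
    and int: "\<And>n. integrable M (\<lambda>\<omega>. (Z (h n) \<omega> - Y \<omega>)\<^sup>2)"
    and lim: "(\<lambda>n. \<integral>\<omega>. (Z (h n) \<omega> - Y \<omega>)\<^sup>2 \<partial>M) \<longlonglongrightarrow> 0"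
  shows "centered_gaussian_rv M Y"
proof (rule centered_gaussian_rv_of_char)
  let ?v = "\<integral>\<omega>. (Y \<omega>)\<^sup>2 \<partial>M"
  show "?v \<ge> 0" by simp
  have iY: "integrable M (\<lambda>\<omega>. (Y \<omega>)\<^sup>2)"
    using integrable_norm_sq_diff(1)[of "Z (h 0)" M "\<lambda>\<omega>. Z (h 0) \<omega> - Y \<omega>"] int[of 0] Z_sq[OF h, of 0] by simp
  have lv: "(\<lambda>n. ip (h n) (h n)) \<longlonglongrightarrow> ?v"
  proof (rule tendsto_of_square_perturbation[OF lim])
    fix n
    show "(\<integral>\<omega>. Y \<omega> * (Z (h n) \<omega> - Y \<omega>) \<partial>M)\<^sup>2 \<le> ?v * (\<integral>\<omega>. (Z (h n) \<omega> - Y \<omega>)\<^sup>2 \<partial>M)"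
      by (rule integral_product_Cauchy_Schwarz) (simp_all add: iY int)
    have p: "integrable M (\<lambda>\<omega>. Y \<omega> * (Z (h n) \<omega> - Y \<omega>))"
      by (rule product_integrable_of_squares) (simp_all add: iY int)
    have "ip (h n) (h n) = (\<integral>\<omega>. (Y \<omega>)\<^sup>2 + 2 * (Y \<omega> * (Z (h n) \<omega> - Y \<omega>)) + (Z (h n) \<omega> - Y \<omega>)\<^sup>2 \<partial>M)"
      unfolding Z_ip[OF h h, symmetric]
      by (intro Bochner_Integration.integral_cong) (auto simp: power2_eq_square algebra_simps)
    also have "\<dots> = ?v + 2 * (\<integral>\<omega>. Y \<omega> * (Z (h n) \<omega> - Y \<omega>) \<partial>M) + (\<integral>\<omega>. (Z (h n) \<omega> - Y \<omega>)\<^sup>2 \<partial>M)"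
      using iY p int[of n] by simp
    finally show "ip (h n) (h n) = ?v + 2 * (\<integral>\<omega>. Y \<omega> * (Z (h n) \<omega> - Y \<omega>) \<partial>M) + (\<integral>\<omega>. (Z (h n) \<omega> - Y \<omega>)\<^sup>2 \<partial>M)" .
  qed
  fix s :: real
  have c: "(CLINT \<omega>|M. iexp (s * Z (h n) \<omega>)) = of_real (exp (- (s\<^sup>2 * ip (h n) (h n)) / 2))" for n
  proof -
    \<comment> \<open>A family with one member gives the characteristic function of a multiple of
      \<open>Z (h n)\<close>, which agrees with \<open>Z\<close> of the multiple only almost
      surely.\<close>
    have "gauss_family M (\<lambda>_::unit. Z (h n)) (\<lambda>_ _. ip (h n) (h n))"
      by (rule gauss_family_Z[OF h]) simp_all
    then have "(CLINT \<omega>|M. iexp (\<Sum>i\<in>{()}. s * Z (h n) \<omega>)) = of_real (exp (- (\<Sum>i\<in>{()}. \<Sum>j\<in>{()}. s * s * ip (h n) (h n)) / 2))"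
      unfolding gauss_family_def by (elim conjE allE[of _ "{()}"] allE[of _ "\<lambda>_. s"] impE) simp_all
    then show ?thesis by (simp add: power2_eq_square)
  qed
  have e2: "(s * Z (h n) \<omega> - s * Y \<omega>)\<^sup>2 = s\<^sup>2 * (Z (h n) \<omega> - Y \<omega>)\<^sup>2" for n \<omega>
    by (simp add: power2_eq_square algebra_simps)
  have "(\<lambda>n. CLINT \<omega>|M. iexp (s * Z (h n) \<omega>)) \<longlonglongrightarrow> (CLINT \<omega>|M. iexp (s * Y \<omega>))"
  proof (rule char_tendsto_L2)
    show "integrable M (\<lambda>\<omega>. (s * Z (h n) \<omega> - s * Y \<omega>)\<^sup>2)" for n unfolding e2 using int by simp
    show "(\<lambda>n. \<integral>\<omega>. (s * Z (h n) \<omega> - s * Y \<omega>)\<^sup>2 \<partial>M) \<longlonglongrightarrow> 0"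
      unfolding e2 using tendsto_mult_left[OF lim, of "s\<^sup>2"] by simp
  qed measurable
  moreover have "(\<lambda>n. CLINT \<omega>|M. iexp (s * Z (h n) \<omega>)) \<longlonglongrightarrow> of_real (exp (- (s\<^sup>2 * ?v) / 2))"
    unfolding c by (intro tendsto_intros lv) simp
  ultimately show "(CLINT \<omega>|M. iexp (s * Y \<omega>)) = of_real (exp (- (s\<^sup>2 * ?v) / 2))" by (rule LIMSEQ_unique)
qed simp

section \<open>Construction of the random element\<close>

text \<open>Reduces a finite-rank operator to finitely many scalar functionals. They are bounded
  because the coefficients in an independent set are controlled by the norm.\<close>

lemma (in function_hilbert) finite_rank_coordinates:
  fixes F :: "('t \<Rightarrow> real) \<Rightarrow> 'x::real_normed_vector"
  assumes bo: "bounded_operator_on H ip F" and fr: "finite_rank_on H F"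
  obtains B a L where "finite B" "\<And>h. h \<in> H \<Longrightarrow> F h = (\<Sum>b\<in>B. a b h *\<^sub>R b)"
    "\<And>b x y. x \<in> H \<Longrightarrow> y \<in> H \<Longrightarrow> a b (\<lambda>s. x s + y s) = a b x + a b y"
    "\<And>b c x. x \<in> H \<Longrightarrow> a b (\<lambda>s. c * x s) = c * a b x"
    "\<And>b h. b \<in> B \<Longrightarrow> h \<in> H \<Longrightarrow> \<bar>a b h\<bar> \<le> L * sqrt (ip h h)"
proof -
  obtain B' where B': "finite B'" "F ` H \<subseteq> span B'" using fr by (auto simp: finite_rank_on_def)
  obtain B where B: "B \<subseteq> B'" "independent B" "B' \<subseteq> span B" by (rule maximal_independent_subset[of B'])
  have fB: "finite B" using B(1) B'(1) by (rule finite_subset)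
  have sp: "F h \<in> span B" if "h \<in> H" for h
  proof -
    have "span B' \<subseteq> span B" using B(3) by (intro span_minimal) auto
    then show ?thesis using B'(2) that by blast
  qed
  obtain C where add: "\<And>x y. x \<in> H \<Longrightarrow> y \<in> H \<Longrightarrow> F (\<lambda>s. x s + y s) = F x + F y"
    and scale: "\<And>c x. x \<in> H \<Longrightarrow> F (\<lambda>s. c * x s) = c *\<^sub>R F x" and C: "\<And>x. x \<in> H \<Longrightarrow> norm (F x) \<le> C * ip_norm ip x"
    using bo unfolding bounded_operator_on_def by blast
  obtain c where c: "c > 0" "\<And>a. c * (\<Sum>b\<in>B. \<bar>a b\<bar>) \<le> norm (\<Sum>b\<in>B. a b *\<^sub>R b)"
    using independent_coefficient_bound[OF fB B(2)] by blast
  define a where "a b h = representation B (F h) b" for b h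
  have rep: "(\<Sum>b\<in>B. a b h *\<^sub>R b) = F h" if "h \<in> H" for h
    unfolding a_def by (rule sum_representation_eq[OF B(2) sp[OF that] fB order_refl])
  show thesis
  proof (rule that[OF fB rep[symmetric]])
    show "a b (\<lambda>s. x s + y s) = a b x + a b y" if "x \<in> H" "y \<in> H" for b x y
      unfolding a_def add[OF that] by (simp add: representation_add[OF B(2) sp[OF that(2)] sp[OF that(1)]])
    show "a b (\<lambda>s. c * x s) = c * a b x" if "x \<in> H" for b c x
      unfolding a_def scale[OF that] by (simp add: representation_scale[OF B(2) sp[OF that]])
    show "\<bar>a b h\<bar> \<le> (C / c) * sqrt (ip h h)" if "b \<in> B" "h \<in> H" for b h
    proof -
      have "c * \<bar>a b h\<bar> \<le> c * (\<Sum>b\<in>B. \<bar>a b h\<bar>)"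
        using c(1) that(1) fB by (intro mult_left_mono member_le_sum[of b B "\<lambda>b. \<bar>a b h\<bar>"]) auto
      also have "\<dots> \<le> norm (F h)" using c(2)[of "\<lambda>b. a b h"] rep[OF that(2)] by simp
      also have "\<dots> \<le> C * sqrt (ip h h)" using C[OF that(2)] by (simp add: ip_norm_def)
      finally show ?thesis using c(1) by (simp add: pos_le_divide_eq mult.commute)
    qed
  qed
qed

context isonormal_banach begin

text \<open>By Bessel's inequality each coordinate functional is square summable along
  \<open>e\<close>. The mean square of a partial sum is at most a constant times the matching
  partial sum of these squares, so its tails vanish.\<close>

lemma finite_rank_tail:
  fixes F :: "('t \<Rightarrow> real) \<Rightarrow> 'x"
  assumes e: "\<And>D. finite D \<Longrightarrow> orthonormal_or_zero D (e :: nat \<Rightarrow> _)"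
    and bo: "bounded_operator_on H ip F" and fr: "finite_rank_on H F" and \<epsilon>: "\<epsilon> > 0"
  shows "\<exists>l. \<forall>l'\<ge>l. \<forall>m. (\<integral>\<omega>. (norm (\<Sum>k=l'..<m. Z (e k) \<omega> *\<^sub>R F (e k)))\<^sup>2 \<partial>M) < \<epsilon>"
proof -
  have eH: "e k \<in> H" for k using orthonormal_or_zero_in[OF e[of "{k}"]] by simp
  obtain B a L where B: "finite B" and F: "\<And>h. h \<in> H \<Longrightarrow> F h = (\<Sum>b\<in>B. a b h *\<^sub>R b)"
    and a: "\<And>b x y. x \<in> H \<Longrightarrow> y \<in> H \<Longrightarrow> a b (\<lambda>s. x s + y s) = a b x + a b y"
      "\<And>b c x. x \<in> H \<Longrightarrow> a b (\<lambda>s. c * x s) = c * a b x"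
      "\<And>b h. b \<in> B \<Longrightarrow> h \<in> H \<Longrightarrow> \<bar>a b h\<bar> \<le> L * sqrt (ip h h)"
    by (rule finite_rank_coordinates[OF bo fr]) (rule that; assumption)
  define N where "N = (\<Sum>b\<in>B. (norm b)\<^sup>2)"
  have N0: "N \<ge> 0" unfolding N_def by (simp add: sum_nonneg)
  define f where "f k = (\<Sum>b\<in>B. (a b (e k))\<^sup>2)" for k
  have f0: "f k \<ge> 0" for k unfolding f_def by (simp add: sum_nonneg)
  have fb: "(\<Sum>k<m. f k) \<le> real (card B) * L\<^sup>2" for m
  proof -
    have "(\<Sum>k<m. f k) = (\<Sum>b\<in>B. \<Sum>k<m. (a b (e k))\<^sup>2)" unfolding f_def by (rule sum.swap)
    also have "\<dots> \<le> (\<Sum>b\<in>B. L\<^sup>2)"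
    proof (rule sum_mono)
      fix b assume "b \<in> B"
      then show "(\<Sum>k<m. (a b (e k))\<^sup>2) \<le> L\<^sup>2"
        by (intro Bessel_functional[where f="a b" and e=e] e a) auto
    qed
    finally show ?thesis by simp
  qed
  have main: "(\<integral>\<omega>. (norm (\<Sum>k\<in>D. Z (e k) \<omega> *\<^sub>R F (e k)))\<^sup>2 \<partial>M) \<le> N * (\<Sum>k\<in>D. f k)" if D: "finite D" for D
  proof -
    define Y where "Y b \<omega> = (\<Sum>k\<in>D. a b (e k) * Z (e k) \<omega>)" for b \<omega>
    have [measurable]: "Y b \<in> borel_measurable M" for b unfolding Y_def by measurable
    have lcH: "lin_comb D (\<lambda>k. a b (e k)) e \<in> H" for b using D eH by (intro lin_comb_in) auto
    have YZ: "AE \<omega> in M. Z (lin_comb D (\<lambda>k. a b (e k)) e) \<omega> = Y b \<omega>" for b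
      unfolding Y_def using D eH by (intro Z_lin_comb) auto
    have iY: "integrable M (\<lambda>\<omega>. (Y b \<omega>)\<^sup>2)" for b
      using Z_sq[OF lcH[of b]] by (rule integrable_cong_AE_imp) (use YZ[of b] in \<open>auto elim!: eventually_mono\<close>)
    have eY: "(\<integral>\<omega>. (Y b \<omega>)\<^sup>2 \<partial>M) \<le> (\<Sum>k\<in>D. (a b (e k))\<^sup>2)" for b
    proof -
      have "(\<integral>\<omega>. (Y b \<omega>)\<^sup>2 \<partial>M) = (\<integral>\<omega>. Z (lin_comb D (\<lambda>k. a b (e k)) e) \<omega> * Z (lin_comb D (\<lambda>k. a b (e k)) e) \<omega> \<partial>M)"
        by (rule integral_cong_AE) (use YZ[of b] in \<open>auto elim!: eventually_mono simp: power2_eq_square\<close>)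
      then show ?thesis using Z_ip[OF lcH[of b] lcH[of b]] ip_lin_comb_orthonormal_or_zero[OF e[OF D], of "\<lambda>k. a b (e k)"] by simp
    qed
    have b: "(norm (\<Sum>k\<in>D. Z (e k) \<omega> *\<^sub>R F (e k)))\<^sup>2 \<le> (\<Sum>b\<in>B. (Y b \<omega>)\<^sup>2) * N" for \<omega>
    proof -
      have "(\<Sum>k\<in>D. Z (e k) \<omega> *\<^sub>R F (e k)) = (\<Sum>k\<in>D. \<Sum>b\<in>B. (a b (e k) * Z (e k) \<omega>) *\<^sub>R b)"
        by (simp add: F[OF eH] scaleR_sum_right mult.commute)
      also have "\<dots> = (\<Sum>b\<in>B. \<Sum>k\<in>D. (a b (e k) * Z (e k) \<omega>) *\<^sub>R b)" by (rule sum.swap)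
      also have "\<dots> = (\<Sum>b\<in>B. Y b \<omega> *\<^sub>R b)" unfolding Y_def by (simp add: scaleR_sum_left)
      finally have "norm (\<Sum>k\<in>D. Z (e k) \<omega> *\<^sub>R F (e k)) \<le> (\<Sum>b\<in>B. \<bar>Y b \<omega>\<bar> * norm b)"
        using norm_sum[of "\<lambda>b. Y b \<omega> *\<^sub>R b" B] by simp
      then have "(norm (\<Sum>k\<in>D. Z (e k) \<omega> *\<^sub>R F (e k)))\<^sup>2 \<le> (\<Sum>b\<in>B. \<bar>Y b \<omega>\<bar> * norm b)\<^sup>2" by (intro power_mono) auto
      also have "\<dots> \<le> (\<Sum>b\<in>B. \<bar>Y b \<omega>\<bar>\<^sup>2) * (\<Sum>b\<in>B. (norm b)\<^sup>2)" by (rule Cauchy_Schwarz_ineq_sum)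
      finally show ?thesis by (simp add: N_def)
    qed
    have "(\<integral>\<omega>. (norm (\<Sum>k\<in>D. Z (e k) \<omega> *\<^sub>R F (e k)))\<^sup>2 \<partial>M) \<le> (\<integral>\<omega>. (\<Sum>b\<in>B. (Y b \<omega>)\<^sup>2) * N \<partial>M)"
      by (rule integral_mono[OF integrable_sum_Z[OF D eH] _ b]) (use iY in simp)
    also have "\<dots> = (\<Sum>b\<in>B. \<integral>\<omega>. (Y b \<omega>)\<^sup>2 \<partial>M) * N" using iY by simp
    also have "\<dots> \<le> (\<Sum>b\<in>B. \<Sum>k\<in>D. (a b (e k))\<^sup>2) * N" by (intro mult_right_mono sum_mono eY N0)
    also have "(\<Sum>b\<in>B. \<Sum>k\<in>D. (a b (e k))\<^sup>2) = (\<Sum>k\<in>D. f k)" unfolding f_def by (rule sum.swap)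
    finally show ?thesis by (simp add: mult.commute)
  qed
  \<comment> \<open>\<open>N\<close> vanishes if the operator is zero, hence the shift by 1.\<close>
  have "\<epsilon> / (N + 1) > 0" using \<epsilon> N0 by simp
  from tail_small_of_bounded[of f, OF f0 fb this] obtain l where l: "\<And>l' m. l' \<ge> l \<Longrightarrow> (\<Sum>k=l'..<m. f k) < \<epsilon> / (N + 1)" by auto
  have "(\<integral>\<omega>. (norm (\<Sum>k=l'..<m. Z (e k) \<omega> *\<^sub>R F (e k)))\<^sup>2 \<partial>M) < \<epsilon>" if "l' \<ge> l" for l' m
  proof -
    have "(\<integral>\<omega>. (norm (\<Sum>k=l'..<m. Z (e k) \<omega> *\<^sub>R F (e k)))\<^sup>2 \<partial>M) \<le> N * (\<Sum>k=l'..<m. f k)" by (rule main) simp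
    also have "\<dots> \<le> (N + 1) * (\<Sum>k=l'..<m. f k)" by (intro mult_right_mono sum_nonneg f0) simp
    also have "\<dots> < \<epsilon>" using l[OF that, of m] N0 by (simp add: pos_less_divide_eq mult.commute)
    finally show ?thesis .
  qed
  then show ?thesis by blast
qed

text \<open>Zero vectors contribute nothing to the sum. After discarding them and renumbering, an
  orthonormal system remains.\<close>

lemma gamma_values_bound_orthonormal_or_zero:
  fixes A :: "('t \<Rightarrow> real) \<Rightarrow> 'x"
  assumes bdd: "bdd_above (gamma_values H ip A)" and D: "orthonormal_or_zero D (e :: nat \<Rightarrow> _)" and A0: "A (\<lambda>s. 0) = 0"
  shows "(\<integral>\<omega>. (norm (\<Sum>k\<in>D. Z (e k) \<omega> *\<^sub>R A (e k)))\<^sup>2 \<partial>M) \<le> (gamma_norm H ip A)\<^sup>2"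
proof -
  define D' where "D' = {k\<in>D. ip (e k) (e k) = 1}"
  have fD: "finite D" "finite D'" and eH: "\<And>k. k \<in> D \<Longrightarrow> e k \<in> H" using D by (auto simp: orthonormal_or_zero_def D'_def)
  have z: "A (e k) = 0" if "k \<in> D - D'" for k
  proof -
    have "ip (e k) (e k) = 0" using that D unfolding orthonormal_or_zero_def D'_def by auto
    then have "e k = (\<lambda>s. 0)" using that by (intro ip_eq_0 eH) auto
    then show ?thesis using A0 by simp
  qed
  obtain g where g: "bij_betw g {..<card D'} D'" using ex_bij_betw_nat_finite[OF fD(2)] by (auto simp: lessThan_atLeast0)
  define h where "h j = e (g j)" for j
  have "orthonormal_system H ip (card D') h" unfolding orthonormal_system_def
  proof (intro conjI allI impI)
    fix j assume j: "j < card D'"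
    have gj: "g j \<in> D'" using g j by (auto simp: bij_betw_def)
    show "h j \<in> H" unfolding h_def using gj by (intro eH) (simp add: D'_def)
    fix k assume k: "k < card D'"
    have gk: "g k \<in> D'" using g k by (auto simp: bij_betw_def)
    have "g j = g k \<longleftrightarrow> j = k" using g j k by (auto simp: bij_betw_def inj_on_def)
    then show "ip (h j) (h k) = (if j = k then 1 else 0)"
      using gj gk D unfolding h_def D'_def orthonormal_or_zero_def by auto
  qed
  from gamma_values_bound[OF bdd this] have "(\<integral>\<omega>. (norm (\<Sum>j<card D'. Z (h j) \<omega> *\<^sub>R A (h j)))\<^sup>2 \<partial>M) \<le> (gamma_norm H ip A)\<^sup>2" .
  moreover have "(\<Sum>j<card D'. Z (h j) \<omega> *\<^sub>R A (h j)) = (\<Sum>k\<in>D. Z (e k) \<omega> *\<^sub>R A (e k))" for \<omega>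
  proof -
    have "(\<Sum>j<card D'. Z (h j) \<omega> *\<^sub>R A (h j)) = (\<Sum>k\<in>D'. Z (e k) \<omega> *\<^sub>R A (e k))"
      unfolding h_def by (rule sum.reindex_bij_betw[OF g])
    also have "\<dots> = (\<Sum>k\<in>D. Z (e k) \<omega> *\<^sub>R A (e k))"
      using fD z by (intro sum.mono_neutral_left) (auto simp: D'_def)
    finally show ?thesis .
  qed
  ultimately show ?thesis by simp
qed

text \<open>The empty orthonormal system contributes the value 0.\<close>

lemma gamma_norm_nonneg:
  fixes A :: "('t \<Rightarrow> real) \<Rightarrow> 'x"
  assumes "bdd_above (gamma_values H ip A)"
  shows "0 \<le> gamma_norm H ip A"
proof -
  have "orthonormal_system H ip 0 (\<lambda>_ _. 0)" by (simp add: orthonormal_system_def)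
  then have "sqrt (\<integral>g. (norm (\<Sum>k<0. g k *\<^sub>R A ((\<lambda>_ _. 0) k)))\<^sup>2 \<partial>std_gaussian_sequence) \<in> gamma_values H ip A"
    unfolding gamma_values_def by (intro CollectI exI[of _ 0] exI[of _ "\<lambda>_ _. 0"] conjI refl)
  from cSup_upper[OF this assms] show ?thesis by (simp add: gamma_norm_def)
qed

text \<open>Write \<open>A = (A - F) + F\<close> with \<open>F\<close> of finite rank. The
  \<gamma>-norm bounds the first part uniformly over all blocks of indices, and the second part has
  vanishing tails.\<close>

lemma gamma_radonifying_tail:
  fixes A :: "('t \<Rightarrow> real) \<Rightarrow> 'x"
  assumes e: "\<And>D. finite D \<Longrightarrow> orthonormal_or_zero D (e :: nat \<Rightarrow> _)" and A: "gamma_radonifying H ip A" and \<epsilon>: "\<epsilon> > 0"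
  shows "\<exists>l. \<forall>l'\<ge>l. \<forall>m. (\<integral>\<omega>. (norm (\<Sum>k=l'..<m. Z (e k) \<omega> *\<^sub>R A (e k)))\<^sup>2 \<partial>M) < \<epsilon>"
proof -
  have eH: "e k \<in> H" for k using orthonormal_or_zero_in[OF e[of "{k}"]] by simp
  \<comment> \<open>Both parts then have mean square below \<open>\<epsilon> / 4\<close>, and the
    bound for the square of a sum doubles each.\<close>
  have "sqrt \<epsilon> / 2 > 0" using \<epsilon> by simp
  then obtain F where F: "F \<in> gamma_infty H ip" "finite_rank_on H F" "gamma_norm H ip (\<lambda>h. A h - F h) < sqrt \<epsilon> / 2"
    using A unfolding gamma_radonifying_def by blast
  have A\<gamma>: "A \<in> gamma_infty H ip" using A by (simp add: gamma_radonifying_def)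
  have boF: "bounded_operator_on H ip F" and bF: "bdd_above (gamma_values H ip F)"
    and boA: "bounded_operator_on H ip A" and bA: "bdd_above (gamma_values H ip A)"
    using F(1) A\<gamma> by (auto simp: gamma_infty_def)
  have zero: "G (\<lambda>s. 0) = 0" if "bounded_operator_on H ip G" for G :: "('t \<Rightarrow> real) \<Rightarrow> 'x"
  proof -
    have "\<forall>c. \<forall>x\<in>H. G (\<lambda>s. c * x s) = c *\<^sub>R G x" using that by (simp add: bounded_operator_on_def)
    from this[rule_format, OF zero_in, of 0] show ?thesis by simp
  qed
  \<comment> \<open>A real supremum bounds the values only if the set is bounded above, so this has
    to be known before the \<gamma>-norm of the difference can be used.\<close>
  have bAF: "bdd_above (gamma_values H ip (\<lambda>h. A h - F h))"
  proof (rule gamma_valuesI(1))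
    fix n h assume on: "orthonormal_system H ip n h"
    have hH: "h k \<in> H" if "k \<in> {..<n}" for k using on that by (simp add: orthonormal_system_def)
    have "(\<integral>\<omega>. (norm (\<Sum>k<n. Z (h k) \<omega> *\<^sub>R (A (h k) - F (h k))))\<^sup>2 \<partial>M)
       = (\<integral>\<omega>. (norm ((\<Sum>k<n. Z (h k) \<omega> *\<^sub>R A (h k)) - (\<Sum>k<n. Z (h k) \<omega> *\<^sub>R F (h k))))\<^sup>2 \<partial>M)"
      by (simp add: scaleR_diff_right sum_subtractf)
    also have "\<dots> \<le> 2 * (\<integral>\<omega>. (norm (\<Sum>k<n. Z (h k) \<omega> *\<^sub>R A (h k)))\<^sup>2 \<partial>M) + 2 * (\<integral>\<omega>. (norm (\<Sum>k<n. Z (h k) \<omega> *\<^sub>R F (h k)))\<^sup>2 \<partial>M)"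
      by (rule integrable_norm_sq_diff(2)) (use hH in \<open>auto intro!: integrable_sum_Z\<close>)
    also have "\<dots> \<le> 2 * (gamma_norm H ip A)\<^sup>2 + 2 * (gamma_norm H ip F)\<^sup>2"
      using gamma_values_bound[OF bA on] gamma_values_bound[OF bF on] by simp
    finally show "(\<integral>\<omega>. (norm (\<Sum>k<n. Z (h k) \<omega> *\<^sub>R (A (h k) - F (h k))))\<^sup>2 \<partial>M) \<le> 2 * (gamma_norm H ip A)\<^sup>2 + 2 * (gamma_norm H ip F)\<^sup>2" .
  qed
  have "(gamma_norm H ip (\<lambda>h. A h - F h))\<^sup>2 < (sqrt \<epsilon> / 2)\<^sup>2"
    by (rule power_strict_mono[OF F(3) gamma_norm_nonneg[OF bAF]]) simp
  then have g: "(gamma_norm H ip (\<lambda>h. A h - F h))\<^sup>2 < \<epsilon> / 4" using \<epsilon> by (simp add: power_divide)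
  have "\<epsilon> / 4 > 0" using \<epsilon> by simp
  from finite_rank_tail[OF e boF F(2) this] obtain l where
    l: "\<And>l' m. l' \<ge> l \<Longrightarrow> (\<integral>\<omega>. (norm (\<Sum>k=l'..<m. Z (e k) \<omega> *\<^sub>R F (e k)))\<^sup>2 \<partial>M) < \<epsilon> / 4" by auto
  have "(\<integral>\<omega>. (norm (\<Sum>k=l'..<m. Z (e k) \<omega> *\<^sub>R A (e k)))\<^sup>2 \<partial>M) < \<epsilon>" if l': "l' \<ge> l" for l' m
  proof -
    have "(\<integral>\<omega>. (norm (\<Sum>k=l'..<m. Z (e k) \<omega> *\<^sub>R A (e k)))\<^sup>2 \<partial>M)
       = (\<integral>\<omega>. (norm ((\<Sum>k=l'..<m. Z (e k) \<omega> *\<^sub>R (A (e k) - F (e k))) + (\<Sum>k=l'..<m. Z (e k) \<omega> *\<^sub>R F (e k))))\<^sup>2 \<partial>M)"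
      by (simp add: scaleR_diff_right sum_subtractf)
    also have "\<dots> \<le> 2 * (\<integral>\<omega>. (norm (\<Sum>k=l'..<m. Z (e k) \<omega> *\<^sub>R (A (e k) - F (e k))))\<^sup>2 \<partial>M) + 2 * (\<integral>\<omega>. (norm (\<Sum>k=l'..<m. Z (e k) \<omega> *\<^sub>R F (e k)))\<^sup>2 \<partial>M)"
      by (rule integrable_norm_sq_add(2)) (auto intro!: integrable_sum_Z eH)
    also have "(\<integral>\<omega>. (norm (\<Sum>k=l'..<m. Z (e k) \<omega> *\<^sub>R (A (e k) - F (e k))))\<^sup>2 \<partial>M) \<le> (gamma_norm H ip (\<lambda>h. A h - F h))\<^sup>2"
      by (rule gamma_values_bound_orthonormal_or_zero[OF bAF e]) (simp_all add: zero[OF boA] zero[OF boF])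
    finally show ?thesis using g l[OF l', of m] by linarith
  qed
  then show ?thesis by blast
qed

end

text \<open>The vectors come from the kernel functions at a separating sequence, so a countable
  system suffices although the index set may be uncountable. The tail estimate makes the random
  series Cauchy in mean square, and functionals and evaluations pass to its limit.\<close>

lemma element_of_gamma_radonifying:
  fixes evl :: "'x::{banach,second_countable_topology} \<Rightarrow> 't \<Rightarrow> real" and M :: "'w measure"
  assumes rk: "rkbs evl" and RK: "is_rkhs K H ip" and iso: "isonormal H ip M Z"
    and sub: "H \<subseteq> rkbs_space evl" and rad: "gamma_radonifying H ip (rkbs_inclusion evl)"
  obtains \<eta> where "\<eta> \<in> borel_measurable M"
    "\<And>f :: 'x \<Rightarrow> real. bounded_linear f \<Longrightarrow> centered_gaussian_rv M (\<lambda>\<omega>. f (\<eta> \<omega>))"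
    "\<And>t. AE \<omega> in M. Z (\<lambda>s. K s t) \<omega> = evl (\<eta> \<omega>) t"
proof -
  interpret isonormal H ip M Z by (rule iso)
  have bl: "bounded_linear (\<lambda>x. evl x t)" for t using rk by (auto simp: rkbs_def)
  obtain t :: "nat \<Rightarrow> 't" where t: "inj (\<lambda>x n. evl x (t n))" by (rule rkbs_separating_sequence[OF rk])
  interpret isonormal_banach H ip M Z "\<lambda>x n. evl x (t n)"
    by unfold_locales (simp_all add: t rkbs_coordinates[OF rk])
  define k where "k n = (\<lambda>s. K s (t n))" for n
  have KH: "(\<lambda>s. K s u) \<in> H" and rep: "x \<in> H \<Longrightarrow> ip x (\<lambda>s. K s u) = x u" for x u
    using RK by (auto simp: is_rkhs_def)
  have kH: "k n \<in> H" and repk: "x \<in> H \<Longrightarrow> ip x (k n) = x (t n)" for x n unfolding k_def by (rule KH, rule rep)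
  define e where "e = gram_schmidt ip k"
  have e: "orthonormal_or_zero D e" if "finite D" for D unfolding e_def by (rule gram_schmidt_orthonormal_or_zero[OF kH that])
  have eH: "e j \<in> H" for j using orthonormal_or_zero_in[OF e[of "{j}"]] by simp
  define \<iota> where "\<iota> = rkbs_inclusion evl"
  have \<iota>e: "evl (\<iota> h) = h" if "h \<in> H" for h unfolding \<iota>_def using sub that by (intro rkbs_inclusion_evl[OF rk]) auto
  \<comment> \<open>A vector orthogonal to all \<open>e j\<close> is orthogonal to the kernel
    functions at the points \<open>t n\<close>, hence vanishes there. As an element of
    \<open>X\<close> it is then zero, because these evaluations separate points. This uses that
    \<open>H\<close> is contained in \<open>X\<close>.\<close>
  have total: "y = (\<lambda>s. 0)" if y: "y \<in> H" and o: "\<And>j. ip y (e j) = 0" for y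
  proof -
    have "evl (\<iota> y) (t n) = evl 0 (t n)" for n
    proof -
      have "y (t n) = ip (k n) y" using repk[OF y] ip_sym[OF y kH] by simp
      also have "k n = proj {..<Suc n} e (k n)" unfolding e_def by (rule gram_schmidt_expand[OF kH]) simp
      also have "ip (proj {..<Suc n} e (k n)) y = (\<Sum>j<Suc n. ip (k n) (e j) * ip y (e j))" by (intro ip_proj e kH y) simp
      also have "\<dots> = 0" using o by simp
      finally show ?thesis using \<iota>e[OF y] \<phi>_zero by simp
    qed
    then have "\<iota> y = 0" using injD[OF t, of "\<iota> y" 0] by (simp add: fun_eq_iff)
    then have "y = evl 0" using \<iota>e[OF y] by simp
    moreover have "evl 0 s = 0" for s using linear_0[OF bounded_linear.linear[OF bl[of s]]] .
    ultimately show ?thesis by (simp add: fun_eq_iff)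
  qed
  define f where "f m \<omega> = (\<Sum>j<m. Z (e j) \<omega> *\<^sub>R \<iota> (e j))" for m \<omega>
  have fm[measurable]: "f m \<in> borel_measurable M" for m unfolding f_def by measurable
  have fsq: "integrable M (\<lambda>\<omega>. (norm (f m \<omega>))\<^sup>2)" for m unfolding f_def by (intro integrable_sum_Z eH) simp
  have fi: "integrable M (\<lambda>\<omega>. (norm (f m \<omega> - f n \<omega>))\<^sup>2)" for m n
    by (rule integrable_norm_sq_diff(1)[OF _ _ fsq fsq]) measurable
  have fd: "f m \<omega> - f l \<omega> = (\<Sum>j=l..<m. Z (e j) \<omega> *\<^sub>R \<iota> (e j))" if "l \<le> m" for l m \<omega>
    unfolding f_def using sum_diff_nat_ivl[of 0 l m "\<lambda>j. Z (e j) \<omega> *\<^sub>R \<iota> (e j)"] that by (simp add: lessThan_atLeast0)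
  have cau: "\<exists>N. \<forall>m\<ge>N. \<forall>n\<ge>N. (\<integral>\<omega>. (norm (f m \<omega> - f n \<omega>))\<^sup>2 \<partial>M) < \<epsilon>" if \<epsilon>: "\<epsilon> > 0" for \<epsilon>
  proof -
    obtain N where N: "\<And>l m. l \<ge> N \<Longrightarrow> (\<integral>\<omega>. (norm (\<Sum>j=l..<m. Z (e j) \<omega> *\<^sub>R \<iota> (e j)))\<^sup>2 \<partial>M) < \<epsilon>"
      using gamma_radonifying_tail[OF e rad \<epsilon>] unfolding \<iota>_def by blast
    have "(\<integral>\<omega>. (norm (f m \<omega> - f n \<omega>))\<^sup>2 \<partial>M) < \<epsilon>" if mn: "m \<ge> N" "n \<ge> N" for m n
    proof (cases "n \<le> m")
      case True then show ?thesis using N[OF mn(2), of m] by (simp add: fd)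
    next
      case False
      then have "(\<integral>\<omega>. (norm (f n \<omega> - f m \<omega>))\<^sup>2 \<partial>M) < \<epsilon>" using N[OF mn(1), of n] by (simp add: fd)
      then show ?thesis by (simp add: norm_minus_commute)
    qed
    then show ?thesis by blast
  qed
  obtain \<eta> where \<eta>[measurable]: "\<eta> \<in> borel_measurable M"
    and \<eta>i: "\<And>n. integrable M (\<lambda>\<omega>. (norm (f n \<omega> - \<eta> \<omega>))\<^sup>2)"
    and \<eta>l: "(\<lambda>n. \<integral>\<omega>. (norm (f n \<omega> - \<eta> \<omega>))\<^sup>2 \<partial>M) \<longlonglongrightarrow> 0"
    using L2_complete[where f=f, OF fm fi cau] by blast
  have functional: "integrable M (\<lambda>\<omega>. (g (f n \<omega>) - g (\<eta> \<omega>))\<^sup>2)"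
    "(\<lambda>n. \<integral>\<omega>. (g (f n \<omega>) - g (\<eta> \<omega>))\<^sup>2 \<partial>M) \<longlonglongrightarrow> 0" 
    "AE \<omega> in M. Z (lin_comb {..<n} (\<lambda>j. g (\<iota> (e j))) e) \<omega> = g (f n \<omega>)"
    and gm: "g \<in> borel_measurable borel" if g: "bounded_linear g" for g :: "'x \<Rightarrow> real" and n
  proof -
    interpret g: bounded_linear g by (rule g)
    show [measurable]: "g \<in> borel_measurable borel" by (intro borel_measurable_continuous_onI linear_continuous_on g)
    obtain c where c: "\<And>x. norm (g x) \<le> norm x * c" using g.bounded by blast
    have b: "(g (f n \<omega>) - g (\<eta> \<omega>))\<^sup>2 \<le> c\<^sup>2 * (norm (f n \<omega> - \<eta> \<omega>))\<^sup>2" for n \<omega>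
    proof -
      have "\<bar>g (f n \<omega>) - g (\<eta> \<omega>)\<bar> \<le> norm (f n \<omega> - \<eta> \<omega>) * c" using c[of "f n \<omega> - \<eta> \<omega>"] by (simp add: g.diff)
      then have "\<bar>g (f n \<omega>) - g (\<eta> \<omega>)\<bar>\<^sup>2 \<le> (norm (f n \<omega> - \<eta> \<omega>) * c)\<^sup>2" by (rule power_mono) simp
      then show ?thesis by (simp add: power_mult_distrib mult.commute)
    qed
    have i': "integrable M (\<lambda>\<omega>. c\<^sup>2 * (norm (f n \<omega> - \<eta> \<omega>))\<^sup>2)" for n using \<eta>i by simp
    have i: "integrable M (\<lambda>\<omega>. (g (f n \<omega>) - g (\<eta> \<omega>))\<^sup>2)" for n
      by (rule Bochner_Integration.integrable_bound[OF i'[of n]]) (auto intro!: AE_I2 order_trans[OF b])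
    then show "integrable M (\<lambda>\<omega>. (g (f n \<omega>) - g (\<eta> \<omega>))\<^sup>2)" .
    show "(\<lambda>n. \<integral>\<omega>. (g (f n \<omega>) - g (\<eta> \<omega>))\<^sup>2 \<partial>M) \<longlonglongrightarrow> 0"
    proof (rule Lim_null_comparison)
      show "(\<lambda>n. c\<^sup>2 * (\<integral>\<omega>. (norm (f n \<omega> - \<eta> \<omega>))\<^sup>2 \<partial>M)) \<longlonglongrightarrow> 0" using tendsto_mult_left[OF \<eta>l, of "c\<^sup>2"] by simp
      have "norm (\<integral>\<omega>. (g (f n \<omega>) - g (\<eta> \<omega>))\<^sup>2 \<partial>M) \<le> c\<^sup>2 * (\<integral>\<omega>. (norm (f n \<omega> - \<eta> \<omega>))\<^sup>2 \<partial>M)" for n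
        using integral_mono[OF i i' b, of n] by simp
      then show "\<forall>\<^sub>F n in sequentially. norm (\<integral>\<omega>. (g (f n \<omega>) - g (\<eta> \<omega>))\<^sup>2 \<partial>M) \<le> c\<^sup>2 * (\<integral>\<omega>. (norm (f n \<omega> - \<eta> \<omega>))\<^sup>2 \<partial>M)" by simp
    qed
    have "AE \<omega> in M. Z (lin_comb {..<n} (\<lambda>j. g (\<iota> (e j))) e) \<omega> = (\<Sum>j<n. g (\<iota> (e j)) * Z (e j) \<omega>)"
      by (rule Z_lin_comb) (simp_all add: eH)
    then show "AE \<omega> in M. Z (lin_comb {..<n} (\<lambda>j. g (\<iota> (e j))) e) \<omega> = g (f n \<omega>)"
      by (simp add: f_def g.sum g.scaleR mult.commute)
  qed
  have lcH: "lin_comb {..<n} a e \<in> H" for n a by (rule lin_comb_in) (simp_all add: eH)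
  have gauss: "centered_gaussian_rv M (\<lambda>\<omega>. g (\<eta> \<omega>))" if g: "bounded_linear g" for g :: "'x \<Rightarrow> real"
  proof -
    note [measurable] = gm[OF g]
    \<comment> \<open>\<open>L2_limit_centered_gaussian\<close> asks for variables of the form
      \<open>Z h\<close>, while \<open>g (f n)\<close> is one of these only almost surely.\<close>
    have ae: "AE \<omega> in M. (Z (lin_comb {..<n} (\<lambda>j. g (\<iota> (e j))) e) \<omega> - g (\<eta> \<omega>))\<^sup>2 = (g (f n \<omega>) - g (\<eta> \<omega>))\<^sup>2" for n
      using functional(3)[OF g, of n] by eventually_elim simp
    have eq: "(\<integral>\<omega>. (Z (lin_comb {..<n} (\<lambda>j. g (\<iota> (e j))) e) \<omega> - g (\<eta> \<omega>))\<^sup>2 \<partial>M) = (\<integral>\<omega>. (g (f n \<omega>) - g (\<eta> \<omega>))\<^sup>2 \<partial>M)" for n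
      by (rule integral_cong_AE[OF _ _ ae]) measurable
    have ieq: "integrable M (\<lambda>\<omega>. (Z (lin_comb {..<n} (\<lambda>j. g (\<iota> (e j))) e) \<omega> - g (\<eta> \<omega>))\<^sup>2) = integrable M (\<lambda>\<omega>. (g (f n \<omega>) - g (\<eta> \<omega>))\<^sup>2)" for n
      by (rule integrable_cong_AE[OF _ _ ae]) measurable
    show ?thesis
      by (rule L2_limit_centered_gaussian[where h="\<lambda>n. lin_comb {..<n} (\<lambda>j. g (\<iota> (e j))) e"])
        (simp_all add: lcH eq ieq functional(1,2)[OF g])
  qed
  have eval: "AE \<omega> in M. Z (\<lambda>s. K s u) \<omega> = evl (\<eta> \<omega>) u" for u
  proof -
    define g where "g x = evl x u" for x
    have g: "bounded_linear g" unfolding g_def by (rule bl)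
    note [measurable] = gm[OF g]
    define q where "q = (\<lambda>s. K s u)"
    have q: "q \<in> H" unfolding q_def by (rule KH)
    \<comment> \<open>The value of \<open>e j\<close> at \<open>u\<close> is its inner product with
      the kernel function \<open>q\<close>. So the partial sums evaluated at \<open>u\<close> are
      \<open>Z\<close> of the projections of \<open>q\<close>, and these projections converge to
      \<open>q\<close>.\<close>
    have lcp: "lin_comb {..<n} (\<lambda>j. g (\<iota> (e j))) e = proj {..<n} e q" for n
      unfolding proj_def g_def \<iota>e[OF eH] using rep[OF eH] ip_sym[OF q eH] by (simp add: q_def)
    have P: "proj {..<n} e q \<in> H" for n by (intro proj_in e) simp
    define b where "b n = ip (\<lambda>s. proj {..<n} e q s - q s) (\<lambda>s. proj {..<n} e q s - q s)" for n
    have bl0: "b \<longlonglongrightarrow> 0" unfolding b_def by (rule proj_converges[OF e q total])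
    define a where "a n = (\<integral>\<omega>. (g (f n \<omega>) - g (\<eta> \<omega>))\<^sup>2 \<partial>M)" for n
    have al: "a \<longlonglongrightarrow> 0" unfolding a_def by (rule functional(2)[OF g])
    \<comment> \<open>Compares \<open>Z q\<close> with the evaluation of \<open>\<eta>\<close> by
      way of \<open>Z\<close> of the \<open>n\<close>-th projection of \<open>q\<close>; both errors
      tend to zero.\<close>
    have le: "integrable M (\<lambda>\<omega>. (Z q \<omega> - g (\<eta> \<omega>))\<^sup>2)" "(\<integral>\<omega>. (Z q \<omega> - g (\<eta> \<omega>))\<^sup>2 \<partial>M) \<le> 2 * b n + 2 * a n" for n
    proof -
      have PH: "(\<lambda>s. proj {..<n} e q s - q s) \<in> H" by (intro diff_in P q)
      have ae: "AE \<omega> in M. (norm (- Z (\<lambda>s. proj {..<n} e q s - q s) \<omega> + (g (f n \<omega>) - g (\<eta> \<omega>))))\<^sup>2 = (Z q \<omega> - g (\<eta> \<omega>))\<^sup>2"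
        using functional(3)[OF g, of n, unfolded lcp] Z_diff[OF P[of n] q] by eventually_elim simp
      have s: "integrable M (\<lambda>\<omega>. (norm (- Z (\<lambda>s. proj {..<n} e q s - q s) \<omega>))\<^sup>2)" "integrable M (\<lambda>\<omega>. (norm (g (f n \<omega>) - g (\<eta> \<omega>)))\<^sup>2)"
        using Z_sq[OF PH] functional(1)[OF g, of n] by simp_all
      note p = integrable_norm_sq_add[OF _ _ s]
      have i1: "integrable M (\<lambda>\<omega>. (norm (- Z (\<lambda>s. proj {..<n} e q s - q s) \<omega> + (g (f n \<omega>) - g (\<eta> \<omega>))))\<^sup>2)"
        by (rule p(1)) measurable
      show "integrable M (\<lambda>\<omega>. (Z q \<omega> - g (\<eta> \<omega>))\<^sup>2)"
        by (rule integrable_cong_AE_imp[OF i1]) (measurable, use ae in \<open>auto elim!: eventually_mono\<close>)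
      have "(\<integral>\<omega>. (Z q \<omega> - g (\<eta> \<omega>))\<^sup>2 \<partial>M) = (\<integral>\<omega>. (norm (- Z (\<lambda>s. proj {..<n} e q s - q s) \<omega> + (g (f n \<omega>) - g (\<eta> \<omega>))))\<^sup>2 \<partial>M)"
        by (rule integral_cong_AE[symmetric, OF _ _ ae]) measurable
      also have "\<dots> \<le> 2 * (\<integral>\<omega>. (norm (- Z (\<lambda>s. proj {..<n} e q s - q s) \<omega>))\<^sup>2 \<partial>M) + 2 * (\<integral>\<omega>. (norm (g (f n \<omega>) - g (\<eta> \<omega>)))\<^sup>2 \<partial>M)"
        by (rule p(2)) measurable
      also have "\<dots> = 2 * b n + 2 * a n"
        using Z_ip[OF PH PH] by (simp add: b_def a_def power2_eq_square)
      finally show "(\<integral>\<omega>. (Z q \<omega> - g (\<eta> \<omega>))\<^sup>2 \<partial>M) \<le> 2 * b n + 2 * a n" .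
    qed
    have "(\<lambda>n. 2 * b n + 2 * a n) \<longlonglongrightarrow> 2 * 0 + 2 * 0" by (intro tendsto_intros bl0 al)
    then have "(\<integral>\<omega>. (Z q \<omega> - g (\<eta> \<omega>))\<^sup>2 \<partial>M) \<le> 2 * 0 + 2 * 0"
      by (rule LIMSEQ_le_const) (use le(2) in blast)
    then have "(\<integral>\<omega>. (Z q \<omega> - g (\<eta> \<omega>))\<^sup>2 \<partial>M) = 0" by (intro antisym) simp_all
    then have "AE \<omega> in M. (Z q \<omega> - g (\<eta> \<omega>))\<^sup>2 = 0"
      using integral_nonneg_eq_0_iff_AE[OF le(1)] by simp
    then show ?thesis by eventually_elim (simp add: q_def g_def)
  qed
  show thesis by (rule that[OF \<eta> gauss eval])
qed

lemma measurable_dual_sigma_algebra: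
  fixes \<eta> :: "'w \<Rightarrow> 'x::{banach,second_countable_topology}"
  assumes [measurable]: "\<eta> \<in> borel_measurable M"
  shows "\<eta> \<in> measurable M dual_sigma_algebra"
  unfolding dual_sigma_algebra_def
proof (rule measurable_measure_of)
  fix y assume "y \<in> {f -` B | (f :: 'x \<Rightarrow> real) B. bounded_linear f \<and> B \<in> sets borel}"
  then obtain f :: "'x \<Rightarrow> real" and B where y: "y = f -` B" and f: "bounded_linear f" and B: "B \<in> sets borel" by blast
  have "f \<in> borel_measurable borel" by (intro borel_measurable_continuous_onI linear_continuous_on f)
  from measurable_sets[OF this B] have "y \<in> sets borel" by (simp add: y)
  then show "\<eta> -` y \<inter> space M \<in> sets M" by (rule measurable_sets[OF assms])
qed auto

theorem theorem1p1:
  fixes M :: "'w measure"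
    and evl :: "'x::{banach,second_countable_topology} \<Rightarrow> 't \<Rightarrow> real"
    and \<xi> :: "'t \<Rightarrow> 'w \<Rightarrow> real"
    and K :: "'t \<Rightarrow> 't \<Rightarrow> real"
    and H :: "('t \<Rightarrow> real) set"
    and ip :: "('t \<Rightarrow> real) \<Rightarrow> ('t \<Rightarrow> real) \<Rightarrow> real"
  assumes "prob_space M"
    and "complete_measure M"
    and "rkbs evl"
    and "centered_gaussian_process M \<xi>"
    and "K = covariance_function M \<xi>"
    and "is_rkhs K H ip"
  shows "(H \<subseteq> rkbs_space evl \<and> gamma_radonifying H ip (rkbs_inclusion evl) \<longrightarrow>
           (\<exists>\<eta> :: 'w \<Rightarrow> 'x. centered_gaussian_element M \<eta> \<and>
              (\<forall>t. AE \<omega> in M. \<xi> t \<omega> = evl (\<eta> \<omega>) t))) \<and>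
         (\<not> H \<subseteq> rkbs_space evl \<or> \<not> gamma_radonifying H ip (rkbs_inclusion evl) \<longrightarrow>
           {\<omega> \<in> space M. (\<lambda>t. \<xi> t \<omega>) \<in> rkbs_space evl} \<in> null_sets M)"
proof (intro conjI impI)
  from isonormal_exists[OF assms(1,4,5,6)] obtain Z where iso: "isonormal H ip M Z"
    and \<xi>Z: "\<And>t. AE \<omega> in M. \<xi> t \<omega> = Z (\<lambda>s. K s t) \<omega>" by blast
  {
    assume *: "H \<subseteq> rkbs_space evl \<and> gamma_radonifying H ip (rkbs_inclusion evl)"
    obtain \<eta> :: "'w \<Rightarrow> 'x" where \<eta>: "\<eta> \<in> borel_measurable M"
      and gauss: "\<And>f :: 'x \<Rightarrow> real. bounded_linear f \<Longrightarrow> centered_gaussian_rv M (\<lambda>\<omega>. f (\<eta> \<omega>))"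
      and Z\<eta>: "\<And>t. AE \<omega> in M. Z (\<lambda>s. K s t) \<omega> = evl (\<eta> \<omega>) t"
      using element_of_gamma_radonifying[OF assms(3,6) iso conjunct1[OF *] conjunct2[OF *]] by blast
    have "AE \<omega> in M. \<xi> t \<omega> = evl (\<eta> \<omega>) t" for t using \<xi>Z[of t] Z\<eta>[of t] by eventually_elim simp
    then show "\<exists>\<eta> :: 'w \<Rightarrow> 'x. centered_gaussian_element M \<eta> \<and> (\<forall>t. AE \<omega> in M. \<xi> t \<omega> = evl (\<eta> \<omega>) t)"
      using measurable_dual_sigma_algebra[OF \<eta>] gauss unfolding centered_gaussian_element_def by blast
  }
  assume *: "\<not> H \<subseteq> rkbs_space evl \<or> \<not> gamma_radonifying H ip (rkbs_inclusion evl)"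
  show "{\<omega> \<in> space M. (\<lambda>t. \<xi> t \<omega>) \<in> rkbs_space evl} \<in> null_sets M"
  \<comment> \<open>By contraposition: a path event that is not null produces a random element, and
    this forces both the inclusion and the radonifying property.\<close>
  proof (rule ccontr)
    assume nonnull: "{\<omega> \<in> space M. (\<lambda>t. \<xi> t \<omega>) \<in> rkbs_space evl} \<notin> null_sets M"
    have \<xi>m: "\<xi> t \<in> borel_measurable M" for t using assms(4) by (simp add: centered_gaussian_process_def)
    obtain \<eta> where \<eta>: "\<eta> \<in> borel_measurable M" and \<xi>\<eta>: "\<And>t. AE \<omega> in M. \<xi> t \<omega> = evl (\<eta> \<omega>) t"
      using element_of_paths_nonnull[OF assms(3,6) iso assms(2) \<xi>m \<xi>Z nonnull] by blast
    have "AE \<omega> in M. evl (\<eta> \<omega>) t = Z (\<lambda>s. K s t) \<omega>" for t using \<xi>Z[of t] \<xi>\<eta>[of t] by eventually_elim simp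
    from gamma_radonifying_of_element[OF assms(3,6) iso \<eta> this] show False using * by blast
  qed
qed

end
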